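(* (Associated Al-Salam–Chihara case.) Let $0<|q|<1$, let $A,B,\delta$ be nonzero complex numbers, and let $$a_n=(1+\delta^{-1})q^n,\qquad b_n^2=\frac{q}{AB\delta}(1-Aq^{n-1})(1-Bq^{n-1}),$$ with $b_n^2\ne0$ for $n\ge1$. Let $\gamma=2(q/(AB\delta))^{1/2}$ and $\Lambda_\pm=\frac12\big(z\pm\sqrt{z^2-\gamma^2}\big)$. For $z/\gamma=x\in\mathbb{C}\setminus[-1,1]$, with the branch chosen so that $|\Lambda_-/\Lambda_+|<1$, $$\cfrac{1}{z-a_0-\cfrac{b_1^2}{z-a_1-\cfrac{b_2^2}{z-a_2-\cdots}}}=\frac{AB\delta\Lambda_-}{q(1-AB\Lambda_-/q)}\;\frac{{}_2\phi_1\left(\begin{matrix}B\Lambda_-,\,B\\ AB\Lambda_-\end{matrix};A\delta\Lambda_-\right)}{{}_2\phi_1\left(\begin{matrix}B\Lambda_-,\,B/q\\ AB\Lambda_-/q\end{matrix};A\delta\Lambda_-\right)}=\int_{-1}^1\frac{\omega(t)\,dt}{z-\gamma t}+\text{possible pole terms},$$ where, for $x\in(-1,1)$, $x=\frac12(u+u^{-1})$, $\Lambda_\pm=\frac\gamma2\big(x\pm i\sqrt{1-x^2}\big)$, $$\omega(x)=\frac{1}{2\pi\sqrt{1-x^2}}\;\frac{(A,B,u^{-2},u^2)_\infty}{\left(\frac{A\delta\gamma u}{2},\frac{A\delta\gamma}{2u},\frac{AB\gamma u}{2q},\frac{AB\gamma}{2qu}\right)_\infty}\left[{}_2\phi_1\left(\begin{matrix}B\Lambda_-,\,B/q\\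 AB\Lambda_-/q\end{matrix};A\delta\Lambda_-\right){}_2\phi_1\left(\begin{matrix}B\Lambda_+,\,B/q\\ AB\Lambda_+/q\end{matrix};A\delta\Lambda_+\right)\right]^{-1}.$$
   Context: Notation: $(a)_k=\prod_{j=0}^{k-1}(1-aq^j)$ ($k$ a nonnegative integer or $\infty$), $(a_1,\dots,a_m)_k=\prod_i(a_i)_k$, and ${}_2\phi_1\left(\begin{matrix}a,b\\ c\end{matrix};w\right)=\sum_{k\ge0}\frac{(a)_k(b)_k}{(c)_k(q)_k}w^k$ for $|w|<1$, and by analytic continuation for $|w|\ge1$. "Possible pole terms" are contributions from possible pole singularities of the function on the left.
   Formalization: The integral representation (only it) is stated under the condition that ω has no pole inside (-1,1); otherwise the integral does not exist, e.g. q=B=A=1/2, δ=2i, where ω has a simple pole at an interior point. *)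

theory Defs
  imports "HOL-Complex_Analysis.Complex_Analysis"
begin

section \<open>Basic hypergeometric series\<close>

definition qpoch :: "complex \<Rightarrow> complex \<Rightarrow> nat \<Rightarrow> complex" where
  "qpoch q a k = (\<Prod>j<k. 1 - a * q ^ j)"

definition qpoch_inf :: "complex \<Rightarrow> complex \<Rightarrow> complex" where
  "qpoch_inf q a = (\<Prod>j. 1 - a * q ^ j)"

definition phi21_series :: "complex \<Rightarrow> complex \<Rightarrow> complex \<Rightarrow> complex \<Rightarrow> complex \<Rightarrow> complex" where
  "phi21_series q a b c w =
     (\<Sum>k. qpoch q a k * qpoch q b k / (qpoch q c k * qpoch q q k) * w ^ k)"

text \<open>
  As a function of \<open>w\<close>, the series continues analytically to the plane without the points
  \<open>q\<^sup>-\<^sup>k\<close> (\<open>k \<ge> 0\<close>), where it has at most poles. This domain is connected, so the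
  continuation is unique. At the excluded points \<open>w = q\<^sup>-\<^sup>k\<close>, and for \<open>c = q\<^sup>-\<^sup>k\<close>, the value
  is meaningless.
\<close>

definition phi21 :: "complex \<Rightarrow> complex \<Rightarrow> complex \<Rightarrow> complex \<Rightarrow> complex \<Rightarrow> complex" where
  "phi21 q a b c w =
     (if norm w < 1 then phi21_series q a b c w
      else (THE v. \<exists>F. F holomorphic_on {\<zeta>. \<forall>k::nat. \<zeta> * q ^ k \<noteq> 1} \<and>
                       (\<forall>\<zeta>. norm \<zeta> < 1 \<longrightarrow> F \<zeta> = phi21_series q a b c \<zeta>) \<and>
                       v = F w))"


section \<open>Continued fractions\<close>

text \<open>
  Numerators and denominators of the approximants of
  \<open>\<alpha>\<^sub>0 / (\<beta>\<^sub>0 + \<alpha>\<^sub>1 / (\<beta>\<^sub>1 + \<alpha>\<^sub>2 / (\<beta>\<^sub>2 + \<dots>)))\<close>. Working with them, and not with nested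
  quotients, avoids a wrong value when a tail of a finite approximant is infinite
  (in HOL, \<open>x / 0 = 0\<close>).
\<close>

fun cf_num :: "(nat \<Rightarrow> complex) \<Rightarrow> (nat \<Rightarrow> complex) \<Rightarrow> nat \<Rightarrow> complex" where
  "cf_num \<alpha> \<beta> 0 = 0"
| "cf_num \<alpha> \<beta> (Suc 0) = \<alpha> 0"
| "cf_num \<alpha> \<beta> (Suc (Suc n)) = \<beta> (Suc n) * cf_num \<alpha> \<beta> (Suc n) + \<alpha> (Suc n) * cf_num \<alpha> \<beta> n"

fun cf_den :: "(nat \<Rightarrow> complex) \<Rightarrow> (nat \<Rightarrow> complex) \<Rightarrow> nat \<Rightarrow> complex" where
  "cf_den \<alpha> \<beta> 0 = 1"
| "cf_den \<alpha> \<beta> (Suc 0) = \<beta> 0"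
| "cf_den \<alpha> \<beta> (Suc (Suc n)) = \<beta> (Suc n) * cf_den \<alpha> \<beta> (Suc n) + \<alpha> (Suc n) * cf_den \<alpha> \<beta> n"

definition cf_approx :: "(nat \<Rightarrow> complex) \<Rightarrow> (nat \<Rightarrow> complex) \<Rightarrow> nat \<Rightarrow> complex" where
  "cf_approx \<alpha> \<beta> n = cf_num \<alpha> \<beta> n / cf_den \<alpha> \<beta> n"

lemma cf_num_shift:
  "cf_num \<alpha> \<beta> (Suc n) = \<alpha> 0 * cf_den (\<lambda>k. \<alpha> (Suc k)) (\<lambda>k. \<beta> (Suc k)) n"
proof (induction n rule: less_induct)
  case (less m)
  show ?case
  proof (cases m)
    case (Suc k)
    show ?thesis
      using less[of k] less[of "k - 1"] Suc by (cases k) (auto simp: algebra_simps)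
  qed simp
qed

lemma cf_den_shift:
  "cf_den \<alpha> \<beta> (Suc n) = \<beta> 0 * cf_den (\<lambda>k. \<alpha> (Suc k)) (\<lambda>k. \<beta> (Suc k)) n
                       + cf_num (\<lambda>k. \<alpha> (Suc k)) (\<lambda>k. \<beta> (Suc k)) n"
proof (induction n rule: less_induct)
  case (less m)
  show ?case
  proof (cases m)
    case (Suc k)
    show ?thesis
      using less[of k] less[of "k - 1"] Suc by (cases k) (auto simp: algebra_simps)
  qed simp
qed

lemma cf_approx_nested:
  assumes "cf_den (\<lambda>k. \<alpha> (Suc k)) (\<lambda>k. \<beta> (Suc k)) n \<noteq> 0"
  shows "cf_approx \<alpha> \<beta> (Suc n) =
           \<alpha> 0 / (\<beta> 0 + cf_approx (\<lambda>k. \<alpha> (Suc k)) (\<lambda>k. \<beta> (Suc k)) n)"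
  using assms by (simp add: cf_approx_def cf_num_shift cf_den_shift add_divide_eq_iff)

definition cf_converges_to ::
    "(nat \<Rightarrow> complex) \<Rightarrow> (nat \<Rightarrow> complex) \<Rightarrow> complex \<Rightarrow> bool" where
  "cf_converges_to \<alpha> \<beta> v \<longleftrightarrow>
     eventually (\<lambda>n. cf_den \<alpha> \<beta> n \<noteq> 0) sequentially \<and> cf_approx \<alpha> \<beta> \<longlonglongrightarrow> v"

text \<open>Convergence to the point at infinity of the Riemann sphere.\<close>

definition cf_converges_to_infinity :: "(nat \<Rightarrow> complex) \<Rightarrow> (nat \<Rightarrow> complex) \<Rightarrow> bool" where
  "cf_converges_to_infinity \<alpha> \<beta> \<longleftrightarrow>
     eventually (\<lambda>n. cf_num \<alpha> \<beta> n \<noteq> 0) sequentially \<and>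
     (\<lambda>n. cf_den \<alpha> \<beta> n / cf_num \<alpha> \<beta> n) \<longlonglongrightarrow> 0"

definition cf_value :: "(nat \<Rightarrow> complex) \<Rightarrow> (nat \<Rightarrow> complex) \<Rightarrow> complex" where
  "cf_value \<alpha> \<beta> = lim (cf_approx \<alpha> \<beta>)"


section \<open>The associated Al-Salam--Chihara continued fraction\<close>

definition asc_a :: "complex \<Rightarrow> complex \<Rightarrow> nat \<Rightarrow> complex" where
  "asc_a q \<delta> n = (1 + inverse \<delta>) * q ^ n"

text \<open>The squares \<open>b\<^sub>n\<^sup>2\<close>, used for \<open>n \<ge> 1\<close> only.\<close>

definition asc_bsq :: "complex \<Rightarrow> complex \<Rightarrow> complex \<Rightarrow> complex \<Rightarrow> nat \<Rightarrow> complex" where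
  "asc_bsq q A B \<delta> n = q / (A * B * \<delta>) * (1 - A * q ^ (n - 1)) * (1 - B * q ^ (n - 1))"

definition asc_\<alpha> :: "complex \<Rightarrow> complex \<Rightarrow> complex \<Rightarrow> complex \<Rightarrow> nat \<Rightarrow> complex" where
  "asc_\<alpha> q A B \<delta> n = (if n = 0 then 1 else - asc_bsq q A B \<delta> n)"

definition asc_\<beta> :: "complex \<Rightarrow> complex \<Rightarrow> complex \<Rightarrow> nat \<Rightarrow> complex" where
  "asc_\<beta> q \<delta> z n = z - asc_a q \<delta> n"

text \<open>
  The square root of \<open>z\<^sup>2 - \<gamma>\<^sup>2\<close> whose sign gives \<open>\<bar>\<Lambda>\<^sub>-\<bar> < \<bar>\<Lambda>\<^sub>+\<bar>\<close>; such a sign exists exactly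
  when \<open>z / \<gamma>\<close> is not in \<open>[-1, 1]\<close>.
\<close>

definition asc_root :: "complex \<Rightarrow> complex \<Rightarrow> complex" where
  "asc_root \<gamma> z =
     (let s = csqrt (z\<^sup>2 - \<gamma>\<^sup>2) in if norm (z - s) < norm (z + s) then s else - s)"

definition Lambda_minus :: "complex \<Rightarrow> complex \<Rightarrow> complex" where
  "Lambda_minus \<gamma> z = (z - asc_root \<gamma> z) / 2"

definition asc_phi_num :: "complex \<Rightarrow> complex \<Rightarrow> complex \<Rightarrow> complex \<Rightarrow> complex \<Rightarrow> complex" where
  "asc_phi_num q A B \<delta> \<Lambda> = phi21 q (B * \<Lambda>) B (A * B * \<Lambda>) (A * \<delta> * \<Lambda>)"

definition asc_phi_den :: "complex \<Rightarrow> complex \<Rightarrow> complex \<Rightarrow> complex \<Rightarrow> complex \<Rightarrow> complex" where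
  "asc_phi_den q A B \<delta> \<Lambda> = phi21 q (B * \<Lambda>) (B / q) (A * B * \<Lambda> / q) (A * \<delta> * \<Lambda>)"

definition asc_quotient :: "complex \<Rightarrow> complex \<Rightarrow> complex \<Rightarrow> complex \<Rightarrow> complex \<Rightarrow> complex" where
  "asc_quotient q A B \<delta> \<Lambda> =
     A * B * \<delta> * \<Lambda> / (q * (1 - A * B * \<Lambda> / q)) *
       (asc_phi_num q A B \<delta> \<Lambda> / asc_phi_den q A B \<delta> \<Lambda>)"

text \<open>
  No parameter \<open>c\<close> of the two series is of the form \<open>q\<^sup>-\<^sup>k\<close> (and \<open>1 - AB\<Lambda>/q \<noteq> 0\<close>), and their
  argument is not a pole \<open>q\<^sup>-\<^sup>k\<close> of the analytic continuation.
\<close>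

definition asc_regular :: "complex \<Rightarrow> complex \<Rightarrow> complex \<Rightarrow> complex \<Rightarrow> complex \<Rightarrow> bool" where
  "asc_regular q A B \<delta> \<Lambda> \<longleftrightarrow>
     (\<forall>k::nat. A * B * \<Lambda> / q * q ^ k \<noteq> 1) \<and> (\<forall>k::nat. A * \<delta> * \<Lambda> * q ^ k \<noteq> 1)"

text \<open>
  The weight is symmetric under \<open>u \<mapsto> 1/u\<close>, so it does not matter which solution \<open>u\<close> of
  \<open>t = (u + 1/u) / 2\<close> is taken.
\<close>

definition asc_weight ::
    "complex \<Rightarrow> complex \<Rightarrow> complex \<Rightarrow> complex \<Rightarrow> complex \<Rightarrow> real \<Rightarrow> complex" where
  "asc_weight q A B \<delta> \<gamma> t =
     (let r = complex_of_real (sqrt (1 - t\<^sup>2));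
          u = complex_of_real t + \<i> * r;
          \<Lambda>p = \<gamma> / 2 * (complex_of_real t + \<i> * r);
          \<Lambda>m = \<gamma> / 2 * (complex_of_real t - \<i> * r)
      in 1 / (2 * complex_of_real pi * r) *
         (qpoch_inf q A * qpoch_inf q B * qpoch_inf q (inverse (u\<^sup>2)) * qpoch_inf q (u\<^sup>2)) /
         (qpoch_inf q (A * \<delta> * \<gamma> * u / 2) * qpoch_inf q (A * \<delta> * \<gamma> / (2 * u)) *
          qpoch_inf q (A * B * \<gamma> * u / (2 * q)) * qpoch_inf q (A * B * \<gamma> / (2 * q * u))) *
         inverse (asc_phi_den q A B \<delta> \<Lambda>m * asc_phi_den q A B \<delta> \<Lambda>p))"

end

theory Submission
  imports Defs
begin

text \<open>
  In the coordinate \<open>v = 2\<Lambda>\<^sub>-/\<gamma>\<close>, \<open>z = \<gamma> (v + 1/v) / 2\<close>, the plane without the cut is the punctured unit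
  disc. Jackson's transformation turns the two hypergeometric functions, up to infinite products,
  into entire functions \<open>X\<^sub>0\<close>, \<open>X\<^sub>1\<close> of \<open>v\<close>. They begin a sequence \<open>X\<^sub>n\<close> that satisfies the three-term
  recurrence of the continued fraction and tends to the nonzero limit \<open>(q v\<^sup>2)\<^sub>\<infinity>\<close>. It is thus the
  minimal solution, and the continued fraction converges to \<open>(2v/\<gamma>) X\<^sub>1/X\<^sub>0\<close>. This quotient is
  meromorphic across the circle \<open>|v| = 1\<close>, which covers the cut, so Cauchy's formula is the residue
  theorem on that circle; the sum of the values at \<open>v\<close> and \<open>1/v\<close> is evaluated by the Casoratian of
  \<open>X\<^sub>n(v)\<close> and \<open>X\<^sub>n(1/v)\<close>, which gives the weight.
\<close>

section \<open>Infinite products and Jackson's transformation\<close>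

text \<open>The obstacle is that the two series have a meaning only where \<open>asc_regular\<close>
  holds, whereas convergence, poles and the contour integral concern every point of the disc and its
  boundary. All analysis is therefore done with the entire functions \<open>X n\<close>; the
  hypergeometric functions re-enter only off finitely many \<open>v\<close>, which punctured
  neighbourhoods and null sets discard. The recurrence of \<open>X\<close> tends to the one with
  constant coefficients \<open>1 + v^2\<close> and \<open>-v^2\<close>, whose solutions are 1 and
  \<open>v^(-2n)\<close>. For \<open>|v| < 1\<close> a finite nonzero limit thus marks the minimal
  solution. On the circle a zero of \<open>X 0\<close> would spoil the contour. Away from 1 and -1
  it would be a pole of the weight inside the interval, which is excluded by assumption. At 1 and -1
  it can occur, but it is simple, and the factor \<open>s^2 - 1\<close> of the derivative of
  \<open>J\<close> cancels it. The weight may then be unbounded at the ends of the cut, yet it stays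
  integrable.\<close>

lemma holomorphic_on_UNIV_suminf:
  fixes f :: "nat \<Rightarrow> complex \<Rightarrow> complex"
  assumes hol: "\<And>k. f k holomorphic_on UNIV"
    and bound: "\<And>R. R > 0 \<Longrightarrow> \<exists>M. summable M \<and> (\<forall>k. \<forall>z\<in>cball 0 R. norm (f k z) \<le> M k)"
  shows "(\<lambda>z. \<Sum>k. f k z) holomorphic_on UNIV"
proof (rule holomorphic_uniform_sequence)
  show "(\<lambda>z. \<Sum>k<n. f k z) holomorphic_on UNIV" for n
    by (intro holomorphic_intros hol)
  fix x :: complex
  obtain M where "summable M" and M: "\<And>k z. z \<in> cball 0 (norm x + 1) \<Longrightarrow> norm (f k z) \<le> M k"
    using bound[of "norm x + 1"] by (metis add_nonneg_pos norm_ge_zero zero_less_one)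
  then have "uniform_limit (cball 0 (norm x + 1)) (\<lambda>n z. \<Sum>k<n. f k z) (\<lambda>z. \<Sum>k. f k z) sequentially"
    by (intro Weierstrass_m_test)
  moreover have "cball x 1 \<subseteq> cball 0 (norm x + 1)"
    by (auto simp: dist_norm) (metis add.commute dist_norm dist_triangle_le norm_minus_commute norm_triangle_sub add_left_mono order_trans)
  ultimately show "\<exists>d>0. cball x d \<subseteq> UNIV \<and>
      uniform_limit (cball x d) (\<lambda>n z. \<Sum>k<n. f k z) (\<lambda>z. \<Sum>k. f k z) sequentially"
    by (intro exI[of _ 1]) (auto intro: uniform_limit_on_subset)
qed auto

lemma Suc_choose_two: "Suc k choose 2 = k + (k choose 2)"
  by (simp add: numeral_2_eq_2)

text \<open>The ratio of consecutive terms is \<rho>^k r, which tends to 0 whatever r is. This is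
  why every series with the factor \<open>gauss k\<close> is entire in its argument.\<close>

lemma summable_gaussian:
  fixes \<rho> r :: real
  assumes "0 \<le> \<rho>" "\<rho> < 1"
  shows "summable (\<lambda>k. \<rho> ^ (k choose 2) * r ^ k)"
proof -
  have "(\<lambda>k. \<rho> ^ k * \<bar>r\<bar>) \<longlonglongrightarrow> 0 * \<bar>r\<bar>"
    using assms by (intro tendsto_intros LIMSEQ_power_zero) auto
  then have "eventually (\<lambda>k. \<rho> ^ k * \<bar>r\<bar> < 1/2) sequentially"
    by (rule order_tendstoD) auto
  then obtain N where N: "\<And>k. k \<ge> N \<Longrightarrow> \<rho> ^ k * \<bar>r\<bar> < 1/2"
    by (auto simp: eventually_sequentially)
  show ?thesis
  proof (rule summable_ratio_test)
    fix k assume "k \<ge> N"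
    have "norm (\<rho> ^ (Suc k choose 2) * r ^ Suc k) = (\<rho> ^ k * \<bar>r\<bar>) * norm (\<rho> ^ (k choose 2) * r ^ k)"
      using assms by (simp add: Suc_choose_two power_add abs_mult power_abs)
    also have "\<dots> \<le> 1/2 * norm (\<rho> ^ (k choose 2) * r ^ k)"
      using N[OF \<open>k \<ge> N\<close>] by (intro mult_right_mono) auto
    finally show "norm (\<rho> ^ (Suc k choose 2) * r ^ Suc k) \<le> 1/2 * norm (\<rho> ^ (k choose 2) * r ^ k)" .
  qed auto
qed

section \<open>Finite and infinite q-shifted factorials\<close>

lemma qpoch_0 [simp]: "qpoch q a 0 = 1"
  by (simp add: qpoch_def)

lemma qpoch_Suc: "qpoch q a (Suc k) = qpoch q a k * (1 - a * q ^ k)"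
  by (simp add: qpoch_def)

lemma qpoch_zero_left [simp]: "qpoch q 0 k = 1"
  by (simp add: qpoch_def)

lemma qpoch_add: "qpoch q a (m + n) = qpoch q a m * qpoch q (a * q ^ m) n"
  by (induction n) (simp_all add: qpoch_Suc power_add mult.assoc)

lemma qpoch_Suc_shift: "qpoch q a (Suc k) = (1 - a) * qpoch q (a * q) k"
  using qpoch_add[of q a 1 k] by (simp add: qpoch_Suc)

lemma qpoch_eq_0_iff: "qpoch q a n = 0 \<longleftrightarrow> (\<exists>j<n. a * q ^ j = 1)"
  by (auto simp: qpoch_def)

locale q_base =
  fixes q :: complex
  assumes q_nz: "q \<noteq> 0" and norm_q: "norm q < 1"
begin

lemma power_q_neq_1: "q ^ Suc j \<noteq> 1"
proof -
  have "norm (q ^ Suc j) < 1"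
    using norm_q power_Suc_less_one[of "norm q" j] q_nz by (simp add: norm_power del: power_Suc)
  then show ?thesis by auto
qed

lemma mult_power_q_neq_1: "norm a < 1 \<Longrightarrow> a * q ^ j \<noteq> 1"
proof
  assume *: "norm a < 1" "a * q ^ j = 1"
  have "norm (a * q ^ j) \<le> norm a * 1"
    using norm_q by (simp add: norm_mult norm_power mult_left_le power_le_one)
  then show False using * by simp
qed

lemma qpoch_q_nonzero: "qpoch q q k \<noteq> 0"
  using power_q_neq_1 by (auto simp: qpoch_eq_0_iff)

lemma convergent_prod_qpoch: "convergent_prod (\<lambda>j. 1 - a * q ^ j)"
proof (intro abs_convergent_prod_imp_convergent_prod summable_imp_abs_convergent_prod)
  show "summable (\<lambda>i. norm (1 - a * q ^ i - 1))"
    using norm_q by (auto simp: norm_mult norm_power intro!: summable_mult)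
qed

lemma LIMSEQ_qpoch: "qpoch q a \<longlonglongrightarrow> qpoch_inf q a"
proof -
  have "(\<lambda>n. \<Prod>j\<le>n. 1 - a * q ^ j) \<longlonglongrightarrow> (\<Prod>j. 1 - a * q ^ j)"
    by (rule convergent_prod_LIMSEQ[OF convergent_prod_qpoch])
  then show ?thesis
    unfolding LIMSEQ_lessThan_iff_atMost[symmetric] qpoch_inf_def qpoch_def .
qed

lemma qpoch_inf_split: "qpoch_inf q a = qpoch q a n * qpoch_inf q (a * q ^ n)"
proof (rule LIMSEQ_unique)
  show "(\<lambda>m. qpoch q a (n + m)) \<longlonglongrightarrow> qpoch_inf q a"
    using LIMSEQ_ignore_initial_segment[OF LIMSEQ_qpoch, where k = n] by (simp add: add.commute)
  show "(\<lambda>m. qpoch q a (n + m)) \<longlonglongrightarrow> qpoch q a n * qpoch_inf q (a * q ^ n)"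
    unfolding qpoch_add by (intro tendsto_intros LIMSEQ_qpoch)
qed

lemma qpoch_inf_Suc: "qpoch_inf q a = (1 - a) * qpoch_inf q (a * q)"
  using qpoch_inf_split[of a 1] by (simp add: qpoch_Suc)

lemma qpoch_inf_nonzero_iff: "qpoch_inf q a \<noteq> 0 \<longleftrightarrow> (\<forall>j. a * q ^ j \<noteq> 1)"
proof
  show "qpoch_inf q a \<noteq> 0" if "\<forall>j. a * q ^ j \<noteq> 1"
    unfolding qpoch_inf_def using that by (intro prodinf_nonzero convergent_prod_qpoch) auto
  show "\<forall>j. a * q ^ j \<noteq> 1" if "qpoch_inf q a \<noteq> 0"
  proof
    fix j show "a * q ^ j \<noteq> 1"
      using that qpoch_inf_split[of a "Suc j"] by (auto simp: qpoch_Suc)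
  qed
qed

lemma qpoch_inf_0 [simp]: "qpoch_inf q 0 = 1"
  by (simp add: qpoch_inf_def)

text \<open>The bound is uniform in \<open>a\<close> and in \<open>n\<close> at once: the factor of
  index j is at most exp (R |q|^j), and these exponents form a geometric series.\<close>

lemma qpoch_bounded: "\<exists>C>0. \<forall>a\<in>cball 0 R. \<forall>n. norm (qpoch q a n) \<le> C"
proof (intro exI conjI ballI allI)
  fix a :: complex and n assume a: "a \<in> cball 0 R"
  have "norm (qpoch q a n) = (\<Prod>j<n. norm (1 - a * q ^ j))"
    by (simp add: qpoch_def prod_norm)
  also have "\<dots> \<le> (\<Prod>j<n. exp (R * norm q ^ j))"
  proof (intro prod_mono conjI norm_ge_zero)
    fix j
    have "norm (1 - a * q ^ j) \<le> 1 + norm (a * q ^ j)"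
      by (metis norm_one norm_triangle_ineq4)
    also have "\<dots> \<le> 1 + R * norm q ^ j"
      using a by (simp add: norm_mult norm_power mult_right_mono)
    also have "\<dots> \<le> exp (R * norm q ^ j)" by (rule exp_ge_add_one_self)
    finally show "norm (1 - a * q ^ j) \<le> exp (R * norm q ^ j)" .
  qed
  also have "\<dots> = exp (R * (\<Sum>j<n. norm q ^ j))"
    by (simp add: exp_sum sum_distrib_left)
  also have "\<dots> \<le> exp (R * (\<Sum>j. norm q ^ j))"
  proof -
    have "R \<ge> 0" using a by (auto intro: order_trans[OF norm_ge_zero])
    then show ?thesis using norm_q
      by (auto intro!: mult_left_mono sum_le_suminf summable_geometric)
  qed
  finally show "norm (qpoch q a n) \<le> exp (R * (\<Sum>j. norm q ^ j))" .
qed simp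

lemma inverse_qpoch_bounded:
  assumes "\<And>j. a * q ^ j \<noteq> 1"
  shows "\<exists>C>0. \<forall>n. norm (inverse (qpoch q a n)) \<le> C"
proof -
  have "(\<lambda>n. inverse (qpoch q a n)) \<longlonglongrightarrow> inverse (qpoch_inf q a)"
    using assms by (intro tendsto_intros LIMSEQ_qpoch) (auto simp: qpoch_inf_nonzero_iff)
  then show ?thesis by (metis convergentI convergent_imp_Bseq Bseq_def)
qed

lemma inverse_qpoch_q_bounded: "\<exists>C>0. \<forall>n. norm (inverse (qpoch q q n)) \<le> C"
  using power_q_neq_1 by (intro inverse_qpoch_bounded) auto

lemma power_q_tendsto_0: "(\<lambda>n. a * q ^ n) \<longlonglongrightarrow> 0"
  using tendsto_mult[OF tendsto_const LIMSEQ_power_zero[OF norm_q], of a] by simp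

section \<open>Euler's series for the infinite product\<close>

definition gauss :: "nat \<Rightarrow> complex" where
  "gauss k = (-1) ^ k * q ^ (k choose 2)"

lemma gauss_0 [simp]: "gauss 0 = 1"
  by (simp add: gauss_def binomial_eq_0)

lemma gauss_Suc: "gauss (Suc k) = - (q ^ k * gauss k)"
  by (simp add: gauss_def Suc_choose_two power_add)

lemma norm_gauss: "norm (gauss k) = norm q ^ (k choose 2)"
  by (simp add: gauss_def norm_mult norm_power)

lemma gauss_summable: "summable (\<lambda>k. C * (norm (gauss k) * R ^ k))"
  using summable_gaussian[of "norm q" R] norm_q by (intro summable_mult) (simp add: norm_gauss)

lemma euler_gauss_holomorphic: "(\<lambda>x. \<Sum>k. gauss k * x ^ k / qpoch q q k) holomorphic_on UNIV"
proof (rule holomorphic_on_UNIV_suminf)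
  fix R :: real assume "R > 0"
  obtain C where C: "C > 0" "\<And>n. norm (inverse (qpoch q q n)) \<le> C"
    using inverse_qpoch_q_bounded by blast
  have "norm (gauss k * z ^ k / qpoch q q k) \<le> C * (norm (gauss k) * R ^ k)" if "z \<in> cball 0 R" for k z
  proof -
    have "norm (gauss k * z ^ k / qpoch q q k) = norm (inverse (qpoch q q k)) * (norm (gauss k) * norm z ^ k)"
      by (simp add: norm_mult norm_divide norm_power norm_inverse field_simps)
    also have "\<dots> \<le> C * (norm (gauss k) * R ^ k)"
      using that C by (intro mult_mono power_mono) auto
    finally show ?thesis .
  qed
  then show "\<exists>M. summable M \<and> (\<forall>k. \<forall>z\<in>cball 0 R. norm (gauss k * z ^ k / qpoch q q k) \<le> M k)"
    using gauss_summable by blast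
qed (intro holomorphic_intros, auto simp: qpoch_q_nonzero)

lemma summable_norm_euler: "summable (\<lambda>k. norm (gauss k * x ^ k / qpoch q q k))"
proof -
  obtain C where C: "C > 0" "\<And>n. norm (inverse (qpoch q q n)) \<le> C"
    using inverse_qpoch_q_bounded by blast
  show ?thesis
  proof (rule summable_comparison_test'[OF gauss_summable[of C "norm x"]])
    fix k
    have "norm (gauss k * x ^ k / qpoch q q k) = norm (inverse (qpoch q q k)) * (norm (gauss k) * norm x ^ k)"
      by (simp add: norm_mult norm_divide norm_power norm_inverse field_simps)
    also have "\<dots> \<le> C * (norm (gauss k) * norm x ^ k)"
      using C by (intro mult_right_mono) auto
    finally show "norm (norm (gauss k * x ^ k / qpoch q q k)) \<le> C * (norm (gauss k) * norm x ^ k)" by simp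
  qed
qed

text \<open>Euler's series \<open>g\<close> is determined by \<open>g x = (1 - x) g (q x)\<close>, \<open>g 0 = 1\<close> and continuity at \<open>0\<close>.\<close>

lemma qpoch_inf_euler: "(\<lambda>k. gauss k * x ^ k / qpoch q q k) sums qpoch_inf q x"
proof -
  define g where "g x = (\<Sum>k. gauss k * x ^ k / qpoch q q k)" for x
  have summ: "summable (\<lambda>k. gauss k * x ^ k / qpoch q q k)" for x
    using summable_norm_euler by (rule summable_norm_cancel)
  have fe: "g x = (1 - x) * g (x * q)" for x
  proof -
    let ?t = "\<lambda>k. gauss k * x ^ k / qpoch q q k"
    let ?u = "\<lambda>k. gauss k * (x * q) ^ k / qpoch q q k"
    have "(\<lambda>k. ?t (Suc k)) sums (g x - 1)"
      using sums_Suc_iff[of ?t] summable_sums[OF summ[of x]] by (simp add: g_def)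
    moreover have "(\<lambda>k. ?u (Suc k)) sums (g (x*q) - 1)"
      using sums_Suc_iff[of ?u] summable_sums[OF summ[of "x*q"]] by (simp add: g_def)
    ultimately have "(\<lambda>k. ?t (Suc k) - ?u (Suc k)) sums (g x - g (x*q))"
      using sums_diff by fastforce
    moreover have "?t (Suc k) - ?u (Suc k) = - x * ?u k" for k
    proof -
      have nz: "qpoch q q k \<noteq> 0" "1 - q * q ^ k \<noteq> 0"
        using qpoch_q_nonzero power_q_neq_1[of k] by auto
      have "?t (Suc k) - ?u (Suc k) = gauss (Suc k) * x ^ Suc k * (1 - q ^ Suc k) / qpoch q q (Suc k)"
        by (simp add: diff_divide_distrib power_mult_distrib algebra_simps)
      also have "\<dots> = gauss (Suc k) * x ^ Suc k / qpoch q q k"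
        using nz by (simp add: qpoch_Suc)
      also have "\<dots> = - x * ?u k"
        by (simp add: gauss_Suc power_mult_distrib)
      finally show ?thesis .
    qed
    ultimately have "(\<lambda>k. - x * ?u k) sums (g x - g (x*q))" by simp
    moreover have "(\<lambda>k. - x * ?u k) sums (- x * g (x*q))"
      unfolding g_def using summ by (intro sums_mult summable_sums)
    ultimately have "g x - g (x*q) = - x * g (x*q)"
      by (rule sums_unique2)
    then show ?thesis by (simp add: algebra_simps)
  qed
  have it: "g x = qpoch q x n * g (x * q ^ n)" for n
  proof (induction n)
    case (Suc n)
    then show ?case using fe[of "x * q ^ n"] by (simp add: qpoch_Suc mult_ac)
  qed simp
  have cont: "isCont g 0"
    using holomorphic_on_imp_continuous_on[OF euler_gauss_holomorphic]
    by (simp add: g_def[abs_def] continuous_on_eq_continuous_at)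
  have "(\<lambda>n. g (x * q ^ n)) \<longlonglongrightarrow> g 0"
    by (rule isCont_tendsto_compose[OF cont power_q_tendsto_0])
  moreover have "g 0 = 1"
  proof -
    have "(\<lambda>k. gauss k * 0 ^ k / qpoch q q k) sums (gauss 0 * 0 ^ 0 / qpoch q q 0)"
      using sums_single[of 0 "\<lambda>k. gauss k * 0 ^ k / qpoch q q k"]
      by (rule back_subst[of "\<lambda>f. f sums _"]) (auto simp: fun_eq_iff)
    then show ?thesis by (simp add: g_def sums_iff)
  qed
  ultimately have "(\<lambda>n. qpoch q x n * g (x * q ^ n)) \<longlonglongrightarrow> qpoch_inf q x * 1"
    by (intro tendsto_mult LIMSEQ_qpoch) auto
  then have "g x = qpoch_inf q x"
    using it by (simp add: LIMSEQ_const_iff)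
  then show ?thesis using summ[of x] by (simp add: g_def sums_iff)
qed

lemma qpoch_inf_holomorphic_UNIV: "qpoch_inf q holomorphic_on UNIV"
  using euler_gauss_holomorphic qpoch_inf_euler by (simp add: sums_iff)

lemma qpoch_inf_holomorphic [holomorphic_intros]:
  "f holomorphic_on X \<Longrightarrow> (\<lambda>z. qpoch_inf q (f z)) holomorphic_on X"
  using holomorphic_on_compose_gen[OF _ qpoch_inf_holomorphic_UNIV, of f X] by (simp add: o_def)

lemma isCont_qpoch_inf: "isCont (qpoch_inf q) x"
  using holomorphic_on_imp_continuous_on[OF qpoch_inf_holomorphic_UNIV]
  by (simp add: continuous_on_eq_continuous_at)

lemma qpoch_inf_bounded: "\<exists>C>0. \<forall>x\<in>cball 0 R. norm (qpoch_inf q x) \<le> C"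
proof -
  obtain C where C: "C > 0" "\<And>a n. a \<in> cball 0 R \<Longrightarrow> norm (qpoch q a n) \<le> C"
    using qpoch_bounded[of R] by blast
  have "norm (qpoch_inf q x) \<le> C" if "x \<in> cball 0 R" for x
    using C(2)[OF that] by (intro tendsto_upperbound[OF tendsto_norm[OF LIMSEQ_qpoch]]) auto
  then show ?thesis using C(1) by blast
qed

lemma norm_mult_power_q_le: "norm (a * q ^ k) \<le> norm a"
  using norm_q by (simp add: norm_mult norm_power mult_left_le power_le_one)

section \<open>The q-binomial theorem\<close>

lemma q_binomial_aux:
  assumes z: "norm z < 1"
  shows "summable (\<lambda>m. norm (qpoch q a m / qpoch q q m * z ^ m))"
proof -
  obtain C where C: "C > 0" "\<And>n. norm (inverse (qpoch q q n)) \<le> C"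
    using inverse_qpoch_q_bounded by blast
  obtain D where D: "D > 0" "\<And>n. norm (qpoch q a n) \<le> D"
    using qpoch_bounded[of "norm a"] by auto
  have s: "summable (\<lambda>m. (D * C) * norm z ^ m)"
    using z by (intro summable_mult summable_geometric) auto
  show ?thesis
  proof (rule summable_comparison_test'[OF s])
    fix m
    have "norm (qpoch q a m / qpoch q q m * z ^ m) = norm (qpoch q a m) * norm (inverse (qpoch q q m)) * norm z ^ m"
      by (simp add: norm_mult norm_divide norm_power norm_inverse field_simps)
    also have "\<dots> \<le> D * C * norm z ^ m"
      using C D by (intro mult_mono) (auto intro!: less_imp_le)
    finally show "norm (norm (qpoch q a m / qpoch q q m * z ^ m)) \<le> D * C * norm z ^ m" by simp
  qed
qed

text \<open>Same method as for Euler's series: the ratio of consecutive coefficients gives (1 - z)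
  h(z) = (1 - a z) h(q z). Iterating moves the argument to 0, where the power series is continuous
  with value 1.\<close>

lemma q_binomial:
  assumes z: "norm z < 1"
  shows "(\<lambda>m. qpoch q a m / qpoch q q m * z ^ m) sums (qpoch_inf q (a * z) / qpoch_inf q z)"
proof -
  define c where "c m = qpoch q a m / qpoch q q m" for m
  define h where "h z = (\<Sum>m. c m * z ^ m)" for z
  have summ: "summable (\<lambda>m. c m * z ^ m)" if "norm z < 1" for z
    using q_binomial_aux[OF that] unfolding c_def by (rule summable_norm_cancel)
  have fe: "(1 - z) * h z = (1 - a * z) * h (z * q)" if z: "norm z < 1" for z
  proof -
    have zq: "norm (z * q) < 1" using norm_mult_power_q_le[of z 1] z by simp
    have 1: "(\<lambda>m. c (Suc m) * z ^ Suc m) sums (h z - 1)"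
      using sums_Suc_iff[of "\<lambda>m. c m * z ^ m"] summable_sums[OF summ[OF z]] by (simp add: h_def c_def)
    have 2: "(\<lambda>m. c (Suc m) * (z*q) ^ Suc m) sums (h (z*q) - 1)"
      using sums_Suc_iff[of "\<lambda>m. c m * (z*q) ^ m"] summable_sums[OF summ[OF zq]] by (simp add: h_def c_def)
    have "(\<lambda>m. c (Suc m) * z ^ Suc m - c (Suc m) * (z*q) ^ Suc m) sums (h z - h (z*q))"
      using sums_diff[OF 1 2] by simp
    moreover have "c (Suc m) * z ^ Suc m - c (Suc m) * (z*q) ^ Suc m = z * (c m * z ^ m) - a * z * (c m * (z*q)^m)" for m
    proof -
      have nz: "qpoch q q m \<noteq> 0" "1 - q * q ^ m \<noteq> 0"
        using qpoch_q_nonzero power_q_neq_1[of m] by auto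
      have "c (Suc m) * z ^ Suc m - c (Suc m) * (z*q) ^ Suc m = c (Suc m) * (1 - q * q ^ m) * z ^ Suc m"
        by (simp add: algebra_simps)
      also have "c (Suc m) * (1 - q * q ^ m) = c m * (1 - a * q ^ m)"
        using nz by (simp add: c_def qpoch_Suc)
      finally show ?thesis by (simp add: algebra_simps)
    qed
    ultimately have "(\<lambda>m. z * (c m * z ^ m) - a * z * (c m * (z*q)^m)) sums (h z - h (z*q))" by simp
    moreover have "(\<lambda>m. z * (c m * z ^ m) - a * z * (c m * (z*q)^m)) sums (z * h z - a * z * h (z*q))"
      unfolding h_def by (intro sums_diff sums_mult summable_sums summ z zq)
    ultimately have "h z - h (z*q) = z * h z - a * z * h (z*q)"
      by (rule sums_unique2)
    then show ?thesis by (simp add: algebra_simps)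
  qed
  have it: "qpoch q z n * h z = qpoch q (a*z) n * h (z * q ^ n)" for n
  proof (induction n)
    case (Suc n)
    have n1: "norm (z * q ^ n) < 1" using norm_mult_power_q_le[of z n] z by simp
    have "qpoch q z (Suc n) * h z = (1 - z * q ^ n) * (qpoch q (a*z) n * h (z * q ^ n))"
      using Suc by (simp add: qpoch_Suc mult_ac)
    also have "\<dots> = qpoch q (a*z) n * ((1 - z * q ^ n) * h (z * q ^ n))" by simp
    also have "\<dots> = qpoch q (a*z) (Suc n) * h (z * q ^ Suc n)"
      unfolding fe[OF n1] by (simp add: qpoch_Suc mult_ac)
    finally show ?case .
  qed simp
  have "isCont h 0"
    \<comment> \<open>The point 1/2 only witnesses a positive radius of convergence.\<close>
    unfolding h_def using summ[of "1/2"] by (intro isCont_powser[of c "1/2"]) (auto simp: norm_divide)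
  then have "(\<lambda>n. h (z * q ^ n)) \<longlonglongrightarrow> h 0"
    by (rule isCont_tendsto_compose[OF _ power_q_tendsto_0])
  then have "(\<lambda>n. qpoch q (a*z) n * h (z * q ^ n)) \<longlonglongrightarrow> qpoch_inf q (a*z) * h 0"
    by (intro tendsto_mult LIMSEQ_qpoch)
  moreover have "(\<lambda>n. qpoch q z n * h z) \<longlonglongrightarrow> qpoch_inf q z * h z"
    by (intro tendsto_intros LIMSEQ_qpoch)
  ultimately have "qpoch_inf q z * h z = qpoch_inf q (a*z) * h 0"
    unfolding it by (rule LIMSEQ_unique[rotated])
  moreover have "h 0 = 1"
    using powser_zero[of c] by (simp add: h_def) (simp add: c_def)
  moreover have "qpoch_inf q z \<noteq> 0"
    using mult_power_q_neq_1[OF z] by (simp add: qpoch_inf_nonzero_iff)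
  ultimately have "h z = qpoch_inf q (a * z) / qpoch_inf q z" by (simp add: field_simps)
  then show ?thesis using summ[OF z] by (simp add: h_def c_def sums_iff)
qed

text \<open>
  With the denominators \<open>(c)\<^sub>k\<close> cleared, the \<open>q\<close>-Pascal rule gives \<open>Q\<^sub>n\<^sub>+\<^sub>1(b, c) = (1 - b) Q\<^sub>n(b q, c q)\<close>
  for the sum.
\<close>

lemma q_vandermonde:
  "(\<Sum>k\<le>n. gauss k * (\<Prod>j<k. b - c * q ^ j) * qpoch q (c * q ^ k) (n - k) /
       (qpoch q q k * qpoch q q (n - k))) = qpoch q b n / qpoch q q n"
proof (induction n arbitrary: b c)
  case (Suc n)
  define t where "t n k b c = gauss k * (\<Prod>j<k. b - c * q ^ j) * qpoch q (c * q ^ k) (n - k) /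
       (qpoch q q k * qpoch q q (n - k))" for n k b c
  have nz: "1 - q * q ^ j \<noteq> 0" for j
    using power_q_neq_1[of j] by simp
  \<comment> \<open>The q-Pascal rule: 1 - q^(n+1) = q^k (1 - q^(n+1-k)) + (1 - q^k). The factor in
    \<open>f\<close> cancels the last factor of (q)_(n+1-k), the factor in \<open>g\<close> the last
    one of (q)_k; after shifting k in \<open>g\<close>, both have the denominator of level
    n.\<close>
  define f where "f k = q ^ k * (1 - q ^ (Suc n - k)) * t (Suc n) k b c" for k
  define g where "g k = (1 - q ^ k) * t (Suc n) k b c" for k
  have "(1 - q ^ Suc n) * (\<Sum>k\<le>Suc n. t (Suc n) k b c) = (\<Sum>k\<le>Suc n. f k + g k)"
    unfolding sum_distrib_left f_def g_def distrib_right[symmetric]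
  proof (rule sum.cong)
    fix k assume "k \<in> {..Suc n}"
    then have "q ^ k * q ^ (Suc n - k) = q ^ Suc n"
      by (subst power_add[symmetric]) auto
    then show "(1 - q ^ Suc n) * t (Suc n) k b c =
        (q ^ k * (1 - q ^ (Suc n - k)) + (1 - q ^ k)) * t (Suc n) k b c"
      by (simp add: right_diff_distrib)
  qed simp
  also have "\<dots> = (\<Sum>k\<le>Suc n. f k) + (\<Sum>k\<le>Suc n. g k)"
    by (rule sum.distrib)
  also have "\<dots> = (\<Sum>k\<le>n. f k) + (\<Sum>k\<le>n. g (Suc k))"
    unfolding sum.atMost_Suc[of f] sum.atMost_Suc_shift[of g] by (simp add: f_def g_def)
  also have "\<dots> = (\<Sum>k\<le>n. (1 - b) * t n k (b * q) (c * q))"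
    unfolding sum.distrib[symmetric]
  proof (rule sum.cong)
    fix k assume k: "k \<in> {..n}"
    define P where "P = (\<Prod>j<k. b - c * q ^ j)"
    define Q where "Q = qpoch q (c * q ^ Suc k) (n - k)"
    define D where "D = qpoch q q k * qpoch q q (n - k)"
    have D: "D \<noteq> 0" by (simp add: D_def qpoch_q_nonzero)
    have nk: "Suc n - k = Suc (n - k)" using k by auto
    have fk: "f k = q ^ k * (gauss k * P * ((1 - c * q ^ k) * Q) / D)"
      unfolding f_def t_def nk P_def Q_def D_def qpoch_Suc[of q q] qpoch_Suc_shift[of q "c * q ^ k"]
      using nz[of "n - k"] by (simp add: mult_ac)
    have gk: "g (Suc k) = gauss (Suc k) * (P * (b - c * q ^ k)) * Q / D"
      unfolding g_def t_def P_def Q_def D_def qpoch_Suc[of q q]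
      using nz[of k] by (simp add: mult_ac)
    have tk: "t n k (b * q) (c * q) = gauss k * (q ^ k * P) * Q / D"
    proof -
      have "(\<Prod>j<k. b * q - c * q * q ^ j) = (\<Prod>j<k. q * (b - c * q ^ j))"
        by (intro prod.cong) (auto simp: algebra_simps)
      also have "\<dots> = q ^ k * P" by (simp add: prod.distrib P_def)
      finally show ?thesis unfolding t_def Q_def D_def by (simp add: mult_ac)
    qed
    show "f k + g (Suc k) = (1 - b) * t n k (b * q) (c * q)"
      unfolding fk gk tk gauss_Suc using D by (simp add: field_simps)
  qed simp
  also have "\<dots> = (1 - b) * (qpoch q (b * q) n / qpoch q q n)"
    unfolding sum_distrib_left[symmetric] t_def Suc ..
  also have "\<dots> = qpoch q b (Suc n) / qpoch q q n"
    by (simp add: qpoch_Suc_shift)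
  finally have "(1 - q ^ Suc n) * (\<Sum>k\<le>Suc n. t (Suc n) k b c) = qpoch q b (Suc n) / qpoch q q n" .
  then have "(\<Sum>k\<le>Suc n. t (Suc n) k b c) = qpoch q b (Suc n) / qpoch q q (Suc n)"
    using nz[of n] qpoch_q_nonzero[of n] unfolding qpoch_Suc[of q q]
    by (simp add: eq_divide_eq mult_ac del: sum.atMost_Suc)
  then show ?case by (simp only: t_def)
qed simp

text \<open>The product is b^k (c/b)_k written without a division, so that b = 0 needs no separate
  treatment.\<close>

definition jackson_coeff :: "complex \<Rightarrow> complex \<Rightarrow> nat \<Rightarrow> complex" where
  "jackson_coeff b c k = gauss k * (\<Prod>j<k. b - c * q ^ j) / (qpoch q c k * qpoch q q k)"

lemma norm_jackson_coeff_le: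
  assumes c: "\<And>j. c * q ^ j \<noteq> 1"
  shows "\<exists>C>0. \<forall>k. norm (jackson_coeff b c k) \<le> C * (norm (gauss k) * (norm b + norm c) ^ k)"
proof -
  obtain C where C: "C > 0" "\<And>n. norm (inverse (qpoch q c n)) \<le> C"
    using inverse_qpoch_bounded[OF c] by blast
  obtain D where D: "D > 0" "\<And>n. norm (inverse (qpoch q q n)) \<le> D"
    using inverse_qpoch_q_bounded by blast
  have "norm (jackson_coeff b c k) \<le> (C * D) * (norm (gauss k) * (norm b + norm c) ^ k)" for k
  proof -
    have "norm (\<Prod>j<k. b - c * q ^ j) \<le> (\<Prod>j<k. norm b + norm c)"
      unfolding prod_norm[symmetric]
      by (intro prod_mono conjI norm_ge_zero order_trans[OF norm_triangle_ineq4] add_left_mono norm_mult_power_q_le)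
    then have p: "norm (\<Prod>j<k. b - c * q ^ j) \<le> (norm b + norm c) ^ k" by simp
    have "norm (jackson_coeff b c k) =
        (norm (inverse (qpoch q c k)) * norm (inverse (qpoch q q k))) * (norm (gauss k) * norm (\<Prod>j<k. b - c * q ^ j))"
      by (simp add: jackson_coeff_def norm_mult norm_divide norm_inverse divide_simps)
    also have "\<dots> \<le> (C * D) * (norm (gauss k) * (norm b + norm c) ^ k)"
      using C D p by (intro mult_mono) (auto intro!: mult_nonneg_nonneg less_imp_le)
    finally show ?thesis .
  qed
  then show ?thesis using C D by (intro exI[of _ "C * D"]) auto
qed

text \<open>This is (a w)_\<infinity> times the series 2phi2 with upper parameters a, c/b, lower
  parameters c, a w and argument b w. The quotient (a w)_\<infinity> / (a w)_k has been merged into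
  one infinite product, which leaves no denominator depending on w.\<close>

definition jackson :: "complex \<Rightarrow> complex \<Rightarrow> complex \<Rightarrow> complex \<Rightarrow> complex" where
  "jackson a b c w = (\<Sum>k. qpoch q a k * jackson_coeff b c k * w ^ k * qpoch_inf q (a * w * q ^ k))"

lemma jackson_bound:
  assumes c: "\<And>j. c * q ^ j \<noteq> 1"
  shows "\<exists>M. summable M \<and> (\<forall>k. \<forall>w\<in>cball 0 R.
      norm (qpoch q a k * jackson_coeff b c k * w ^ k * qpoch_inf q (a * w * q ^ k)) \<le> M k)"
proof -
  obtain C where C: "C > 0" "\<And>k. norm (jackson_coeff b c k) \<le> C * (norm (gauss k) * (norm b + norm c) ^ k)"
    using norm_jackson_coeff_le[OF c] by blast
  obtain D where D: "D > 0" "\<And>n. norm (qpoch q a n) \<le> D"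
    using qpoch_bounded[of "norm a"] by auto
  obtain E where E: "E > 0" "\<And>x. x \<in> cball 0 (norm a * R) \<Longrightarrow> norm (qpoch_inf q x) \<le> E"
    using qpoch_inf_bounded[of "norm a * R"] by auto
  have "norm (qpoch q a k * jackson_coeff b c k * w ^ k * qpoch_inf q (a * w * q ^ k)) \<le>
      (D * C * E) * (norm (gauss k) * ((norm b + norm c) * R) ^ k)" if w: "w \<in> cball 0 R" for k w
  proof -
    have R: "R \<ge> 0" using w by (auto intro: order_trans[OF norm_ge_zero])
    have "norm (a * w * q ^ k) \<le> norm a * R"
      using norm_mult_power_q_le[of "a * w" k] mult_left_mono[of "norm w" R "norm a"] w
      by (simp add: norm_mult)
    then have "norm (qpoch_inf q (a * w * q ^ k)) \<le> E"
      using E(2)[of "a * w * q ^ k"] by simp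
    moreover have "norm w ^ k \<le> R ^ k"
      using w by (intro power_mono) auto
    ultimately have "norm (qpoch q a k * jackson_coeff b c k * w ^ k * qpoch_inf q (a * w * q ^ k)) \<le>
       D * (C * (norm (gauss k) * (norm b + norm c) ^ k)) * R ^ k * E"
      unfolding norm_mult norm_power using C D R
      by (intro mult_mono mult_nonneg_nonneg) (auto intro: less_imp_le)
    also have "\<dots> = (D * C * E) * (norm (gauss k) * ((norm b + norm c) * R) ^ k)"
      by (simp add: power_mult_distrib mult_ac)
    finally show ?thesis .
  qed
  then show ?thesis using gauss_summable by blast
qed

lemma jackson_holomorphic:
  assumes "\<And>j. c * q ^ j \<noteq> 1"
  shows "jackson a b c holomorphic_on UNIV"
  unfolding jackson_def[abs_def]
  by (intro holomorphic_on_UNIV_suminf jackson_bound assms holomorphic_intros)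

lemma suminf_eq_infsum: "f summable_on UNIV \<Longrightarrow> (\<Sum>n. f n) = (\<Sum>\<^sub>\<infinity>n. f n)"
  for f :: "nat \<Rightarrow> complex"
  using has_sum_imp_sums[OF has_sum_infsum] by (metis sums_unique)

text \<open>The dominating product makes the family absolutely summable over pairs, so it may be
  summed along the diagonals k + m = n. The rearrangement is done with unordered sums and carried
  back to \<open>suminf\<close>.\<close>

lemma suminf_triangle:
  fixes f :: "nat \<Rightarrow> nat \<Rightarrow> complex" and x y :: "nat \<Rightarrow> complex"
  assumes x: "summable (\<lambda>k. norm (x k))" and y: "summable (\<lambda>k. norm (y k))"
    and f: "\<And>k m. norm (f k m) \<le> norm (x k) * norm (y m)"
  shows "(\<Sum>k. \<Sum>m. f k m) = (\<Sum>n. \<Sum>k\<le>n. f k (n - k))"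
proof -
  have bij: "bij_betw (\<lambda>(n, k). (k, n - k)) (SIGMA n:UNIV. {..n::nat}) (UNIV :: (nat \<times> nat) set)"
    by (rule bij_betwI[where g = "\<lambda>(k, m). (k + m, k)"]) auto
  have xs: "(\<lambda>k. norm (x k)) summable_on UNIV" and ys: "(\<lambda>k. norm (y k)) summable_on UNIV"
    using x y by (auto simp: summable_on_UNIV_nonneg_real_iff)
  have "(\<lambda>(k, m). norm (x k) * norm (y m)) summable_on UNIV \<times> UNIV"
  proof (rule summable_on_SigmaI)
    show "((\<lambda>m. case (k, m) of (k, m) \<Rightarrow> norm (x k) * norm (y m)) has_sum
        norm (x k) * (\<Sum>\<^sub>\<infinity>m. norm (y m))) UNIV" for k
      using has_sum_cmult_right[OF has_sum_infsum[OF ys]] by simp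
    show "(\<lambda>k. norm (x k) * (\<Sum>\<^sub>\<infinity>m. norm (y m))) summable_on UNIV"
      by (intro summable_on_cmult_left xs)
  qed auto
  then have "(\<lambda>p. norm (f (fst p) (snd p))) summable_on UNIV \<times> UNIV"
    by (rule Infinite_Sum.abs_summable_on_comparison_test') (auto simp: f)
  then have s: "(\<lambda>(k, m). f k m) summable_on UNIV \<times> UNIV"
    unfolding case_prod_unfold by (rule Infinite_Sum.abs_summable_summable)
  then have s': "(\<lambda>(n, k). f k (n - k)) summable_on (SIGMA n:UNIV. {..n})"
    using summable_on_reindex_bij_betw[OF bij, of "\<lambda>(k, m). f k m"]
    by (simp add: case_prod_unfold)
  have inner: "f k summable_on UNIV" for k
    using summable_on_SigmaD1[OF s, of k] by simp
  have outer: "(\<lambda>k. \<Sum>\<^sub>\<infinity>m. f k m) summable_on UNIV"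
    using summable_on_SigmaD[OF s] inner by simp
  have outer': "(\<lambda>n. \<Sum>k\<le>n. f k (n - k)) summable_on UNIV"
    using summable_on_SigmaD[OF s'] by simp
  have "(\<Sum>k. \<Sum>m. f k m) = (\<Sum>\<^sub>\<infinity>k. \<Sum>\<^sub>\<infinity>m. f k m)"
    by (simp add: suminf_eq_infsum inner outer)
  also have "\<dots> = (\<Sum>\<^sub>\<infinity>(k, m)\<in>UNIV \<times> UNIV. f k m)"
    by (rule infsum_Sigma'_banach[OF s])
  also have "\<dots> = (\<Sum>\<^sub>\<infinity>(n, k)\<in>(SIGMA n:UNIV. {..n}). f k (n - k))"
    using infsum_reindex_bij_betw[OF bij, of "\<lambda>(k, m). f k m"]
    by (simp add: case_prod_unfold)
  also have "\<dots> = (\<Sum>\<^sub>\<infinity>n. \<Sum>\<^sub>\<infinity>k\<in>{..n}. f k (n - k))"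
    by (rule infsum_Sigma'_banach[OF s', symmetric])
  also have "\<dots> = (\<Sum>n. \<Sum>k\<le>n. f k (n - k))"
    by (simp add: suminf_eq_infsum outer')
  finally show ?thesis .
qed

text \<open>In the term of order n, (b)_n / (q)_n is expanded by the q-Vandermonde sum over k. After
  the interchange, the inner sum over m = n - k is a q-binomial series with parameter a q^k, whose
  value is (a q^k w)_\<infinity> / (w)_\<infinity>.\<close>

theorem jackson_transformation:
  assumes w: "norm w < 1" and c: "\<And>j. c * q ^ j \<noteq> 1"
  shows "phi21_series q a b c w = jackson a b c w / qpoch_inf q w"
proof -
  define f where "f k m = qpoch q a (k + m) * jackson_coeff b c k * w ^ (k + m) / qpoch q q m" for k m
  obtain C where C: "C > 0" "\<And>k. norm (jackson_coeff b c k) \<le> C * (norm (gauss k) * (norm b + norm c) ^ k)"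
    using norm_jackson_coeff_le[OF c] by blast
  obtain D where D: "D > 0" "\<And>n. norm (qpoch q a n) \<le> D"
    using qpoch_bounded[of "norm a"] by auto
  have x: "summable (\<lambda>k. norm (of_real D * jackson_coeff b c k * w ^ k))"
  proof (rule summable_comparison_test'[OF gauss_summable[of "D * C" "(norm b + norm c) * norm w"]])
    fix k
    have "norm (of_real D * jackson_coeff b c k * w ^ k) \<le>
        D * (C * (norm (gauss k) * (norm b + norm c) ^ k)) * norm w ^ k"
      using C D by (simp add: norm_mult norm_power mult_mono mult_right_mono)
    then show "norm (norm (of_real D * jackson_coeff b c k * w ^ k)) \<le>
        D * C * (norm (gauss k) * ((norm b + norm c) * norm w) ^ k)"
      by (simp add: power_mult_distrib mult_ac)
  qed
  have y: "summable (\<lambda>m. norm (w ^ m / qpoch q q m))"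
    using q_binomial_aux[OF w, of 0] by simp
  have bound: "norm (f k m) \<le> norm (of_real D * jackson_coeff b c k * w ^ k) * norm (w ^ m / qpoch q q m)" for k m
  proof -
    have "norm (f k m) = norm (qpoch q a (k + m)) * (norm (jackson_coeff b c k * w ^ k) * norm (w ^ m / qpoch q q m))"
      by (simp add: f_def norm_mult norm_divide power_add)
    also have "\<dots> \<le> D * (norm (jackson_coeff b c k * w ^ k) * norm (w ^ m / qpoch q q m))"
      using D by (intro mult_right_mono) auto
    also have "\<dots> = norm (of_real D * jackson_coeff b c k * w ^ k) * norm (w ^ m / qpoch q q m)"
      using D by (simp add: norm_mult)
    finally show ?thesis .
  qed
  have inner: "(\<Sum>m. f k m) = qpoch q a k * jackson_coeff b c k * w ^ k *
      qpoch_inf q (a * w * q ^ k) / qpoch_inf q w" for k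
  proof -
    have "(\<lambda>m. qpoch q a k * jackson_coeff b c k * w ^ k * (qpoch q (a * q ^ k) m / qpoch q q m * w ^ m)) sums
        (qpoch q a k * jackson_coeff b c k * w ^ k * (qpoch_inf q (a * q ^ k * w) / qpoch_inf q w))"
      by (intro sums_mult q_binomial w)
    moreover have "qpoch q a k * jackson_coeff b c k * w ^ k * (qpoch q (a * q ^ k) m / qpoch q q m * w ^ m) = f k m" for m
      by (simp add: f_def qpoch_add power_add)
    ultimately have "(\<lambda>m. f k m) sums
        (qpoch q a k * jackson_coeff b c k * w ^ k * (qpoch_inf q (a * q ^ k * w) / qpoch_inf q w))"
      by simp
    then show ?thesis by (simp add: sums_iff mult_ac)
  qed
  have "phi21_series q a b c w = (\<Sum>n. \<Sum>k\<le>n. f k (n - k))"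
    unfolding phi21_series_def
  proof (rule suminf_cong)
    fix n
    have cn: "qpoch q c k \<noteq> 0" for k using c by (simp add: qpoch_eq_0_iff)
    have "f k (n - k) = qpoch q a n * w ^ n / qpoch q c n *
        (gauss k * (\<Prod>j<k. b - c * q ^ j) * qpoch q (c * q ^ k) (n - k) / (qpoch q q k * qpoch q q (n - k)))"
      if "k \<le> n" for k
    proof -
      have "qpoch q c n = qpoch q c k * qpoch q (c * q ^ k) (n - k)"
        using qpoch_add[of q c k "n - k"] that by simp
      then have e: "inverse (qpoch q c k) = qpoch q (c * q ^ k) (n - k) / qpoch q c n"
        using cn[of k] cn[of n] by (simp add: divide_simps)
      show ?thesis
        using that unfolding f_def jackson_coeff_def divide_inverse inverse_mult_distrib e
        by (simp add: mult_ac)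
    qed
    then have "(\<Sum>k\<le>n. f k (n - k)) = (\<Sum>k\<le>n. qpoch q a n * w ^ n / qpoch q c n *
        (gauss k * (\<Prod>j<k. b - c * q ^ j) * qpoch q (c * q ^ k) (n - k) / (qpoch q q k * qpoch q q (n - k))))"
      by (intro sum.cong) auto
    also have "\<dots> = qpoch q a n * w ^ n / qpoch q c n * (qpoch q b n / qpoch q q n)"
      unfolding sum_distrib_left[symmetric] q_vandermonde ..
    finally show "qpoch q a n * qpoch q b n / (qpoch q c n * qpoch q q n) * w ^ n = (\<Sum>k\<le>n. f k (n - k))"
      by simp
  qed
  also have "\<dots> = (\<Sum>k. \<Sum>m. f k m)"
    using suminf_triangle[OF x y bound] by simp
  also have "\<dots> = (\<Sum>k. qpoch q a k * jackson_coeff b c k * w ^ k * qpoch_inf q (a * w * q ^ k) / qpoch_inf q w)"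
    unfolding inner ..
  also have "\<dots> = jackson a b c w / qpoch_inf q w"
  proof -
    obtain M where M: "summable M" "\<And>k. norm (qpoch q a k * jackson_coeff b c k * w ^ k * qpoch_inf q (a * w * q ^ k)) \<le> M k"
      using jackson_bound[OF c, where a = a and b = b and R = "norm w"] by auto
    then have "summable (\<lambda>k. qpoch q a k * jackson_coeff b c k * w ^ k * qpoch_inf q (a * w * q ^ k))"
      by (intro summable_comparison_test'[OF M(1)]) auto
    then show ?thesis
      unfolding jackson_def by (rule suminf_divide)
  qed
  finally show ?thesis .
qed

text \<open>This resolves the definite description in \<open>phi21\<close>. Jackson's quotient is
  one continuation, since its numerator is entire and its denominator vanishes only at the excluded
  points. It is the only one, because the plane without a countable set is connected and the domain
  contains the unit disc.\<close>

lemma phi21_eq_jackson: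
  assumes w: "\<And>k. w * q ^ k \<noteq> 1" and c: "\<And>j. c * q ^ j \<noteq> 1"
  shows "phi21 q a b c w = jackson a b c w / qpoch_inf q w"
proof (cases "norm w < 1")
  case True
  then show ?thesis using jackson_transformation[OF True c] by (simp add: phi21_def)
next
  case False
  define D where "D = {\<zeta>. \<forall>k::nat. \<zeta> * q ^ k \<noteq> 1}"
  have D_eq: "D = {\<zeta>. qpoch_inf q \<zeta> \<noteq> 0}"
    by (simp add: D_def qpoch_inf_nonzero_iff)
  have "open D"
    unfolding D_eq by (intro open_Collect_neq continuous_intros continuous_at_imp_continuous_on ballI isCont_qpoch_inf)
  have "D = UNIV - range (\<lambda>k. inverse (q ^ k))"
    using q_nz by (auto simp: D_def field_simps)
  then have "connected D"
    using connected_open_diff_countable[of "UNIV :: complex set" "range (\<lambda>k. inverse (q ^ k))"]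
    by (simp add: connected_UNIV)
  have ball: "ball 0 1 \<subseteq> D"
    using mult_power_q_neq_1 by (auto simp: D_def)
  define J where "J \<zeta> = jackson a b c \<zeta> / qpoch_inf q \<zeta>" for \<zeta>
  have J_hol: "J holomorphic_on D"
    unfolding J_def[abs_def] D_eq
    by (intro holomorphic_intros holomorphic_on_subset[OF jackson_holomorphic[OF c]]
        holomorphic_on_subset[OF qpoch_inf_holomorphic_UNIV]) auto
  have J_eq: "J \<zeta> = phi21_series q a b c \<zeta>" if "norm \<zeta> < 1" for \<zeta>
    using jackson_transformation[OF that c] by (simp add: J_def)
  have uniq: "F w = J w" if "F holomorphic_on D" "\<forall>\<zeta>. norm \<zeta> < 1 \<longrightarrow> F \<zeta> = phi21_series q a b c \<zeta>" for F
  proof -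
    have "F w - J w = 0"
    proof (rule analytic_continuation_open[of "ball 0 1" D "\<lambda>z. F z - J z" "\<lambda>_. 0"])
      show "w \<in> D" using w by (simp add: D_def)
    qed (use that J_hol J_eq ball \<open>open D\<close> \<open>connected D\<close> in \<open>auto intro!: holomorphic_intros\<close>)
    then show ?thesis by simp
  qed
  have "phi21 q a b c w = (THE v. \<exists>F. F holomorphic_on D \<and>
      (\<forall>\<zeta>. norm \<zeta> < 1 \<longrightarrow> F \<zeta> = phi21_series q a b c \<zeta>) \<and> v = F w)"
    using False by (simp add: phi21_def D_def)
  also have "\<dots> = J w"
    using uniq J_hol J_eq by (intro the_equality) blast+
  finally show ?thesis by (simp add: J_def)
qed

section \<open>The entire series and its recurrence\<close>

text \<open>The term of (\<alpha>)_\<infinity> (\<beta>)_\<infinity> times the series 2phi2 with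
  upper parameters a, b, lower parameters \<alpha>, \<beta> and argument y. The lower factorials are
  absorbed into the infinite products.\<close>

definition asc_term :: "complex \<Rightarrow> complex \<Rightarrow> complex \<Rightarrow> complex \<Rightarrow> complex \<Rightarrow> nat \<Rightarrow> complex" where
  "asc_term a b \<alpha> \<beta> y k = qpoch q a k * qpoch q b k / qpoch q q k * gauss k * y ^ k *
     (qpoch_inf q (\<alpha> * q ^ k) * qpoch_inf q (\<beta> * q ^ k))"

text \<open>
  By Jackson's transformation \<open>{}\<^sub>2\<phi>\<^sub>1 \<rightarrow> {}\<^sub>2\<phi>\<^sub>2\<close>, both hypergeometric functions of the theorem are
  of this form up to explicit infinite products, and this form is entire in all parameters.
\<close>

definition asc_sum :: "complex \<Rightarrow> complex \<Rightarrow> complex \<Rightarrow> complex \<Rightarrow> complex \<Rightarrow> complex" where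
  "asc_sum a b \<alpha> \<beta> y = (\<Sum>k. asc_term a b \<alpha> \<beta> y k)"

text \<open>The two upper parameters are exchanged before Jackson's transformation. In the
  application \<open>b\<close> is B\<Lambda>, so c/b = d is free of \<Lambda>, and the sum becomes
  symmetric in the roles of A and B.\<close>

lemma phi21_eq_asc_sum:
  assumes w: "\<And>k. w * q ^ k \<noteq> 1" and c: "\<And>k. b * d * q ^ k \<noteq> 1"
  shows "qpoch_inf q w * qpoch_inf q (b * d) * phi21 q b a (b * d) w = asc_sum d a (b * d) (a * w) (b * w)"
proof -
  have comm: "phi21 q b a (b * d) w = phi21 q a b (b * d) w"
    by (simp add: phi21_def phi21_series_def mult.commute)
  have "qpoch_inf q w \<noteq> 0" using w by (simp add: qpoch_inf_nonzero_iff)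
  then have "qpoch_inf q w * qpoch_inf q (b * d) * phi21 q b a (b * d) w =
      qpoch_inf q (b * d) * jackson a b (b * d) w"
    unfolding comm by (simp add: phi21_eq_jackson[OF w c])
  also have "\<dots> = asc_sum d a (b * d) (a * w) (b * w)"
  proof -
    obtain M where M: "summable M" "\<And>k. norm (qpoch q a k * jackson_coeff b (b * d) k * w ^ k * qpoch_inf q (a * w * q ^ k)) \<le> M k"
      using jackson_bound[OF c, where a = a and b = b and R = "norm w"] by auto
    then have "summable (\<lambda>k. qpoch q a k * jackson_coeff b (b * d) k * w ^ k * qpoch_inf q (a * w * q ^ k))"
      by (intro summable_comparison_test'[OF M(1)]) auto
    then have "qpoch_inf q (b * d) * jackson a b (b * d) w =
        (\<Sum>k. qpoch_inf q (b * d) * (qpoch q a k * jackson_coeff b (b * d) k * w ^ k * qpoch_inf q (a * w * q ^ k)))"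
      unfolding jackson_def by (rule suminf_mult[symmetric])
    also have "\<dots> = asc_sum d a (b * d) (a * w) (b * w)"
      unfolding asc_sum_def
    proof (rule suminf_cong)
      fix k
      have "(\<Prod>j<k. b - b * d * q ^ j) = (\<Prod>j<k. b * (1 - d * q ^ j))"
        by (intro prod.cong) (auto simp: algebra_simps)
      also have "\<dots> = b ^ k * qpoch q d k" by (simp add: prod.distrib qpoch_def)
      finally have p: "(\<Prod>j<k. b - b * d * q ^ j) = b ^ k * qpoch q d k" .
      have nz: "qpoch q (b * d) k \<noteq> 0" using c by (simp add: qpoch_eq_0_iff)
      show "qpoch_inf q (b * d) * (qpoch q a k * jackson_coeff b (b * d) k * w ^ k * qpoch_inf q (a * w * q ^ k)) =
          asc_term d a (b * d) (a * w) (b * w) k"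
        unfolding asc_term_def jackson_coeff_def p qpoch_inf_split[of "b * d" k]
        using nz by (simp add: power_mult_distrib mult_ac)
    qed
    finally show ?thesis .
  qed
  finally show ?thesis .
qed

text \<open>One constant has to serve a whole disc of parameters, because \<alpha> and \<beta> vary
  in the proof of holomorphy and all four parameters vary in the limit below.\<close>

lemma asc_term_bound:
  "\<exists>C>0. \<forall>a\<in>cball 0 R. \<forall>b\<in>cball 0 R. \<forall>\<alpha>\<in>cball 0 R. \<forall>\<beta>\<in>cball 0 R. \<forall>y k.
     norm (asc_term a b \<alpha> \<beta> y k) \<le> C * (norm (gauss k) * norm y ^ k)"
proof -
  obtain C where C: "C > 0" "\<And>a n. a \<in> cball 0 R \<Longrightarrow> norm (qpoch q a n) \<le> C"
    using qpoch_bounded[of R] by blast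
  obtain D where D: "D > 0" "\<And>n. norm (inverse (qpoch q q n)) \<le> D"
    using inverse_qpoch_q_bounded by blast
  obtain E where E: "E > 0" "\<And>x. x \<in> cball 0 R \<Longrightarrow> norm (qpoch_inf q x) \<le> E"
    using qpoch_inf_bounded[of R] by auto
  have E': "norm (qpoch_inf q (x * q ^ k)) \<le> E" if "x \<in> cball 0 R" for x k
    using that norm_mult_power_q_le[of x k] by (intro E) auto
  have "norm (asc_term a b \<alpha> \<beta> y k) \<le> (C * C * D * E * E) * (norm (gauss k) * norm y ^ k)"
    if ab: "a \<in> cball 0 R" "b \<in> cball 0 R" "\<alpha> \<in> cball 0 R" "\<beta> \<in> cball 0 R" for a b \<alpha> \<beta> y k
  proof -
    have "norm (asc_term a b \<alpha> \<beta> y k) = norm (qpoch q a k) * norm (qpoch q b k) * norm (inverse (qpoch q q k)) *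
        norm (qpoch_inf q (\<alpha> * q ^ k)) * norm (qpoch_inf q (\<beta> * q ^ k)) * (norm (gauss k) * norm y ^ k)"
      by (simp add: asc_term_def norm_mult norm_divide norm_inverse norm_power divide_inverse mult_ac)
    also have "\<dots> \<le> (C * C * D * E * E) * (norm (gauss k) * norm y ^ k)"
      using C D E(1) ab
      by (intro mult_mono mult_right_mono E' mult_nonneg_nonneg norm_ge_zero zero_le_power less_imp_le[OF C(1)]
          less_imp_le[OF D(1)] less_imp_le[OF E(1)]) auto
    finally show ?thesis .
  qed
  then show ?thesis using C D E by (intro exI[of _ "C * C * D * E * E"]) auto
qed

lemma summable_asc_term: "summable (asc_term a b \<alpha> \<beta> y)"
proof -
  define R where "R = norm a + norm b + norm \<alpha> + norm \<beta>"
  have "a \<in> cball 0 R" "b \<in> cball 0 R" "\<alpha> \<in> cball 0 R" "\<beta> \<in> cball 0 R"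
    by (simp_all add: R_def)
  then obtain C where C: "\<And>k. norm (asc_term a b \<alpha> \<beta> y k) \<le> C * (norm (gauss k) * norm y ^ k)"
    using asc_term_bound[of R] by meson
  show ?thesis
    by (rule summable_comparison_test'[OF gauss_summable]) (rule C)
qed

lemma asc_sum_holomorphic:
  assumes "f holomorphic_on UNIV" "g holomorphic_on UNIV" "h holomorphic_on UNIV"
  shows "(\<lambda>z. asc_sum a b (f z) (g z) (h z)) holomorphic_on UNIV"
  unfolding asc_sum_def
proof (rule holomorphic_on_UNIV_suminf)
  show "(\<lambda>z. asc_term a b (f z) (g z) (h z) k) holomorphic_on UNIV" for k
    unfolding asc_term_def by (intro holomorphic_intros assms qpoch_q_nonzero)
  fix R :: real
  have bnd: "\<exists>B. \<forall>z\<in>cball 0 R. norm (f z) \<le> B" if "f holomorphic_on UNIV" for f :: "complex \<Rightarrow> complex"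
  proof -
    have "bounded (f ` cball 0 R)"
      using that by (intro compact_imp_bounded compact_continuous_image)
        (auto intro: holomorphic_on_imp_continuous_on holomorphic_on_subset)
    then show ?thesis by (auto simp: bounded_iff)
  qed
  obtain F G H where F: "\<And>z. z \<in> cball 0 R \<Longrightarrow> norm (f z) \<le> F" and G: "\<And>z. z \<in> cball 0 R \<Longrightarrow> norm (g z) \<le> G"
    and H: "\<And>z. z \<in> cball 0 R \<Longrightarrow> norm (h z) \<le> H"
    using bnd[OF assms(1)] bnd[OF assms(2)] bnd[OF assms(3)] by metis
  define S where "S = Max {norm a, norm b, F, G}"
  have S: "norm a \<le> S" "norm b \<le> S" "F \<le> S" "G \<le> S" by (simp_all add: S_def)
  obtain C where C: "C > 0" "\<And>\<alpha> \<beta> y k. \<alpha> \<in> cball 0 S \<Longrightarrow> \<beta> \<in> cball 0 S \<Longrightarrow>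
      norm (asc_term a b \<alpha> \<beta> y k) \<le> C * (norm (gauss k) * norm y ^ k)"
    using asc_term_bound[of S] S by (auto simp: Ball_def)
  have "norm (asc_term a b (f z) (g z) (h z) k) \<le> C * (norm (gauss k) * H ^ k)" if z: "z \<in> cball 0 R" for z k
  proof -
    have "norm (asc_term a b (f z) (g z) (h z) k) \<le> C * (norm (gauss k) * norm (h z) ^ k)"
      using F[OF z] G[OF z] S by (intro C) auto
    also have "\<dots> \<le> C * (norm (gauss k) * H ^ k)"
      using C H[OF z] by (intro mult_left_mono power_mono) auto
    finally show ?thesis .
  qed
  then show "\<exists>M. summable M \<and> (\<forall>k. \<forall>z\<in>cball 0 R. norm (asc_term a b (f z) (g z) (h z) k) \<le> M k)"
    using gauss_summable by blast
qed

text \<open>All four parameters shrink to 0 while y stays fixed. The terms then tend to those of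
  Euler's series for (y)_\<infinity>, and Tannery's theorem exchanges limit and sum.\<close>

lemma asc_sum_tendsto: "(\<lambda>n. asc_sum (a * q ^ n) (b * q ^ n) (\<alpha> * q ^ n) (\<beta> * q ^ n) y) \<longlonglongrightarrow> qpoch_inf q y"
proof -
  define R where "R = norm a + norm b + norm \<alpha> + norm \<beta>"
  have R: "norm (a * q ^ n) \<le> R" "norm (b * q ^ n) \<le> R" "norm (\<alpha> * q ^ n) \<le> R" "norm (\<beta> * q ^ n) \<le> R" for n
    by (rule order_trans[OF norm_mult_power_q_le], simp add: R_def)+
  obtain C where C: "\<And>a b \<alpha> \<beta> k. a \<in> cball 0 R \<Longrightarrow> b \<in> cball 0 R \<Longrightarrow> \<alpha> \<in> cball 0 R \<Longrightarrow> \<beta> \<in> cball 0 R \<Longrightarrow>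
      norm (asc_term a b \<alpha> \<beta> y k) \<le> C * (norm (gauss k) * norm y ^ k)"
    using asc_term_bound[of R] by meson
  have t: "(\<lambda>n. asc_term (a * q ^ n) (b * q ^ n) (\<alpha> * q ^ n) (\<beta> * q ^ n) y k) \<longlonglongrightarrow> gauss k * y ^ k / qpoch q q k" for k
  proof -
    have q: "(\<lambda>n. qpoch q (x * q ^ n) k) \<longlonglongrightarrow> (\<Prod>j<k. 1 - 0 * q ^ j)" for x
      unfolding qpoch_def by (intro tendsto_intros power_q_tendsto_0)
    have i: "(\<lambda>n. qpoch_inf q (x * q ^ n * q ^ k)) \<longlonglongrightarrow> qpoch_inf q (0 * q ^ k)" for x
      by (intro isCont_tendsto_compose[OF isCont_qpoch_inf] tendsto_mult power_q_tendsto_0 tendsto_const)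
    have "(\<lambda>n. asc_term (a * q ^ n) (b * q ^ n) (\<alpha> * q ^ n) (\<beta> * q ^ n) y k) \<longlonglongrightarrow>
        (\<Prod>j<k. 1 - 0 * q ^ j) * (\<Prod>j<k. 1 - 0 * q ^ j) / qpoch q q k * gauss k * y ^ k * (qpoch_inf q (0 * q ^ k) * qpoch_inf q (0 * q ^ k))"
      unfolding asc_term_def by (intro tendsto_mult tendsto_divide q i tendsto_const qpoch_q_nonzero)
    then show ?thesis by simp
  qed
  have "(\<lambda>n. \<Sum>k. asc_term (a * q ^ n) (b * q ^ n) (\<alpha> * q ^ n) (\<beta> * q ^ n) y k) \<longlonglongrightarrow> (\<Sum>k. gauss k * y ^ k / qpoch q q k)"
  proof (rule tannerys_theorem[where M = "\<lambda>k. C * (norm (gauss k) * norm y ^ k)", THEN conjunct2, THEN conjunct2])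
    show "\<forall>\<^sub>F (k, n) in sequentially \<times>\<^sub>F sequentially.
        norm (asc_term (a * q ^ n) (b * q ^ n) (\<alpha> * q ^ n) (\<beta> * q ^ n) y k) \<le> C * (norm (gauss k) * norm y ^ k)"
      using C R by (intro always_eventually) auto
  qed (use t gauss_summable in auto)
  then show ?thesis
    using qpoch_inf_euler[of y] by (simp add: asc_sum_def sums_iff)
qed

text \<open>
  The three-term recurrence: the combined summand is \<open>G (k + 1) - G k\<close> for
  \<open>G k = - Y (1 - a b q\<^sup>k) U (k - 1)\<close>, where \<open>y = q Y\<close> and \<open>U\<close> is the summand of the middle term.
\<close>

lemma asc_sum_recurrence:
  assumes rel: "\<alpha> * \<beta> = a * b * q * Y"
  shows "asc_sum a b \<alpha> \<beta> (q * Y) = (1 + Y - \<alpha> - \<beta>) * asc_sum (a * q) (b * q) (\<alpha> * q) (\<beta> * q) (q * Y)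
           - Y * (1 - a * q) * (1 - b * q) * asc_sum (a * q * q) (b * q * q) (\<alpha> * q * q) (\<beta> * q * q) (q * Y)"
proof -
  define y where "y = q * Y"
  define T where "T = asc_term a b \<alpha> \<beta> y"
  define U where "U = asc_term (a * q) (b * q) (\<alpha> * q) (\<beta> * q) y"
  define Z where "Z k = Y * (1 - a * q) * (1 - b * q) * asc_term (a * q * q) (b * q * q) (\<alpha> * q * q) (\<beta> * q * q) y k" for k
  \<comment> \<open>\<open>W\<close> is the third series \<open>Z\<close> moved up by one index,
    where its terms become multiples of those of \<open>U\<close>. Since \<open>W 0 = 0\<close>, the
    shift does not change the sum.\<close>
  define W where "W k = (1 - inverse (q ^ k)) * U k" for k
  define G where "G k = (if k = 0 then 0 else - Y * (1 - a * b * q ^ k) * U (k - 1))" for k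
  have nz: "qpoch q q k \<noteq> 0" "1 - q * q ^ k \<noteq> 0" "q ^ k \<noteq> 0" for k
    using qpoch_q_nonzero power_q_neq_1[of k] q_nz by auto
  have ZW: "Z k = W (Suc k)" for k
  proof -
    have "Z k = Y * (((1 - a * q) * qpoch q (a * q * q) k) * ((1 - b * q) * qpoch q (b * q * q) k)) /
        qpoch q q k * gauss k * y ^ k * (qpoch_inf q (\<alpha> * q * q * q ^ k) * qpoch_inf q (\<beta> * q * q * q ^ k))"
      unfolding Z_def asc_term_def by (simp add: mult_ac)
    also have "\<dots> = Y * (qpoch q (a * q) (Suc k) * qpoch q (b * q) (Suc k)) / qpoch q q k * gauss k * y ^ k *
        (qpoch_inf q (\<alpha> * q * q ^ Suc k) * qpoch_inf q (\<beta> * q * q ^ Suc k))"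
      unfolding qpoch_Suc_shift by (simp add: mult_ac)
    also have "\<dots> = W (Suc k)"
      unfolding W_def U_def asc_term_def gauss_Suc qpoch_Suc[of q q] y_def
      using nz[of k] q_nz by (simp add: field_simps)
    finally show ?thesis .
  qed
  have tele: "T k - (1 + Y - \<alpha> - \<beta>) * U k + W k = G (Suc k) - G k" for k
  proof (cases k)
    case 0
    have "T 0 = (1 - \<alpha>) * (1 - \<beta>) * U 0"
      by (simp add: T_def U_def asc_term_def qpoch_inf_Suc[of \<alpha>] qpoch_inf_Suc[of \<beta>])
    moreover have "(1 - \<alpha>) * (1 - \<beta>) = 1 - \<alpha> - \<beta> + a * b * q * Y"
      unfolding rel[symmetric] by (simp add: algebra_simps)
    ultimately show ?thesis using 0 by (simp add: W_def G_def algebra_simps)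
  next
    case (Suc j)
    define x where "x = q ^ k"
    \<comment> \<open>With k = j + 1, \<open>V\<close> is a common factor of \<open>T k\<close>,
      \<open>U k\<close> and \<open>U j\<close>: its factorials of a q and b q stop at j, and its
      infinite products start one step later. What remains is a polynomial identity in x =
      q^k.\<close>
    define V where "V = qpoch q (a * q) j * qpoch q (b * q) j / qpoch q q k * gauss k * y ^ k *
      (qpoch_inf q (\<alpha> * q * q ^ k) * qpoch_inf q (\<beta> * q * q ^ k))"
    have inf: "qpoch_inf q (z * q ^ k) = (1 - z * x) * qpoch_inf q (z * q * q ^ k)" for z
      using qpoch_inf_Suc[of "z * q ^ k"] by (simp add: x_def mult_ac)
    have T: "T k = (1 - a) * (1 - b) * ((1 - \<alpha> * x) * (1 - \<beta> * x)) * V"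
      unfolding T_def asc_term_def V_def inf[of \<alpha>] inf[of \<beta>] unfolding Suc qpoch_Suc_shift[of q a] qpoch_Suc_shift[of q b]
      by (simp add: mult_ac)
    have U: "U k = (1 - a * x) * (1 - b * x) * V"
      unfolding U_def asc_term_def V_def Suc qpoch_Suc[of q "a * q"] qpoch_Suc[of q "b * q"] x_def
      by (simp add: mult_ac)
    have xx: "x = q * q ^ j" by (simp add: x_def Suc)
    have x0: "x \<noteq> 0" using q_nz by (simp add: x_def)
    have Uj: "Y * U j = - (1 / x) * (1 - x) * ((1 - \<alpha> * x) * (1 - \<beta> * x)) * V"
    proof -
      have i: "qpoch_inf q (z * q * q ^ j) = (1 - z * x) * qpoch_inf q (z * q * q ^ k)" for z
        using inf[of z] by (simp add: Suc mult_ac)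
      define H where "H = qpoch q (a * q) j * qpoch q (b * q) j / qpoch q q j * gauss j * y ^ j *
         (qpoch_inf q (\<alpha> * q * q ^ k) * qpoch_inf q (\<beta> * q * q ^ k))"
      have x1: "1 - x \<noteq> 0" using nz(2)[of j] by (simp add: xx)
      have "V = - (H * (q ^ j * y)) / (1 - x)"
        unfolding V_def H_def Suc gauss_Suc qpoch_Suc[of q q] xx by simp
      then have "V * (1 - x) = - (x * Y * H)"
        using x1 by (simp add: y_def xx mult_ac)
      moreover have "U j = (1 - \<alpha> * x) * (1 - \<beta> * x) * H"
        unfolding U_def asc_term_def i H_def by (simp add: mult_ac)
      moreover have "- (1 / x) * (1 - x) * ((1 - \<alpha> * x) * (1 - \<beta> * x)) * V =
          - (1 / x) * ((1 - \<alpha> * x) * (1 - \<beta> * x)) * (V * (1 - x))"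
        by (simp only: mult_ac)
      ultimately show ?thesis using x0 by simp
    qed
    have Gk: "G k = (1 - a * b * x) * ((1 / x) * (1 - x) * ((1 - \<alpha> * x) * (1 - \<beta> * x)) * V)"
    proof -
      have "G k = - (1 - a * b * x) * (Y * U j)" by (simp add: G_def Suc x_def algebra_simps)
      then show ?thesis unfolding Uj
        by (simp only: mult_minus_left mult_minus_right minus_minus mult.assoc)
    qed
    have GS: "G (Suc k) = - Y * (1 - a * b * q * x) * U k"
      by (simp add: G_def x_def mult_ac)
    have Wk: "W k = (1 - 1 / x) * U k"
      by (simp add: W_def x_def divide_inverse)
    have key: "(1 - \<alpha> * x) * (1 - \<beta> * x) = 1 - (\<alpha> + \<beta>) * x + a * b * q * Y * x * x"
      unfolding rel[symmetric] by (simp add: algebra_simps)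
    have "x * (T k - (1 + Y - \<alpha> - \<beta>) * U k + W k) = x * (G (Suc k) - G k)"
      unfolding GS Gk Wk T key U using x0 by (simp add: field_simps)
    then show ?thesis using x0 by simp
  qed
  have sT: "T sums asc_sum a b \<alpha> \<beta> y" and sU: "U sums asc_sum (a * q) (b * q) (\<alpha> * q) (\<beta> * q) y"
    unfolding T_def U_def asc_sum_def by (intro summable_sums summable_asc_term)+
  have "Z sums (Y * (1 - a * q) * (1 - b * q) * asc_sum (a * q * q) (b * q * q) (\<alpha> * q * q) (\<beta> * q * q) y)"
    unfolding Z_def asc_sum_def by (intro sums_mult summable_sums summable_asc_term)
  moreover have "Z = (\<lambda>k. W (Suc k))" "W 0 = 0" by (simp_all add: ZW fun_eq_iff W_def)
  ultimately have sW: "W sums (Y * (1 - a * q) * (1 - b * q) * asc_sum (a * q * q) (b * q * q) (\<alpha> * q * q) (\<beta> * q * q) y)"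
    using sums_Suc_iff[of W] by simp
  have "(\<lambda>k. G (Suc k)) \<longlonglongrightarrow> - Y * (1 - a * b * 0) * 0"
  proof -
    have "(\<lambda>k. - Y * (1 - a * b * q ^ Suc k) * U k) \<longlonglongrightarrow> - Y * (1 - a * b * 0) * 0"
      by (intro tendsto_intros LIMSEQ_Suc[OF LIMSEQ_power_zero] norm_q summable_LIMSEQ_zero sums_summable[OF sU])
    then show ?thesis by (simp add: G_def)
  qed
  then have "G \<longlonglongrightarrow> 0" by (simp add: filterlim_sequentially_Suc)
  then have "(\<lambda>k. G (Suc k) - G k) sums (0 - G 0)"
    by (rule telescope_sums)
  moreover have "(\<lambda>k. G (Suc k) - G k) sums (asc_sum a b \<alpha> \<beta> y -
      (1 + Y - \<alpha> - \<beta>) * asc_sum (a * q) (b * q) (\<alpha> * q) (\<beta> * q) y +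
      Y * (1 - a * q) * (1 - b * q) * asc_sum (a * q * q) (b * q * q) (\<alpha> * q * q) (\<beta> * q * q) y)"
    unfolding tele[symmetric] by (intro sums_add sums_diff sums_mult sT sU sW)
  ultimately show ?thesis
    unfolding y_def[symmetric] using sums_unique2 by (fastforce simp: G_def algebra_simps)
qed

end

section \<open>The minimal solution and the continued fraction\<close>

text \<open>Once |r n| < \<kappa> < 1 and |\<epsilon> n| < (1 - \<kappa>) \<eta>/2, the recursion
  preserves the bound \<eta>/2, and whatever error is present at that index decays like
  \<kappa>^m.\<close>

lemma tendsto_0_of_contraction:
  fixes e :: "nat \<Rightarrow> complex"
  assumes step: "\<And>n. e (Suc n) = \<epsilon> n + r n * e n"
    and \<epsilon>: "\<epsilon> \<longlonglongrightarrow> 0" and r: "r \<longlonglongrightarrow> r0" "norm r0 < 1"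
  shows "e \<longlonglongrightarrow> 0"
proof (rule LIMSEQ_I)
  fix \<eta> :: real assume "\<eta> > 0"
  obtain \<kappa> where \<kappa>: "norm r0 < \<kappa>" "\<kappa> < 1" using r(2) dense by blast
  have k0: "\<kappa> > 0" using \<kappa>(1) by (rule le_less_trans[OF norm_ge_zero])
  have "eventually (\<lambda>n. norm (r n) < \<kappa>) sequentially"
    using order_tendstoD(2)[OF tendsto_norm[OF r(1)] \<kappa>(1)] .
  moreover have "eventually (\<lambda>n. norm (\<epsilon> n) < (1 - \<kappa>) * (\<eta> / 2)) sequentially"
    using order_tendstoD(2)[OF tendsto_norm[OF \<epsilon>], of "(1 - \<kappa>) * (\<eta> / 2)"] \<kappa> \<open>\<eta> > 0\<close> by simp
  ultimately obtain N where N: "\<And>n. n \<ge> N \<Longrightarrow> norm (r n) < \<kappa> \<and> norm (\<epsilon> n) < (1 - \<kappa>) * (\<eta> / 2)"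
    by (metis (mono_tags, lifting) eventually_conj eventually_sequentially)
  have bound: "norm (e (N + m)) \<le> \<eta> / 2 + \<kappa> ^ m * norm (e N)" for m
  proof (induction m)
    case (Suc m)
    have "norm (e (N + Suc m)) \<le> norm (\<epsilon> (N + m)) + norm (r (N + m)) * norm (e (N + m))"
      using step[of "N + m"] norm_triangle_ineq[of "\<epsilon> (N + m)" "r (N + m) * e (N + m)"] by (simp add: norm_mult)
    also have "\<dots> \<le> (1 - \<kappa>) * (\<eta> / 2) + \<kappa> * (\<eta> / 2 + \<kappa> ^ m * norm (e N))"
      using N[of "N + m"] Suc k0 by (intro add_mono mult_mono) auto
    also have "\<dots> = \<eta> / 2 + \<kappa> ^ Suc m * norm (e N)" by (simp add: field_simps)
    finally show ?case .
  qed (use \<open>\<eta> > 0\<close> in simp)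
  have "(\<lambda>m. \<kappa> ^ m * norm (e N)) \<longlonglongrightarrow> 0 * norm (e N)"
    using \<kappa> k0 by (intro tendsto_intros LIMSEQ_power_zero) auto
  then have "eventually (\<lambda>m. \<kappa> ^ m * norm (e N) < \<eta> / 2) sequentially"
    using \<open>\<eta> > 0\<close> by (intro order_tendstoD(2)) auto
  then obtain M where M: "\<And>m. m \<ge> M \<Longrightarrow> \<kappa> ^ m * norm (e N) < \<eta> / 2"
    by (auto simp: eventually_sequentially)
  have "norm (e n - 0) < \<eta>" if "n \<ge> N + M" for n
  proof -
    have "M \<le> n - N" using that by simp
    from M[OF this] show ?thesis using bound[of "n - N"] that by simp
  qed
  then show "\<exists>no. \<forall>n\<ge>no. norm (e n - 0) < \<eta>" by blast
qed

text \<open>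
  The tail of a minimal solution \<open>x\<close> turns the second-order recurrence of numerators or
  denominators \<open>s\<close> into a first-order one, which is asymptotically a contraction.
\<close>

lemma tendsto_of_minimal_solution:
  fixes s x d :: "nat \<Rightarrow> complex"
  assumes inv: "\<And>n. s (Suc n) * x (Suc n) - d n * s n * x (Suc (Suc n)) = C"
    and x: "x \<longlonglongrightarrow> x0" "x0 \<noteq> 0" and d: "d \<longlonglongrightarrow> d0" "norm d0 < 1"
  shows "s \<longlonglongrightarrow> C / (x0 * (1 - d0))"
proof -
  obtain N where N: "\<And>n. n \<ge> N \<Longrightarrow> x n \<noteq> 0"
    using tendsto_imp_eventually_ne[OF x] by (auto simp: eventually_sequentially)
  \<comment> \<open>\<open>L\<close> is the fixed point of the limiting recursion s = C / x0 + d0 s,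
    so the error \<open>s n - L\<close> satisfies a contraction with a perturbation tending to
    0.\<close>
  define L where "L = C / (x0 * (1 - d0))"
  have d1: "1 - d0 \<noteq> 0" using d(2) by auto
  define p where "p n = C / x (Suc (n + N))" for n
  define r where "r n = d (n + N) * x (Suc (Suc (n + N))) / x (Suc (n + N))" for n
  have xS: "(\<lambda>n. x (Suc (n + N))) \<longlonglongrightarrow> x0" "(\<lambda>n. x (Suc (Suc (n + N)))) \<longlonglongrightarrow> x0"
    using LIMSEQ_ignore_initial_segment[OF x(1), of "Suc N"] LIMSEQ_ignore_initial_segment[OF x(1), of "Suc (Suc N)"]
    by simp_all
  have "p \<longlonglongrightarrow> C / x0"
    unfolding p_def by (intro tendsto_intros xS x)
  have "r \<longlonglongrightarrow> d0 * x0 / x0"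
    unfolding r_def by (intro tendsto_intros xS x LIMSEQ_ignore_initial_segment d)
  then have r: "r \<longlonglongrightarrow> d0" using x by simp
  have "(\<lambda>n. p n + r n * L - L) \<longlonglongrightarrow> C / x0 + d0 * L - L"
    by (intro tendsto_intros \<open>p \<longlonglongrightarrow> C / x0\<close> r)
  moreover have "C / x0 + d0 * L - L = 0"
    unfolding L_def using x(2) d1 by (simp add: divide_simps) (simp add: algebra_simps)
  ultimately have \<epsilon>: "(\<lambda>n. p n + r n * L - L) \<longlonglongrightarrow> 0" by simp
  have "(\<lambda>n. s (n + N) - L) \<longlonglongrightarrow> 0"
  proof (rule tendsto_0_of_contraction[OF _ \<epsilon> r d(2)])
    fix n
    have "s (Suc n + N) = p n + r n * s (n + N)"
      using inv[of "n + N"] N[of "Suc (n + N)"] by (simp add: p_def r_def field_simps)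
    then show "s (Suc n + N) - L = p n + r n * L - L + r n * (s (n + N) - L)"
      by (simp add: algebra_simps)
  qed
  then have "(\<lambda>n. s (n + N)) \<longlonglongrightarrow> L" by (simp add: LIM_zero_iff)
  then show ?thesis unfolding L_def[symmetric] by (rule LIMSEQ_offset)
qed

section \<open>The sequence \<open>X\<close> and its Casoratian\<close>

locale asc = q_base +
  fixes A B \<delta> \<gamma> :: complex
  assumes A_nz: "A \<noteq> 0" and B_nz: "B \<noteq> 0" and \<delta>_nz: "\<delta> \<noteq> 0"
    and A_neq: "\<And>n. A * q ^ n \<noteq> 1" and B_neq: "\<And>n. B * q ^ n \<noteq> 1"
    and \<gamma>_sq: "\<gamma>\<^sup>2 = 4 * (q / (A * B * \<delta>))"
begin

lemma \<gamma>_nz: "\<gamma> \<noteq> 0"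
  using \<gamma>_sq q_nz A_nz B_nz \<delta>_nz by auto

lemma AB\<delta>_\<gamma>: "A * B * \<delta> * \<gamma>\<^sup>2 = 4 * q"
  using \<gamma>_sq A_nz B_nz \<delta>_nz by (simp add: field_simps)

text \<open>
  The variable \<open>v = 2\<Lambda>/\<gamma>\<close> uniformizes \<open>z = \<gamma> (v + 1/v) / 2\<close>. Up to infinite products, \<open>X 0 v\<close> and
  \<open>X 1 v\<close> are the denominator and the numerator series of the theorem.
\<close>

definition X :: "nat \<Rightarrow> complex \<Rightarrow> complex" where
  "X n v = asc_sum (A / q * q ^ n) (B / q * q ^ n) (A * B * \<gamma> / (2 * q) * v * q ^ n)
     (A * B * \<delta> * \<gamma> / (2 * q) * v * q ^ n) (q * v\<^sup>2)"

text \<open>For z = \<open>J v\<close>, the first coefficient is (2v/\<gamma>) (z - a_n) and the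
  second is (2v/\<gamma>)^2 times the square of b_(n+1), so this is the recurrence of the continued
  fraction after rescaling. The condition on \<alpha>\<beta> in \<open>asc_sum_recurrence\<close>,
  with Y = v^2, is the equation for \<gamma>^2.\<close>

lemma X_recurrence:
  "X n v = (1 + v\<^sup>2 - 2 / \<gamma> * (1 + 1 / \<delta>) * v * q ^ n) * X (Suc n) v
     - v\<^sup>2 * (1 - A * q ^ n) * (1 - B * q ^ n) * X (Suc (Suc n)) v"
proof -
  have \<beta>: "A * B * \<delta> * \<gamma> / (2 * q) = 2 / \<gamma>" and \<alpha>: "A * B * \<gamma> / (2 * q) = 2 / \<gamma> / \<delta>"
    using AB\<delta>_\<gamma> \<gamma>_nz q_nz \<delta>_nz by (simp_all add: field_simps power2_eq_square)
  have "A * B * \<gamma> / (2 * q) * v * q ^ n * (A * B * \<delta> * \<gamma> / (2 * q) * v * q ^ n) =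
      (A * B * \<delta> * \<gamma>\<^sup>2) * (A * B / (4 * q * q) * v\<^sup>2 * q ^ n * q ^ n)"
    by (simp add: power2_eq_square mult_ac)
  also have "\<dots> = A / q * q ^ n * (B / q * q ^ n) * q * v\<^sup>2"
    unfolding AB\<delta>_\<gamma> using q_nz by (simp add: field_simps)
  finally have rel: "A * B * \<gamma> / (2 * q) * v * q ^ n * (A * B * \<delta> * \<gamma> / (2 * q) * v * q ^ n) =
      A / q * q ^ n * (B / q * q ^ n) * q * v\<^sup>2" .
  have a: "A / q * q ^ n * q = A * q ^ n" "B / q * q ^ n * q = B * q ^ n"
    using q_nz by simp_all
  have "1 + v\<^sup>2 - A * B * \<gamma> / (2 * q) * v * q ^ n - A * B * \<delta> * \<gamma> / (2 * q) * v * q ^ n =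
      1 + v\<^sup>2 - 2 / \<gamma> * (1 + 1 / \<delta>) * v * q ^ n"
    unfolding \<alpha> \<beta> using \<gamma>_nz \<delta>_nz by (simp add: field_simps)
  then show ?thesis
    using asc_sum_recurrence[OF rel] unfolding X_def a by (simp only: power_Suc2 mult.assoc[symmetric] a)
qed

lemma X_tendsto: "(\<lambda>n. X n v) \<longlonglongrightarrow> qpoch_inf q (q * v\<^sup>2)"
  unfolding X_def by (rule asc_sum_tendsto)

lemma X_holomorphic_UNIV: "X n holomorphic_on UNIV"
  unfolding X_def[abs_def] by (intro asc_sum_holomorphic holomorphic_intros)

lemma X_holomorphic [holomorphic_intros]: "f holomorphic_on S \<Longrightarrow> (\<lambda>z. X n (f z)) holomorphic_on S"
  using holomorphic_on_compose_gen[OF _ X_holomorphic_UNIV, of f S] by (simp add: o_def)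

lemma X_at_0: "X n 0 = 1"
proof -
  have "(\<Sum>k. asc_term (A / q * q ^ n) (B / q * q ^ n) 0 0 0 k) =
      (\<Sum>k\<in>{0}. asc_term (A / q * q ^ n) (B / q * q ^ n) 0 0 0 k)"
    by (rule suminf_finite) (auto simp: asc_term_def)
  then show ?thesis by (simp add: X_def asc_sum_def) (simp add: asc_term_def)
qed

lemma limit_X_nonzero: "norm v < 1 \<Longrightarrow> qpoch_inf q (q * v\<^sup>2) \<noteq> 0"
proof -
  assume "norm v < 1"
  then have "norm (q * v\<^sup>2) < 1"
    using norm_q q_nz mult_strict_mono'[of "norm q" 1 "(norm v)\<^sup>2" 1] by (simp add: norm_mult norm_power power_less_one_iff abs_square_less_1)
  then show ?thesis
    using mult_power_q_neq_1 by (auto simp: qpoch_inf_nonzero_iff)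
qed

text \<open>The coefficient of \<open>X (n + 2)\<close> never vanishes, so two consecutive zeros
  would propagate to all later indices and force the limit to be 0.\<close>

lemma X0_X1_not_both_zero:
  assumes "v \<noteq> 0" "norm v < 1" "X 0 v = 0"
  shows "X 1 v \<noteq> 0"
proof
  assume "X 1 v = 0"
  have "X n v = 0 \<and> X (Suc n) v = 0" for n
  proof (induction n)
    case (Suc n)
    then have X0: "X n v = 0" "X (Suc n) v = 0" by auto
    have "v\<^sup>2 * (1 - A * q ^ n) * (1 - B * q ^ n) * X (Suc (Suc n)) v = 0"
      using X_recurrence[of n v] unfolding X0 by simp
    moreover have "v\<^sup>2 \<noteq> 0" "1 - A * q ^ n \<noteq> 0" "1 - B * q ^ n \<noteq> 0"
      using assms(1) A_neq[of n] B_neq[of n] by auto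
    ultimately show ?case using Suc by (metis mult_eq_0_iff)
  qed (use assms \<open>X 1 v = 0\<close> in simp)
  then have "qpoch_inf q (q * v\<^sup>2) = 0"
    using X_tendsto[of v] by (simp add: LIMSEQ_const_iff)
  then show False using limit_X_nonzero[OF assms(2)] by simp
qed

text \<open>
  Suitably rescaled, \<open>X n v\<close> and \<open>X n (1/v)\<close> solve the same recurrence; the proof evaluates their
  Casoratian by \<open>n \<rightarrow> \<infinity>\<close>.
\<close>

lemma casoratian:
  assumes v: "v \<noteq> 0"
  shows "X 0 v * X 1 (1 / v) / v - v * X 1 v * X 0 (1 / v) =
    qpoch_inf q A * qpoch_inf q B * qpoch_inf q (q * v\<^sup>2) * qpoch_inf q (q / v\<^sup>2) * (1 / v - v)"
proof -
  define w where "w = 1 / v"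
  \<comment> \<open>\<open>K n\<close> is the Casoratian of v^n \<open>X n v\<close> and v^(-n)
    \<open>X n (1/v)\<close>; the powers cancel up to the single factors v and 1/v. In this scaling
    both solve one recurrence, whose coefficients are invariant under v -> 1/v.\<close>
  define K where "K n = X n v * X (Suc n) w / v - v * X (Suc n) v * X n w" for n
  have K: "K n = (1 - A * q ^ n) * (1 - B * q ^ n) * K (Suc n)" for n
  proof -
    define c where "c = v + 1 / v - 2 / \<gamma> * (1 + 1 / \<delta>) * q ^ n"
    define d where "d = (1 - A * q ^ n) * (1 - B * q ^ n)"
    have c1: "1 + v\<^sup>2 - 2 / \<gamma> * (1 + 1 / \<delta>) * v * q ^ n = v * c"
      using v by (simp add: c_def algebra_simps power2_eq_square)
    have c2: "1 + w\<^sup>2 - 2 / \<gamma> * (1 + 1 / \<delta>) * w * q ^ n = w * c"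
      using v by (simp add: c_def w_def algebra_simps power2_eq_square)
    have 1: "X n v / v = c * X (Suc n) v - d * v * X (Suc (Suc n)) v"
      unfolding X_recurrence[of n v] c1 d_def using v by (simp add: field_simps power2_eq_square)
    have 2: "v * X n w = c * X (Suc n) w - d / v * X (Suc (Suc n)) w"
      unfolding X_recurrence[of n w] c2 d_def using v by (simp add: w_def field_simps power2_eq_square)
    have "K n = (X n v / v) * X (Suc n) w - X (Suc n) v * (v * X n w)"
      by (simp add: K_def)
    also have "\<dots> = d * K (Suc n)"
      unfolding 1 2 K_def by (simp add: algebra_simps)
    finally show ?thesis by (simp add: d_def)
  qed
  have it: "K 0 = qpoch q A n * qpoch q B n * K n" for n
  proof (induction n)
    case (Suc n)
    then show ?case using K[of n] by (simp add: qpoch_Suc mult_ac)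
  qed simp
  have "(\<lambda>n. qpoch q A n * qpoch q B n * K n) \<longlonglongrightarrow> qpoch_inf q A * qpoch_inf q B *
      (qpoch_inf q (q * v\<^sup>2) * qpoch_inf q (q * w\<^sup>2) / v - v * qpoch_inf q (q * v\<^sup>2) * qpoch_inf q (q * w\<^sup>2))"
    unfolding K_def by (intro tendsto_intros LIMSEQ_qpoch X_tendsto LIMSEQ_Suc v)
  then have "K 0 = qpoch_inf q A * qpoch_inf q B *
      (qpoch_inf q (q * v\<^sup>2) * qpoch_inf q (q * w\<^sup>2) / v - v * qpoch_inf q (q * v\<^sup>2) * qpoch_inf q (q * w\<^sup>2))"
    unfolding it[symmetric] by (simp add: LIMSEQ_const_iff)
  then show ?thesis by (simp add: K_def w_def power_divide algebra_simps)
qed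

definition J :: "complex \<Rightarrow> complex" where
  "J v = \<gamma> / 2 * (v + 1 / v)"

section \<open>Numerators and denominators of the continued fraction at \<open>J v\<close>\<close>

context
  fixes v :: complex
  assumes v: "v \<noteq> 0" "norm v < 1"
begin

text \<open>This is \<Lambda>_+, while \<Lambda>_- is \<gamma>v/2. It is the growth rate of
  numerators and denominators, so dividing them by \<rho>^n leaves sequences with finite
  limits.\<close>

private definition "\<rho> = \<gamma> / (2 * v)"

private lemma \<rho>_nz: "\<rho> \<noteq> 0"
  using v \<gamma>_nz by (simp add: \<rho>_def)

private definition "c n = 1 + v\<^sup>2 - 2 / \<gamma> * (1 + 1 / \<delta>) * v * q ^ n"
private definition "d n = v\<^sup>2 * (1 - A * q ^ n) * (1 - B * q ^ n)"

private lemma X_rec: "X n v = c n * X (Suc n) v - d n * X (Suc (Suc n)) v"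
  unfolding c_def d_def by (rule X_recurrence)

private lemma beta_eq: "asc_\<beta> q \<delta> (J v) n = \<rho> * c n"
  using v \<gamma>_nz \<delta>_nz
  by (simp add: asc_\<beta>_def asc_a_def J_def \<rho>_def c_def field_simps power2_eq_square)

private lemma alpha_eq: "asc_\<alpha> q A B \<delta> (Suc n) = - \<rho>\<^sup>2 * d n"
proof -
  have "\<rho>\<^sup>2 * v\<^sup>2 = q / (A * B * \<delta>)"
    using v \<gamma>_sq by (simp add: \<rho>_def power_divide power_mult_distrib)
  then show ?thesis
    by (simp add: asc_\<alpha>_def asc_bsq_def d_def mult.assoc[symmetric])
qed

text \<open>The additional factor \<rho> normalizes \<open>P 1\<close> to 1, as numerators start one
  index later than denominators.\<close>

private definition "P n = cf_num (asc_\<alpha> q A B \<delta>) (asc_\<beta> q \<delta> (J v)) n * \<rho> / \<rho> ^ n"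
private definition "Q n = cf_den (asc_\<alpha> q A B \<delta>) (asc_\<beta> q \<delta> (J v)) n / \<rho> ^ n"

private lemma P_rec: "P (Suc (Suc n)) = c (Suc n) * P (Suc n) - d n * P n"
  using \<rho>_nz by (simp add: P_def beta_eq alpha_eq field_simps power2_eq_square)

private lemma Q_rec: "Q (Suc (Suc n)) = c (Suc n) * Q (Suc n) - d n * Q n"
  using \<rho>_nz by (simp add: Q_def beta_eq alpha_eq field_simps power2_eq_square)

text \<open>Pairing a solution with the minimal one gives a quantity independent of n, whose value
  is read off at n = 0. It has the shape required by \<open>tendsto_of_minimal_solution\<close>, and
  so yields the limits of \<open>Q\<close> and, likewise, of \<open>P\<close>.\<close>

private lemma Q_inv: "Q (Suc n) * X (Suc n) v - d n * Q n * X (Suc (Suc n)) v = X 0 v"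
proof (induction n)
  case 0
  show ?case using \<rho>_nz X_rec[of 0] by (simp add: Q_def beta_eq)
next
  case (Suc n)
  then show ?case using X_rec[of "Suc n"] by (simp add: Q_rec algebra_simps)
qed

private lemma P_inv: "P (Suc n) * X (Suc n) v - d n * P n * X (Suc (Suc n)) v = X 1 v"
proof (induction n)
  case 0
  show ?case using \<rho>_nz by (simp add: P_def asc_\<alpha>_def)
next
  case (Suc n)
  then show ?case using X_rec[of "Suc n"] by (simp add: P_rec algebra_simps)
qed

private lemma d_tendsto: "d \<longlonglongrightarrow> v\<^sup>2"
proof -
  have "(\<lambda>n. v\<^sup>2 * (1 - A * q ^ n) * (1 - B * q ^ n)) \<longlonglongrightarrow> v\<^sup>2 * (1 - 0) * (1 - 0)"
    by (intro tendsto_intros power_q_tendsto_0)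
  then show ?thesis by (simp add: d_def[abs_def])
qed

private lemma norm_v2: "norm (v\<^sup>2) < 1"
  using v by (simp add: norm_power power_less_one_iff abs_square_less_1)

private definition "L = qpoch_inf q (q * v\<^sup>2) * (1 - v\<^sup>2)"

private lemma L_nz: "L \<noteq> 0"
  using limit_X_nonzero[OF v(2)] norm_v2 by (auto simp: L_def)

private lemma Q_tendsto: "Q \<longlonglongrightarrow> X 0 v / L"
  unfolding L_def
  by (rule tendsto_of_minimal_solution[where x = "\<lambda>n. X n v", OF Q_inv X_tendsto limit_X_nonzero[OF v(2)] d_tendsto norm_v2])

private lemma P_tendsto: "P \<longlonglongrightarrow> X 1 v / L"
  unfolding L_def
  by (rule tendsto_of_minimal_solution[where x = "\<lambda>n. X n v", OF P_inv X_tendsto limit_X_nonzero[OF v(2)] d_tendsto norm_v2])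

private lemma num_eq: "cf_num (asc_\<alpha> q A B \<delta>) (asc_\<beta> q \<delta> (J v)) n = \<rho> ^ n / \<rho> * P n"
  and den_eq: "cf_den (asc_\<alpha> q A B \<delta>) (asc_\<beta> q \<delta> (J v)) n = \<rho> ^ n * Q n"
  using \<rho>_nz by (simp_all add: P_def Q_def)

lemma asc_cf_converges:
  assumes "X 0 v \<noteq> 0"
  shows "cf_converges_to (asc_\<alpha> q A B \<delta>) (asc_\<beta> q \<delta> (J v)) (2 * v / \<gamma> * X 1 v / X 0 v)"
  unfolding cf_converges_to_def
proof
  have "eventually (\<lambda>n. Q n \<noteq> 0) sequentially"
    using assms L_nz by (intro tendsto_imp_eventually_ne[OF Q_tendsto]) auto
  then show "\<forall>\<^sub>F n in sequentially. cf_den (asc_\<alpha> q A B \<delta>) (asc_\<beta> q \<delta> (J v)) n \<noteq> 0"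
    by eventually_elim (simp add: den_eq \<rho>_nz)
  have "(\<lambda>n. 1 / \<rho> * P n / Q n) \<longlonglongrightarrow> 1 / \<rho> * (X 1 v / L) / (X 0 v / L)"
    using assms L_nz by (intro tendsto_intros P_tendsto Q_tendsto) auto
  moreover have "1 / \<rho> * (X 1 v / L) / (X 0 v / L) = 2 * v / \<gamma> * X 1 v / X 0 v"
    using L_nz by (simp add: \<rho>_def)
  moreover have "(\<lambda>n. 1 / \<rho> * P n / Q n) = cf_approx (asc_\<alpha> q A B \<delta>) (asc_\<beta> q \<delta> (J v))"
    using \<rho>_nz by (simp add: cf_approx_def num_eq den_eq fun_eq_iff)
  ultimately show "cf_approx (asc_\<alpha> q A B \<delta>) (asc_\<beta> q \<delta> (J v)) \<longlonglongrightarrow> 2 * v / \<gamma> * X 1 v / X 0 v"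
    by simp
qed

text \<open>Here \<open>X 1 v\<close> is nonzero, so the scaled denominators tend to 0 while the
  scaled numerators keep a nonzero limit.\<close>

lemma asc_cf_diverges:
  assumes "X 0 v = 0"
  shows "cf_converges_to_infinity (asc_\<alpha> q A B \<delta>) (asc_\<beta> q \<delta> (J v))"
  unfolding cf_converges_to_infinity_def
proof
  have nz: "X 1 v / L \<noteq> 0"
    using X0_X1_not_both_zero[OF v assms] L_nz by simp
  have "eventually (\<lambda>n. P n \<noteq> 0) sequentially"
    by (rule tendsto_imp_eventually_ne[OF P_tendsto nz])
  then show "\<forall>\<^sub>F n in sequentially. cf_num (asc_\<alpha> q A B \<delta>) (asc_\<beta> q \<delta> (J v)) n \<noteq> 0"
    by eventually_elim (simp add: num_eq \<rho>_nz)
  have "(\<lambda>n. \<rho> * Q n / P n) \<longlonglongrightarrow> \<rho> * (X 0 v / L) / (X 1 v / L)"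
    by (intro tendsto_intros P_tendsto Q_tendsto nz)
  then show "(\<lambda>n. cf_den (asc_\<alpha> q A B \<delta>) (asc_\<beta> q \<delta> (J v)) n /
      cf_num (asc_\<alpha> q A B \<delta>) (asc_\<beta> q \<delta> (J v)) n) \<longlonglongrightarrow> 0"
    using \<rho>_nz assms by (simp add: num_eq den_eq mult.commute)
qed

end

section \<open>Return to the hypergeometric functions\<close>

lemma asc_phi_den_eq:
  assumes "asc_regular q A B \<delta> (\<gamma> * v / 2)"
  shows "qpoch_inf q (A * \<delta> * (\<gamma> * v / 2)) * qpoch_inf q (A * B * (\<gamma> * v / 2) / q) *
    asc_phi_den q A B \<delta> (\<gamma> * v / 2) = X 0 v"
proof -
  define \<Lambda> where "\<Lambda> = \<gamma> * v / 2"
  have r: "\<And>k. A * B * \<Lambda> / q * q ^ k \<noteq> 1" "\<And>k. A * \<delta> * \<Lambda> * q ^ k \<noteq> 1"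
    using assms by (auto simp: asc_regular_def \<Lambda>_def)
  have e: "B * \<Lambda> * (A / q) = A * B * \<Lambda> / q" by simp
  have y: "B * \<Lambda> * (A * \<delta> * \<Lambda>) = q * v\<^sup>2"
  proof -
    have "B * \<Lambda> * (A * \<delta> * \<Lambda>) = A * B * \<delta> * \<gamma>\<^sup>2 * v\<^sup>2 / 4"
      by (simp add: \<Lambda>_def power2_eq_square)
    then show ?thesis unfolding AB\<delta>_\<gamma> by simp
  qed
  have "qpoch_inf q (A * \<delta> * \<Lambda>) * qpoch_inf q (A * B * \<Lambda> / q) * asc_phi_den q A B \<delta> \<Lambda> =
      asc_sum (A / q) (B / q) (A * B * \<Lambda> / q) (B / q * (A * \<delta> * \<Lambda>)) (q * v\<^sup>2)"
    using phi21_eq_asc_sum[of "A * \<delta> * \<Lambda>" "B * \<Lambda>" "A / q" "B / q"] r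
    unfolding e y asc_phi_den_def by blast
  also have "\<dots> = X 0 v"
    by (simp add: X_def \<Lambda>_def mult_ac)
  finally show ?thesis by (simp only: \<Lambda>_def)
qed

lemma asc_phi_num_eq:
  assumes "asc_regular q A B \<delta> (\<gamma> * v / 2)"
  shows "qpoch_inf q (A * \<delta> * (\<gamma> * v / 2)) * qpoch_inf q (A * B * (\<gamma> * v / 2)) *
    asc_phi_num q A B \<delta> (\<gamma> * v / 2) = X 1 v"
proof -
  define \<Lambda> where "\<Lambda> = \<gamma> * v / 2"
  have r: "\<And>k. A * B * \<Lambda> * q ^ k \<noteq> 1" "\<And>k. A * \<delta> * \<Lambda> * q ^ k \<noteq> 1"
  proof -
    fix k show "A * \<delta> * \<Lambda> * q ^ k \<noteq> 1"
      using assms by (auto simp: asc_regular_def \<Lambda>_def)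
    have "A * B * \<Lambda> / q * q ^ Suc k \<noteq> 1"
      using assms unfolding asc_regular_def \<Lambda>_def by blast
    then show "A * B * \<Lambda> * q ^ k \<noteq> 1" using q_nz by (simp add: mult_ac)
  qed
  have e: "B * \<Lambda> * A = A * B * \<Lambda>" by simp
  have y: "B * \<Lambda> * (A * \<delta> * \<Lambda>) = q * v\<^sup>2"
  proof -
    have "B * \<Lambda> * (A * \<delta> * \<Lambda>) = A * B * \<delta> * \<gamma>\<^sup>2 * v\<^sup>2 / 4"
      by (simp add: \<Lambda>_def power2_eq_square)
    then show ?thesis unfolding AB\<delta>_\<gamma> by simp
  qed
  have "qpoch_inf q (A * \<delta> * \<Lambda>) * qpoch_inf q (A * B * \<Lambda>) * asc_phi_num q A B \<delta> \<Lambda> =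
      asc_sum A B (A * B * \<Lambda>) (B * (A * \<delta> * \<Lambda>)) (q * v\<^sup>2)"
    using phi21_eq_asc_sum[of "A * \<delta> * \<Lambda>" "B * \<Lambda>" A B] r
    unfolding e y asc_phi_num_def by blast
  also have "\<dots> = X 1 v"
    using q_nz by (simp add: X_def \<Lambda>_def mult_ac)
  finally show ?thesis by (simp only: \<Lambda>_def)
qed

lemma asc_regular_iff:
  "asc_regular q A B \<delta> \<Lambda> \<longleftrightarrow> qpoch_inf q (A * \<delta> * \<Lambda>) * qpoch_inf q (A * B * \<Lambda> / q) \<noteq> 0"
  using qpoch_inf_nonzero_iff[of "A * \<delta> * \<Lambda>"] qpoch_inf_nonzero_iff[of "A * B * \<Lambda> / q"]
  by (auto simp: asc_regular_def)

lemma asc_phi_den_eq_0_iff: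
  assumes "asc_regular q A B \<delta> (\<gamma> * v / 2)"
  shows "asc_phi_den q A B \<delta> (\<gamma> * v / 2) = 0 \<longleftrightarrow> X 0 v = 0"
  using asc_phi_den_eq[OF assms] assms by (auto simp: asc_regular_iff)

text \<open>The infinite products of numerator and denominator differ only in
  (AB\<Lambda>)_\<infinity> against (AB\<Lambda>/q)_\<infinity>. Their ratio is the factor 1 -
  AB\<Lambda>/q of the prefactor, so everything except \<open>X 1 v / X 0 v\<close> and 2v/\<gamma>
  cancels.\<close>

lemma asc_quotient_eq:
  assumes reg: "asc_regular q A B \<delta> (\<gamma> * v / 2)"
  shows "asc_quotient q A B \<delta> (\<gamma> * v / 2) = 2 * v / \<gamma> * X 1 v / X 0 v"
proof -
  define \<Lambda> where "\<Lambda> = \<gamma> * v / 2"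
  define W where "W = qpoch_inf q (A * \<delta> * \<Lambda>)"
  define C where "C = qpoch_inf q (A * B * \<Lambda>)"
  have split: "qpoch_inf q (A * B * \<Lambda> / q) = (1 - A * B * \<Lambda> / q) * C"
    unfolding C_def using qpoch_inf_Suc[of "A * B * \<Lambda> / q"] q_nz by simp
  have nz: "W \<noteq> 0" "1 - A * B * \<Lambda> / q \<noteq> 0" "C \<noteq> 0"
    using reg split unfolding asc_regular_iff W_def \<Lambda>_def[symmetric] by auto
  have \<beta>: "A * B * \<delta> * \<Lambda> / q = 2 * v / \<gamma>"
    using AB\<delta>_\<gamma> \<gamma>_nz q_nz by (simp add: \<Lambda>_def field_simps power2_eq_square)
  have "asc_quotient q A B \<delta> \<Lambda> = (A * B * \<delta> * \<Lambda> / q * asc_phi_num q A B \<delta> \<Lambda>) /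
      ((1 - A * B * \<Lambda> / q) * asc_phi_den q A B \<delta> \<Lambda>)"
    unfolding asc_quotient_def by simp
  also have "\<dots> = ((W * C) * (A * B * \<delta> * \<Lambda> / q * asc_phi_num q A B \<delta> \<Lambda>)) /
      ((W * C) * ((1 - A * B * \<Lambda> / q) * asc_phi_den q A B \<delta> \<Lambda>))"
    using nz by (intro mult_divide_mult_cancel_left[symmetric]) auto
  also have "\<dots> = (A * B * \<delta> * \<Lambda> / q) * (W * C * asc_phi_num q A B \<delta> \<Lambda>) /
      (W * ((1 - A * B * \<Lambda> / q) * C) * asc_phi_den q A B \<delta> \<Lambda>)"
    by (simp only: mult_ac)
  also have "\<dots> = 2 * v / \<gamma> * X 1 v / X 0 v"
    using asc_phi_num_eq[OF reg] asc_phi_den_eq[OF reg]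
    unfolding \<Lambda>_def[symmetric] W_def[symmetric] C_def[symmetric] split \<beta> by simp
  finally show ?thesis by (simp only: \<Lambda>_def)
qed

end

section \<open>Uniformization of the cut plane\<close>

lemma isCont_cis: "isCont cis t"
proof -
  have "isCont (\<lambda>t. exp (\<i> * complex_of_real t)) t" by (intro continuous_intros)
  then show ?thesis by (simp add: cis_conv_exp[symmetric])
qed

lemma finite_zeros_in_cball:
  fixes f :: "complex \<Rightarrow> complex"
  assumes "f holomorphic_on UNIV" "f a \<noteq> 0"
  shows "finite {z \<in> cball 0 R. f z = 0}"
proof (cases "f constant_on UNIV")
  case True
  then have "f z \<noteq> 0" for z using assms(2) by (auto simp: constant_on_def)
  then show ?thesis by simp
next
  case False
  then show ?thesis
    using holomorphic_compact_finite_zeros[OF assms(1), of "cball 0 R"] by (simp add: connected_UNIV)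
qed

lemma eventually_at_notin_finite:
  fixes a :: "'a::t1_space"
  assumes "finite N"
  shows "eventually (\<lambda>z. z \<notin> N) (at a)"
proof -
  have "open (- (N - {a}))" using assms by (intro open_Compl finite_imp_closed) auto
  then show ?thesis
    unfolding eventually_at_topological by (intro exI[of _ "- (N - {a})"]) auto
qed

context asc
begin

definition cut :: "complex set" where
  "cut = {z. z / \<gamma> \<in> complex_of_real ` {-1..1}}"

definition unif :: "complex \<Rightarrow> complex" where
  "unif z = 2 * Lambda_minus \<gamma> z / \<gamma>"

lemma Lambda_minus_unif: "Lambda_minus \<gamma> z = \<gamma> * unif z / 2"
  using \<gamma>_nz by (simp add: unif_def)

text \<open>If \<open>J v\<close> = \<gamma>t, then v and 1/v are the roots of x^2 - 2tx + 1. For t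
  in [-1, 1] these are conjugate numbers of modulus 1.\<close>

lemma J_mem_cut_iff:
  assumes "v \<noteq> 0"
  shows "J v \<in> cut \<longleftrightarrow> norm v = 1"
proof
  assume "norm v = 1"
  then have v1: "v * cnj v = 1" by (simp add: complex_norm_square[symmetric])
  then have "1 / v = cnj v" using assms by (simp add: field_simps)
  then have "J v / \<gamma> = of_real (Re v)"
    using \<gamma>_nz complex_add_cnj[of v] by (simp add: J_def)
  moreover have "Re v \<in> {-1..1}"
    using abs_Re_le_cmod[of v] \<open>norm v = 1\<close> by auto
  ultimately show "J v \<in> cut" unfolding cut_def by blast
next
  assume "J v \<in> cut"
  then obtain t where t: "-1 \<le> t" "t \<le> 1" "J v / \<gamma> = complex_of_real t"
    by (auto simp: cut_def)
  then have "v + 1 / v = 2 * complex_of_real t"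
    using \<gamma>_nz by (simp add: J_def)
  then have eq: "v * v + 1 = 2 * complex_of_real t * v"
    using assms by (simp add: field_simps)
  define u where "u = Complex t (sqrt (1 - t\<^sup>2))"
  have t2: "t\<^sup>2 \<le> 1" using t by (simp add: abs_square_le_1 abs_le_iff)
  have nu: "norm u = 1" using t2 by (simp add: u_def cmod_def)
  have "u * cnj u = 1" using nu by (simp add: complex_norm_square[symmetric])
  moreover have "u + cnj u = 2 * complex_of_real t"
    by (simp add: complex_add_cnj u_def)
  moreover have "(v - u) * (v - cnj u) = v * v - (u + cnj u) * v + u * cnj u"
    by (simp add: algebra_simps)
  ultimately have "(v - u) * (v - cnj u) = v * v + 1 - 2 * complex_of_real t * v"
    by simp
  then have "v = u \<or> v = cnj u" using eq by simp
  then show "norm v = 1" using nu by auto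
qed

lemma unif_props:
  assumes z: "z \<notin> cut"
  shows "unif z \<noteq> 0" "norm (unif z) < 1" "J (unif z) = z"
proof -
  define s where "s = asc_root \<gamma> z"
  have s2: "s\<^sup>2 = z\<^sup>2 - \<gamma>\<^sup>2"
    by (simp add: s_def asc_root_def Let_def power2_csqrt)
  define v where "v = (z - s) / \<gamma>"
  define w where "w = (z + s) / \<gamma>"
  have v: "unif z = v"
    using \<gamma>_nz by (simp add: unif_def Lambda_minus_def v_def s_def right_diff_distrib diff_divide_distrib)
  have "(z - s) * (z + s) = \<gamma>\<^sup>2" using s2 by (simp add: algebra_simps power2_eq_square)
  then have vw: "v * w = 1"
    using \<gamma>_nz by (simp add: v_def w_def power2_eq_square)
  then have v0: "v \<noteq> 0" by auto
  with vw have w: "w = 1 / v" by (simp add: eq_divide_eq mult.commute)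
  have Jv: "J v = z"
    unfolding J_def w[symmetric] using \<gamma>_nz by (simp add: v_def w_def field_simps)
  \<comment> \<open>The two candidates have product 1, so equal moduli would put v on the circle and
    z on the cut. Hence the sign chosen in \<open>asc_root\<close> gives a strict
    inequality.\<close>
  have "norm (z - s) \<noteq> norm (z + s)"
  proof
    assume "norm (z - s) = norm (z + s)"
    then have "norm v = norm w" by (simp add: v_def w_def norm_divide)
    then have "norm v * norm v = 1" using vw by (metis norm_mult norm_one)
    then have "norm v = 1" by (metis norm_ge_zero abs_of_nonneg real_sqrt_abs2 real_sqrt_one)
    then show False using J_mem_cut_iff[OF v0] z Jv by simp
  qed
  then have "norm (z - s) < norm (z + s)"
    unfolding s_def asc_root_def Let_def by (auto simp: algebra_simps split: if_splits)
  then have "norm v < norm w" using \<gamma>_nz by (simp add: v_def w_def norm_divide divide_strict_right_mono)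
  then have "norm v * norm v < norm v * norm w"
    using v0 by simp
  also have "\<dots> = 1" using vw by (metis norm_mult norm_one)
  finally have "norm v < 1"
    using abs_square_less_1[of "norm v"] by (simp add: power2_eq_square)
  then show "unif z \<noteq> 0" "norm (unif z) < 1" "J (unif z) = z"
    using v0 Jv v by auto
qed

lemma J_notin_cut: "v \<noteq> 0 \<Longrightarrow> norm v < 1 \<Longrightarrow> J v \<notin> cut"
  by (simp add: J_mem_cut_iff)

lemma inj_on_J: "inj_on J (ball 0 1 - {0})"
proof (rule inj_onI)
  fix v w assume vw: "v \<in> ball 0 1 - {0}" "w \<in> ball 0 1 - {0}" and eq: "J v = J w"
  have "v + 1 / v = w + 1 / w" using eq \<gamma>_nz by (simp add: J_def)
  then have "(v - w) * (v * w - 1) = 0"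
    using vw by (simp add: field_simps)
  moreover have "norm (v * w) < 1"
    using vw mult_strict_mono'[of "norm v" 1 "norm w" 1] by (simp add: norm_mult)
  then have "v * w - 1 \<noteq> 0" by auto
  ultimately show "v = w" by simp
qed

lemma unif_J:
  assumes "v \<noteq> 0" "norm v < 1"
  shows "unif (J v) = v"
proof (rule inj_onD[OF inj_on_J])
  show "J (unif (J v)) = J v"
    by (rule unif_props(3)[OF J_notin_cut[OF assms]])
qed (use unif_props(1,2)[OF J_notin_cut[OF assms]] assms in auto)

lemma image_J: "J ` (ball 0 1 - {0}) = - cut"
proof
  show "J ` (ball 0 1 - {0}) \<subseteq> - cut" using J_notin_cut by auto
  show "- cut \<subseteq> J ` (ball 0 1 - {0})"
  proof
    fix z assume "z \<in> - cut"
    then show "z \<in> J ` (ball 0 1 - {0})"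
      using unif_props[of z] by (intro image_eqI[of _ _ "unif z"]) auto
  qed
qed

lemma J_holomorphic: "J holomorphic_on (- {0})"
  unfolding J_def[abs_def] by (intro holomorphic_intros) auto

lemma J_holomorphic_disc: "J holomorphic_on (ball 0 1 - {0})"
  by (rule holomorphic_on_subset[OF J_holomorphic]) auto

lemma open_punctured_disc: "open (ball (0::complex) 1 - {0})"
  by (intro open_Diff) auto

lemma open_Compl_cut: "open (- cut)"
  using open_mapping_thm3[OF J_holomorphic_disc open_punctured_disc inj_on_J] by (simp add: image_J)

text \<open>The sign in \<open>asc_root\<close> is chosen pointwise on top of a square root with a
  cut of its own, so the formula does not display holomorphy. It comes from identifying
  \<open>unif\<close> with the holomorphic inverse of the injective \<open>J\<close>.\<close>

lemma unif_holomorphic: "unif holomorphic_on (- cut)"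
proof -
  obtain g where g: "g holomorphic_on J ` (ball 0 1 - {0})" "\<And>z. z \<in> ball 0 1 - {0} \<Longrightarrow> g (J z) = z"
    using holomorphic_has_inverse[OF J_holomorphic_disc open_punctured_disc inj_on_J] by metis
  have "g z = unif z" if "z \<in> - cut" for z
    using g(2)[of "unif z"] unif_props[of z] that by auto
  then show ?thesis
    using holomorphic_transform[OF g(1)] by (simp add: image_J)
qed

lemma isCont_unif: "z \<notin> cut \<Longrightarrow> isCont unif z"
  using holomorphic_on_imp_continuous_on[OF unif_holomorphic] open_Compl_cut
  by (auto simp: continuous_on_eq_continuous_at)

lemma finite_X0_zeros: "finite {v \<in> cball 0 R. X 0 v = 0}"
  by (rule finite_zeros_in_cball[OF X_holomorphic_UNIV, of 0 0]) (simp add: X_at_0)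

lemma finite_irregular: "finite {v \<in> cball 0 R. \<not> asc_regular q A B \<delta> (\<gamma> * v / 2)}"
  unfolding asc_regular_iff not_not
  by (rule finite_zeros_in_cball[of _ 0]) (auto intro!: holomorphic_intros)

definition H :: "complex \<Rightarrow> complex" where
  "H v = 2 * v / \<gamma> * X 1 v / X 0 v"

text \<open>Only finitely many v in the disc are exceptional, hence only finitely many z. All
  identities between the continued fraction, \<open>H\<close> and the series thus hold in a
  punctured neighbourhood of each z off the cut, which is enough for limits and poles.\<close>

lemma eventually_generic:
  assumes z: "z \<notin> cut"
  shows "eventually (\<lambda>z'. z' \<notin> cut \<and> asc_regular q A B \<delta> (Lambda_minus \<gamma> z') \<and> X 0 (unif z') \<noteq> 0) (at z)"
proof -
  define N where "N = {v \<in> cball 0 1. X 0 v = 0} \<union> {v \<in> cball 0 1. \<not> asc_regular q A B \<delta> (\<gamma> * v / 2)}"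
  have "eventually (\<lambda>z'. z' \<notin> J ` N) (at z)"
    unfolding N_def by (intro eventually_at_notin_finite finite_imageI finite_UnI finite_X0_zeros finite_irregular)
  moreover have "eventually (\<lambda>z'. z' \<in> - cut) (at z)"
    using z by (intro eventually_at_in_open' open_Compl_cut) auto
  ultimately show ?thesis
  proof eventually_elim
    case (elim z')
    have "unif z' \<in> N \<Longrightarrow> z' \<in> J ` N"
      using unif_props(3)[of z'] elim by force
    then have "unif z' \<notin> N" using elim by blast
    then show ?case
      using elim unif_props(2)[of z'] by (auto simp: N_def Lambda_minus_unif)
  qed
qed

lemma cf_converges_at:
  assumes "z \<notin> cut" "X 0 (unif z) \<noteq> 0"
  shows "cf_converges_to (asc_\<alpha> q A B \<delta>) (asc_\<beta> q \<delta> z) (H (unif z))"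
  using asc_cf_converges[OF unif_props(1,2)[OF assms(1)] assms(2)] unif_props(3)[OF assms(1)]
  by (simp add: H_def)

lemma cf_diverges_at:
  assumes "z \<notin> cut" "X 0 (unif z) = 0"
  shows "cf_converges_to_infinity (asc_\<alpha> q A B \<delta>) (asc_\<beta> q \<delta> z)"
  using asc_cf_diverges[OF unif_props(1,2)[OF assms(1)] assms(2)] unif_props(3)[OF assms(1)]
  by simp

lemma cf_value_eq:
  assumes "z \<notin> cut" "X 0 (unif z) \<noteq> 0"
  shows "cf_value (asc_\<alpha> q A B \<delta>) (asc_\<beta> q \<delta> z) = H (unif z)"
  using cf_converges_at[OF assms] by (auto simp: cf_value_def cf_converges_to_def intro: limI)

lemma asc_quotient_at:
  assumes "asc_regular q A B \<delta> (Lambda_minus \<gamma> z)"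
  shows "asc_quotient q A B \<delta> (Lambda_minus \<gamma> z) = H (unif z)"
  using asc_quotient_eq assms unfolding Lambda_minus_unif H_def by blast

theorem quotient_formula:
  assumes "z \<notin> cut" "asc_regular q A B \<delta> (Lambda_minus \<gamma> z)"
  shows "if asc_phi_den q A B \<delta> (Lambda_minus \<gamma> z) \<noteq> 0
    then cf_converges_to (asc_\<alpha> q A B \<delta>) (asc_\<beta> q \<delta> z) (asc_quotient q A B \<delta> (Lambda_minus \<gamma> z))
    else cf_converges_to_infinity (asc_\<alpha> q A B \<delta>) (asc_\<beta> q \<delta> z)"
  using cf_converges_at[OF assms(1)] cf_diverges_at[OF assms(1)] asc_quotient_at[OF assms(2)]
    asc_phi_den_eq_0_iff[of "unif z"] assms(2) unfolding Lambda_minus_unif by auto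

lemma isCont_X: "isCont (X n) v"
  using holomorphic_on_imp_continuous_on[OF X_holomorphic_UNIV] by (simp add: continuous_on_eq_continuous_at)

lemma tendsto_H_unif:
  assumes z: "z \<notin> cut" "X 0 (unif z) \<noteq> 0"
  shows "((\<lambda>z. H (unif z)) \<longlongrightarrow> H (unif z)) (at z)"
proof -
  have u: "(unif \<longlongrightarrow> unif z) (at z)" using isCont_unif[OF z(1)] by (simp add: isCont_def)
  show ?thesis
    unfolding H_def using z \<gamma>_nz by (intro tendsto_intros u isCont_tendsto_compose[OF isCont_X u])
qed

text \<open>A zero of \<open>X 0\<close> cannot be cancelled, because \<open>X 1\<close> is nonzero
  there.\<close>

lemma is_pole_H_unif:
  assumes z: "z \<notin> cut" "X 0 (unif z) = 0"
  shows "is_pole (\<lambda>z. H (unif z)) z"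
  unfolding H_def
proof (rule is_pole_divide)
  have cX: "isCont (\<lambda>z. X n (unif z)) z" for n
    using isCont_o2[OF isCont_unif[OF z(1)] isCont_X] .
  show "isCont (\<lambda>z. 2 * unif z / \<gamma> * X 1 (unif z)) z"
    using \<gamma>_nz by (intro continuous_intros cX isCont_unif z)
  show "2 * unif z / \<gamma> * X 1 (unif z) \<noteq> 0"
    using X0_X1_not_both_zero[OF unif_props(1,2)[OF z(1)] z(2)] unif_props(1)[OF z(1)] \<gamma>_nz by simp
  have "((\<lambda>z. X 0 (unif z)) \<longlongrightarrow> 0) (at z)"
    using cX[of 0] z(2) by (simp add: isCont_def)
  then show "filterlim (\<lambda>z. X 0 (unif z)) (at 0) (at z)"
    using eventually_mono[OF eventually_generic[OF z(1)]] by (auto simp: filterlim_at)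
qed

theorem quotient_formula_meromorphic:
  assumes z: "z \<notin> cut"
  defines "R \<equiv> \<lambda>z. asc_quotient q A B \<delta> (Lambda_minus \<gamma> z)"
  shows "(\<exists>v. cf_converges_to (asc_\<alpha> q A B \<delta>) (asc_\<beta> q \<delta> z) v \<and> (R \<longlongrightarrow> v) (at z)) \<or>
    (cf_converges_to_infinity (asc_\<alpha> q A B \<delta>) (asc_\<beta> q \<delta> z) \<and> is_pole R z)"
proof -
  have R: "eventually (\<lambda>z. H (unif z) = R z) (at z)"
    using eventually_generic[OF z] by eventually_elim (simp add: R_def asc_quotient_at)
  show ?thesis
  proof (cases "X 0 (unif z) = 0")
    case True
    then show ?thesis
      using cf_diverges_at[OF z True] is_pole_transform[OF is_pole_H_unif[OF z True] R refl] by blast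
  next
    case False
    then show ?thesis
      using cf_converges_at[OF z False] Lim_transform_eventually[OF tendsto_H_unif[OF z False] R] by blast
  qed
qed

section \<open>Poles of the continued fraction\<close>

definition asc_F :: "complex \<Rightarrow> complex" where
  "asc_F z = cf_value (asc_\<alpha> q A B \<delta>) (asc_\<beta> q \<delta> z)"

text \<open>At a pole \<open>cf_value\<close> is the limit of a divergent sequence and carries no
  information, so the comparison is made on punctured neighbourhoods.\<close>

lemma eventually_asc_F_eq: "z \<notin> cut \<Longrightarrow> eventually (\<lambda>z. asc_F z = H (unif z)) (at z)"
  by (rule eventually_mono[OF eventually_generic]) (auto simp: asc_F_def cf_value_eq)

lemma is_pole_asc_F_iff:
  assumes "z \<notin> cut"
  shows "is_pole asc_F z \<longleftrightarrow> X 0 (unif z) = 0"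
proof -
  have "is_pole asc_F z \<longleftrightarrow> is_pole (\<lambda>z. H (unif z)) z"
    by (rule is_pole_cong[OF eventually_asc_F_eq[OF assms] refl])
  also have "\<dots> \<longleftrightarrow> X 0 (unif z) = 0"
    using is_pole_H_unif[OF assms] tendsto_H_unif[OF assms] not_tendsto_and_filterlim_at_infinity[of "at z"]
    unfolding is_pole_def by auto
  finally show ?thesis .
qed

definition Z :: "complex set" where
  "Z = {v \<in> ball 0 1. X 0 v = 0}"

lemma finite_Z: "finite Z"
  by (rule finite_subset[OF _ finite_X0_zeros[of 1]]) (auto simp: Z_def)

lemma zero_notin_Z: "0 \<notin> Z"
  by (simp add: Z_def X_at_0)

lemma poles_asc_F: "{p. p \<notin> cut \<and> is_pole asc_F p} = J ` Z"
proof (intro equalityI subsetI)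
  fix p assume "p \<in> {p. p \<notin> cut \<and> is_pole asc_F p}"
  then have p: "p \<notin> cut" "X 0 (unif p) = 0" by (auto simp: is_pole_asc_F_iff)
  then show "p \<in> J ` Z"
    using unif_props[OF p(1)] by (intro image_eqI[of _ _ "unif p"]) (auto simp: Z_def)
next
  fix p assume "p \<in> J ` Z"
  then obtain v where v: "v \<in> Z" "p = J v" by blast
  have v': "v \<noteq> 0" "norm v < 1" "X 0 v = 0" using v zero_notin_Z by (auto simp: Z_def)
  show "p \<in> {p. p \<notin> cut \<and> is_pole asc_F p}"
    using J_notin_cut[OF v'(1,2)] v'(3) by (simp add: v(2) is_pole_asc_F_iff unif_J[OF v'(1,2)])
qed

end

section \<open>Residues and simple zeros\<close>

text \<open>
  Both residues are contour integrals, over a small circle and over its image; the winding number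
  of the image around \<open>\<phi> p\<close> is the residue of \<open>\<phi>' / (\<phi> - \<phi> p)\<close>, which is \<open>1\<close>.
\<close>

lemma residue_comp_conformal:
  fixes f \<phi> :: "complex \<Rightarrow> complex"
  assumes S: "open S" "p \<in> S" and \<phi>: "\<phi> holomorphic_on S" "inj_on \<phi> S"
    and f: "f holomorphic_on \<phi> ` S - {\<phi> p}"
  shows "residue (\<lambda>s. deriv \<phi> s * f (\<phi> s)) p = residue f (\<phi> p)"
proof -
  obtain R where R: "R > 0" "ball p R \<subseteq> S" using S by (meson openE)
  define r where "r = R / 2"
  have r: "r > 0" "cball p r \<subseteq> ball p R" using R by (auto simp: r_def)
  define D where "D = ball p R"
  have D: "open D" "connected D" "convex D" "p \<in> D" "D \<subseteq> S" using R by (auto simp: D_def)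
  have \<phi>D: "\<phi> holomorphic_on D" "inj_on \<phi> D"
    using \<phi> D(5) by (auto intro: holomorphic_on_subset inj_on_subset)
  have d\<phi>: "deriv \<phi> holomorphic_on D" using \<phi>D(1) D(1) by (rule holomorphic_deriv)
  define T where "T = \<phi> ` D"
  have T: "open T" "connected T"
    using open_mapping_thm3[OF \<phi>D(1) D(1) \<phi>D(2)] connected_continuous_image[OF holomorphic_on_imp_continuous_on[OF \<phi>D(1)] D(2)]
    by (simp_all add: T_def)
  define c where "c = circlepath p r"
  have c: "valid_path c" "pathfinish c = pathstart c" "path_image c \<subseteq> D - {p}"
    using r R by (auto simp: c_def D_def sphere_def)
  have ana: "\<phi> analytic_on D" using \<phi>D(1) D(1) by (simp add: analytic_on_open)
  have cD: "path_image c \<subseteq> D" using c(3) by blast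
  have comp: "contour_integral (\<phi> \<circ> c) g = contour_integral c (\<lambda>w. deriv \<phi> w * g (\<phi> w))" for g
    by (rule contour_integral_comp_analyticW[OF ana c(1) cD])
  have v: "valid_path (\<phi> \<circ> c)" by (rule valid_path_compose_analytic[OF c(1) ana cD])
  have inj: "\<phi> x \<noteq> \<phi> p" if "x \<in> D" "x \<noteq> p" for x
    using inj_onD[OF \<phi>D(2) _ that(1) D(4)] that(2) by blast
  have img: "path_image (\<phi> \<circ> c) \<subseteq> T - {\<phi> p}"
    using c(3) inj by (auto simp: path_image_compose T_def)
  have wind: "winding_number (\<phi> \<circ> c) z = 1/(2*pi*\<i>) * contour_integral c (\<lambda>w. deriv \<phi> w * (1 / (\<phi> w - z)))"
    if "z \<notin> path_image (\<phi> \<circ> c)" for z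
    unfolding winding_number_valid_path[OF v that] comp ..
  have base: "contour_integral c g = 2 * pi * \<i> * residue g p" if "g holomorphic_on D - {p}" for g
    unfolding c_def using that r by (intro contour_integral_unique base_residue[OF D(1,4)]) (auto simp: D_def)
  \<comment> \<open>The residue theorem on T requires winding number 0 outside T. For such z the
    pulled-back integrand has no singularity in the convex disc D.\<close>
  have out: "winding_number (\<phi> \<circ> c) z = 0" if "z \<notin> T" for z
  proof -
    have "(\<lambda>w. deriv \<phi> w * (1 / (\<phi> w - z))) holomorphic_on D"
      using that by (intro holomorphic_intros d\<phi> \<phi>D) (auto simp: T_def)
    then have "contour_integral c (\<lambda>w. deriv \<phi> w * (1 / (\<phi> w - z))) = 0"
      by (intro contour_integral_unique Cauchy_theorem_convex_simple[OF _ D(3) c(1) cD c(2)])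
    moreover have "z \<notin> path_image (\<phi> \<circ> c)" using that img by blast
    ultimately show ?thesis by (simp add: wind)
  qed
  have "winding_number (\<phi> \<circ> c) (\<phi> p) = 1"
  proof -
    let ?g = "\<lambda>w. deriv \<phi> w * (1 / (\<phi> w - \<phi> p))"
    have g: "?g holomorphic_on D - {p}"
      using inj by (intro holomorphic_intros holomorphic_on_subset[OF d\<phi>] holomorphic_on_subset[OF \<phi>D(1)]) auto
    have nz: "deriv \<phi> p \<noteq> 0"
      using holomorphic_injective_imp_regular[OF \<phi>D(1) D(1) \<phi>D(2) D(4)] .
    have "((\<lambda>w. (\<phi> w - \<phi> p) / (w - p)) \<longlongrightarrow> deriv \<phi> p) (at p)"
      using holomorphic_derivI[OF \<phi>D(1) D(1) D(4)] by (simp add: has_field_derivative_iff)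
    moreover have "(deriv \<phi> \<longlongrightarrow> deriv \<phi> p) (at p)"
      using holomorphic_on_imp_continuous_on[OF d\<phi>] D by (simp add: continuous_on_eq_continuous_at isCont_def)
    ultimately have "((\<lambda>w. deriv \<phi> w / ((\<phi> w - \<phi> p) / (w - p))) \<longlongrightarrow> deriv \<phi> p / deriv \<phi> p) (at p)"
      using nz by (intro tendsto_divide)
    then have "((\<lambda>w. ?g w * (w - p)) \<longlongrightarrow> 1) (at p)" using nz by simp
    then have "residue ?g p = 1" by (rule residue_simple'[OF D(1,4) g])
    moreover have "\<phi> p \<notin> path_image (\<phi> \<circ> c)" using img by blast
    ultimately show ?thesis using base[OF g] by (simp add: wind)
  qed
  moreover have "contour_integral (\<phi> \<circ> c) f = 2 * pi * \<i> * (\<Sum>z\<in>{\<phi> p}. winding_number (\<phi> \<circ> c) z * residue f z)"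
  proof (rule Residue_theorem[OF T])
    show "f holomorphic_on T - {\<phi> p}"
      by (rule holomorphic_on_subset[OF f]) (use D(5) in \<open>auto simp: T_def\<close>)
    show "pathfinish (\<phi> \<circ> c) = pathstart (\<phi> \<circ> c)"
      using c(2) by (simp add: pathfinish_compose pathstart_compose)
  qed (use v img out in auto)
  ultimately have "contour_integral (\<phi> \<circ> c) f = 2 * pi * \<i> * residue f (\<phi> p)" by simp
  moreover have "contour_integral (\<phi> \<circ> c) f = 2 * pi * \<i> * residue (\<lambda>s. deriv \<phi> s * f (\<phi> s)) p"
    unfolding comp
  proof (rule base)
    have "\<phi> ` (D - {p}) \<subseteq> \<phi> ` S - {\<phi> p}"
      using inj D(5) by (intro image_subsetI DiffI imageI) auto
    then have "(\<lambda>s. f (\<phi> s)) holomorphic_on D - {p}"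
      using holomorphic_on_compose_gen[OF holomorphic_on_subset[OF \<phi>D(1), of "D - {p}"] f]
      by (auto simp: o_def)
    then show "(\<lambda>s. deriv \<phi> s * f (\<phi> s)) holomorphic_on D - {p}"
      by (intro holomorphic_intros holomorphic_on_subset[OF d\<phi>]) auto
  qed
  ultimately show ?thesis by simp
qed

text \<open>The quotient (s - c) / f equals n / g with g nonzero at c, whether or not f vanishes
  there: n is s - c in one case and 1 in the other. The last clause keeps the other zeros simple, so
  that the lemma can be applied again at a second point.\<close>

lemma factor_simple_zero:
  fixes f :: "complex \<Rightarrow> complex"
  assumes f: "f holomorphic_on UNIV" and c: "f c = 0 \<Longrightarrow> deriv f c \<noteq> 0"
  shows "\<exists>n g. n holomorphic_on UNIV \<and> g holomorphic_on UNIV \<and> (\<forall>s. n s * f s = (s - c) * g s) \<and> g c \<noteq> 0 \<and>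
    (\<forall>s. s \<noteq> c \<longrightarrow> (g s = 0 \<longleftrightarrow> f s = 0)) \<and> (\<forall>e. f e = 0 \<longrightarrow> deriv f e \<noteq> 0 \<longrightarrow> e \<noteq> c \<longrightarrow> deriv g e \<noteq> 0)"
proof (cases "f c = 0")
  case False
  then show ?thesis
    by (intro exI[of _ "\<lambda>s. s - c"] exI[of _ f]) (use f in \<open>auto intro!: holomorphic_intros\<close>)
next
  case True
  define g where "g s = (if s = c then deriv f c else (f s - f c) / (s - c))" for s
  have "g holomorphic_on UNIV"
    unfolding g_def by (rule pole_lemma_open[OF f open_UNIV])
  moreover have "deriv g e \<noteq> 0" if e: "f e = 0" "deriv f e \<noteq> 0" "e \<noteq> c" for e
  proof -
    have df: "(f has_field_derivative deriv f e) (at e)"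
      using holomorphic_derivI[OF f] by simp
    have L: "((\<lambda>s. f s / (s - c)) has_field_derivative deriv f e / (e - c)) (at e)"
      by (rule derivative_eq_intros df refl | use e in \<open>simp add: power2_eq_square\<close>)+
    have ev: "eventually (\<lambda>s. f s / (s - c) = g s) (nhds e)"
      using t1_space_nhds[OF e(3)] by eventually_elim (simp add: g_def True)
    have "(g has_field_derivative deriv f e / (e - c)) (at e)"
      using L unfolding DERIV_cong_ev[OF refl ev refl] .
    then show ?thesis using e by (simp add: DERIV_imp_deriv)
  qed
  moreover have "g c \<noteq> 0" using c[OF True] by (simp add: g_def)
  moreover have "1 * f s = (s - c) * g s" for s using True by (simp add: g_def)
  moreover have "g s = 0 \<longleftrightarrow> f s = 0" if "s \<noteq> c" for s using that True by (simp add: g_def)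
  ultimately show ?thesis
    by (intro exI[of _ "\<lambda>_. 1"] exI[of _ g]) auto
qed

lemma factor_two_simple_zeros:
  fixes f :: "complex \<Rightarrow> complex"
  assumes f: "f holomorphic_on UNIV" and c: "f 1 = 0 \<Longrightarrow> deriv f 1 \<noteq> 0" "f (-1) = 0 \<Longrightarrow> deriv f (-1) \<noteq> 0"
  shows "\<exists>n g. n holomorphic_on UNIV \<and> g holomorphic_on UNIV \<and> (\<forall>s. n s * f s = (s\<^sup>2 - 1) * g s) \<and>
    g 1 \<noteq> 0 \<and> g (-1) \<noteq> 0 \<and> (\<forall>s. s\<^sup>2 \<noteq> 1 \<longrightarrow> (g s = 0 \<longleftrightarrow> f s = 0))"
proof -
  obtain n1 g1 where 1: "n1 holomorphic_on UNIV" "g1 holomorphic_on UNIV" "\<forall>s. n1 s * f s = (s - 1) * g1 s"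
    "g1 1 \<noteq> 0" "\<forall>s. s \<noteq> 1 \<longrightarrow> (g1 s = 0 \<longleftrightarrow> f s = 0)"
    "\<forall>e. f e = 0 \<longrightarrow> deriv f e \<noteq> 0 \<longrightarrow> e \<noteq> 1 \<longrightarrow> deriv g1 e \<noteq> 0"
    using factor_simple_zero[OF f c(1)] by blast
  have d: "g1 (-1) = 0 \<Longrightarrow> deriv g1 (-1) \<noteq> 0"
    using 1(5)[rule_format, of "-1"] 1(6)[rule_format, of "-1"] c(2) by auto
  obtain n2 g2 where 2: "n2 holomorphic_on UNIV" "g2 holomorphic_on UNIV" "\<forall>s. n2 s * g1 s = (s - (-1)) * g2 s"
    "g2 (-1) \<noteq> 0" "\<forall>s. s \<noteq> -1 \<longrightarrow> (g2 s = 0 \<longleftrightarrow> g1 s = 0)"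
    using factor_simple_zero[OF 1(2) d] by blast
  show ?thesis
  proof (rule exI[of _ "\<lambda>s. n2 s * n1 s"], rule exI[of _ g2], intro conjI allI impI)
    show "(\<lambda>s. n2 s * n1 s) holomorphic_on UNIV" by (intro holomorphic_intros 1 2)
    show "n2 s * n1 s * f s = (s\<^sup>2 - 1) * g2 s" for s
    proof -
      have "n2 s * n1 s * f s = (s - 1) * (n2 s * g1 s)"
        using 1(3)[rule_format, of s] by (simp add: mult_ac)
      also have "\<dots> = (s\<^sup>2 - 1) * g2 s"
        using 2(3)[rule_format, of s] by (simp add: algebra_simps power2_eq_square)
      finally show ?thesis .
    qed
    show "g2 1 \<noteq> 0" using 2(5)[rule_format, of 1] 1(4) by simp
    show "g2 s = 0 \<longleftrightarrow> f s = 0" if "s\<^sup>2 \<noteq> 1" for s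
    proof -
      have "s \<noteq> 1" "s \<noteq> -1" using that by auto
      then show ?thesis using 1(5)[rule_format, of s] 2(5)[rule_format, of s] by blast
    qed
  qed (use 2 in auto)
qed

context asc
begin

lemma qpoch_inf_A_B_nonzero: "qpoch_inf q A \<noteq> 0" "qpoch_inf q B \<noteq> 0"
  using A_neq B_neq by (auto simp: qpoch_inf_nonzero_iff)

lemma qpoch_inf_q_circle_nonzero:
  assumes "norm x = 1"
  shows "qpoch_inf q (q * x) \<noteq> 0"
proof -
  have "norm (q * x) < 1" using assms norm_q by (simp add: norm_mult)
  then show ?thesis using mult_power_q_neq_1 by (auto simp: qpoch_inf_nonzero_iff)
qed

text \<open>A double zero at \<open>\<plusminus>1\<close> would make the Casoratian vanish there to second order.\<close>

lemma X0_simple_at_branch_point: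
  assumes e: "e = 1 \<or> e = -1" and X0: "X 0 e = 0"
  shows "deriv (X 0) e \<noteq> 0"
proof
  assume d0: "deriv (X 0) e = 0"
  have e2: "e * e = 1" "e \<noteq> 0" "1 / e = e" using e by auto
  define C where "C v = qpoch_inf q A * qpoch_inf q B * qpoch_inf q (q * v\<^sup>2) * qpoch_inf q (q / v\<^sup>2)" for v
  have DX: "(X n has_field_derivative deriv (X n) v) (at v)" for n v
    using holomorphic_derivI[OF X_holomorphic_UNIV] by simp
  have hol: "C holomorphic_on - {0}" unfolding C_def[abs_def] by (intro holomorphic_intros) auto
  have DC: "(C has_field_derivative deriv C e) (at e)"
    using holomorphic_derivI[OF hol] e2 by (auto simp: open_Compl)
  have Di: "((\<lambda>v. 1 / v) has_field_derivative -1) (at e)"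
    by (rule derivative_eq_intros refl | use e2 in simp)+
  have DXi: "((\<lambda>v. X n (1 / v)) has_field_derivative deriv (X n) e * (-1)) (at e)" for n
    using DERIV_chain[OF DX[of n "1 / e"] Di] e2 by (simp add: o_def)
  \<comment> \<open>Each product contains \<open>X 0\<close> at v or 1/v, and both its value and its
    derivative vanish at e.\<close>
  have L: "((\<lambda>v. X 0 v * X 1 (1 / v) * (1 / v) - v * X 1 v * X 0 (1 / v)) has_field_derivative 0) (at e)"
    by (rule derivative_eq_intros DX DXi Di refl | use e2 X0 d0 in simp)+
  have R: "((\<lambda>v. C v * (1 / v - v)) has_field_derivative C e * (-2)) (at e)"
    by (rule derivative_eq_intros DC Di refl | use e2 in simp)+
  have ev: "eventually (\<lambda>v. X 0 v * X 1 (1 / v) * (1 / v) - v * X 1 v * X 0 (1 / v) = C v * (1 / v - v)) (nhds e)"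
    using t1_space_nhds[OF e2(2)]
  proof eventually_elim
    case (elim v)
    show ?case using casoratian[OF elim] by (simp add: C_def)
  qed
  have "((\<lambda>v. C v * (1 / v - v)) has_field_derivative 0) (at e)"
    using L unfolding DERIV_cong_ev[OF refl ev refl] .
  then have "C e * (-2) = 0" using R by (rule DERIV_unique[symmetric])
  moreover have "C e \<noteq> 0"
    using qpoch_inf_A_B_nonzero qpoch_inf_q_circle_nonzero[of 1] e by (auto simp: C_def)
  ultimately show False by simp
qed

section \<open>The weight\<close>

text \<open>The Casoratian without its factor 1/v - v. On the circle, the numerator products of the
  weight are this times (1 - u^2)(1 - u^(-2)) = 4(1 - t^2).\<close>

definition C :: "complex \<Rightarrow> complex" where
  "C v = qpoch_inf q A * qpoch_inf q B * qpoch_inf q (q * v\<^sup>2) * qpoch_inf q (q / v\<^sup>2)"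

lemma C_circle_nonzero:
  assumes "norm u = 1"
  shows "C u \<noteq> 0"
  using qpoch_inf_A_B_nonzero qpoch_inf_q_circle_nonzero[of "u\<^sup>2"] qpoch_inf_q_circle_nonzero[of "1 / u\<^sup>2"] assms
  by (simp add: C_def norm_power norm_divide)

lemma C_holomorphic: "C holomorphic_on - {0}"
  unfolding C_def[abs_def] by (intro holomorphic_intros) auto

definition circle_pt :: "real \<Rightarrow> complex" where
  "circle_pt t = complex_of_real t + \<i> * complex_of_real (sqrt (1 - t\<^sup>2))"

lemma circle_pt_eq: "circle_pt t = Complex t (sqrt (1 - t\<^sup>2))"
  by (simp add: circle_pt_def complex_eq_iff)

lemma circle_pt_props:
  assumes "t \<in> {-1<..<1}"
  shows "norm (circle_pt t) = 1" "1 / circle_pt t = complex_of_real t - \<i> * complex_of_real (sqrt (1 - t\<^sup>2))"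
    "(1 - (circle_pt t)\<^sup>2) * (1 - 1 / (circle_pt t)\<^sup>2) = 4 * complex_of_real (1 - t\<^sup>2)"
proof -
  have t: "t\<^sup>2 < 1" using assms by (auto simp: abs_square_less_1)
  then show n: "norm (circle_pt t) = 1" by (simp add: circle_pt_eq cmod_def)
  define r where "r = complex_of_real (sqrt (1 - t\<^sup>2))"
  have r2: "r * r = 1 - complex_of_real t * complex_of_real t"
    using t by (simp add: r_def of_real_mult[symmetric] power2_eq_square del: of_real_mult)
  have m: "circle_pt t * (complex_of_real t - \<i> * r) = 1"
    unfolding circle_pt_def r_def[symmetric] by (simp add: algebra_simps r2)
  have u0: "circle_pt t \<noteq> 0" using n by auto
  show i: "1 / circle_pt t = complex_of_real t - \<i> * complex_of_real (sqrt (1 - t\<^sup>2))"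
    using m u0 unfolding r_def by (simp add: divide_eq_eq mult.commute)
  have d: "circle_pt t - 1 / circle_pt t = 2 * \<i> * r"
    unfolding i unfolding circle_pt_def r_def by simp
  have "(1 - (circle_pt t)\<^sup>2) * (1 - 1 / (circle_pt t)\<^sup>2) = - ((circle_pt t - 1 / circle_pt t)\<^sup>2)"
    using u0 by (simp add: field_simps power2_eq_square)
  also have "\<dots> = 4 * (r * r)" unfolding d by (simp add: power2_eq_square)
  also have "\<dots> = 4 * complex_of_real (1 - t\<^sup>2)" unfolding r2 by (simp add: power2_eq_square)
  finally show "(1 - (circle_pt t)\<^sup>2) * (1 - 1 / (circle_pt t)\<^sup>2) = 4 * complex_of_real (1 - t\<^sup>2)" .
qed

text \<open>The four infinite products in the denominator are exactly those that turn the two series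
  into \<open>X 0 u\<close> and \<open>X 0 (1/u)\<close>. With r = sqrt (1 - t^2), the constant is
  4r^2 / (2\<pi>r) = 2r/\<pi>.\<close>

lemma weight_eq:
  assumes t: "t \<in> {-1<..<1}"
    and reg: "asc_regular q A B \<delta> (\<gamma> * circle_pt t / 2)" "asc_regular q A B \<delta> (\<gamma> * (1 / circle_pt t) / 2)"
  shows "asc_weight q A B \<delta> \<gamma> t =
    2 * complex_of_real (sqrt (1 - t\<^sup>2)) / complex_of_real pi * C (circle_pt t) / (X 0 (circle_pt t) * X 0 (1 / circle_pt t))"
proof -
  define u where "u = circle_pt t"
  define r where "r = complex_of_real (sqrt (1 - t\<^sup>2))"
  have t2: "t\<^sup>2 < 1" using t by (auto simp: abs_square_less_1)
  have r: "r \<noteq> 0" "r * r = complex_of_real (1 - t\<^sup>2)"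
    using t2 by (simp_all add: r_def of_real_mult[symmetric] del: of_real_mult of_real_diff)
  have ru: "complex_of_real t + \<i> * r = u" by (simp add: u_def r_def circle_pt_def)
  have u0: "u \<noteq> 0" using circle_pt_props(1)[OF t] by (auto simp: u_def)
  have rm: "complex_of_real t - \<i> * r = 1 / u" using circle_pt_props(2)[OF t] by (simp add: u_def r_def)
  define \<Lambda>p where "\<Lambda>p = \<gamma> * u / 2"
  define \<Lambda>m where "\<Lambda>m = \<gamma> * (1 / u) / 2"
  define wp where "wp = qpoch_inf q (A * \<delta> * \<Lambda>p) * qpoch_inf q (A * B * \<Lambda>p / q)"
  define wm where "wm = qpoch_inf q (A * \<delta> * \<Lambda>m) * qpoch_inf q (A * B * \<Lambda>m / q)"
  have args: "A * \<delta> * \<gamma> * u / 2 = A * \<delta> * \<Lambda>p" "A * \<delta> * \<gamma> / (2 * u) = A * \<delta> * \<Lambda>m"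
    "A * B * \<gamma> * u / (2 * q) = A * B * \<Lambda>p / q" "A * B * \<gamma> / (2 * q * u) = A * B * \<Lambda>m / q"
    "\<gamma> / 2 * u = \<Lambda>p" "\<gamma> / 2 * (1 / u) = \<Lambda>m"
    by (simp_all add: \<Lambda>p_def \<Lambda>m_def)
  have pp: "wp * asc_phi_den q A B \<delta> \<Lambda>p = X 0 u" and pm: "wm * asc_phi_den q A B \<delta> \<Lambda>m = X 0 (1 / u)"
    unfolding wp_def wm_def \<Lambda>p_def \<Lambda>m_def using asc_phi_den_eq reg unfolding u_def by blast+
  have wnz: "wp \<noteq> 0" "wm \<noteq> 0"
    using reg unfolding asc_regular_iff u_def[symmetric] \<Lambda>p_def[symmetric] \<Lambda>m_def[symmetric] by (auto simp: wp_def wm_def)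
  have num: "qpoch_inf q A * qpoch_inf q B * qpoch_inf q (inverse (u\<^sup>2)) * qpoch_inf q (u\<^sup>2) = 4 * (r * r) * C u"
  proof -
    have "qpoch_inf q (u\<^sup>2) = (1 - u\<^sup>2) * qpoch_inf q (q * u\<^sup>2)"
      using qpoch_inf_Suc[of "u\<^sup>2"] by (simp add: mult.commute)
    moreover have "qpoch_inf q (inverse (u\<^sup>2)) = (1 - 1 / u\<^sup>2) * qpoch_inf q (q / u\<^sup>2)"
      using qpoch_inf_Suc[of "inverse (u\<^sup>2)"] by (simp add: divide_inverse mult.commute)
    ultimately have "qpoch_inf q A * qpoch_inf q B * qpoch_inf q (inverse (u\<^sup>2)) * qpoch_inf q (u\<^sup>2) =
        ((1 - u\<^sup>2) * (1 - 1 / u\<^sup>2)) * C u"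
      unfolding C_def by (simp only: mult_ac)
    then show ?thesis unfolding u_def circle_pt_props(3)[OF t] r(2) .
  qed
  have "asc_weight q A B \<delta> \<gamma> t = 1 / (2 * complex_of_real pi * r) * (4 * (r * r) * C u) /
      (qpoch_inf q (A * \<delta> * \<Lambda>p) * qpoch_inf q (A * \<delta> * \<Lambda>m) * qpoch_inf q (A * B * \<Lambda>p / q) * qpoch_inf q (A * B * \<Lambda>m / q)) *
      inverse (asc_phi_den q A B \<delta> \<Lambda>m * asc_phi_den q A B \<delta> \<Lambda>p)"
    unfolding asc_weight_def Let_def r_def[symmetric] ru rm args num ..
  also have "\<dots> = (2 * r / complex_of_real pi * C u) / ((wp * asc_phi_den q A B \<delta> \<Lambda>p) * (wm * asc_phi_den q A B \<delta> \<Lambda>m))"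
  proof -
    have e: "1 / (2 * complex_of_real pi * r) * (4 * (r * r) * C u) = 2 * r / complex_of_real pi * C u"
      using r(1) by simp
    show ?thesis
      unfolding e unfolding wp_def wm_def divide_inverse inverse_mult_distrib by (simp only: mult_ac)
  qed
  finally show ?thesis unfolding pp pm by (simp add: u_def r_def)
qed

lemma isCont_circle_pt: "isCont circle_pt t"
  unfolding circle_pt_def by (intro continuous_intros)

text \<open>In \<open>weight_eq\<close> the numerator is nonzero inside the interval, so a zero of
  \<open>X 0\<close> makes the weight tend to infinity. The finitely many points where the weight is
  irregular are avoided by a punctured neighbourhood.\<close>

lemma X0_circle_nonzero:
  assumes np: "\<forall>t\<in>{-1<..<1}. \<not> is_pole (asc_weight q A B \<delta> \<gamma>) t"
    and v: "norm v = 1" "v\<^sup>2 \<noteq> 1"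
  shows "X 0 v \<noteq> 0"
proof
  assume X0: "X 0 v = 0"
  define t where "t = Re v"
  have nv: "(Re v)\<^sup>2 + (Im v)\<^sup>2 = 1" using v(1) by (simp add: cmod_def)
  have "Im v \<noteq> 0"
  proof
    assume "Im v = 0"
    then have "v = complex_of_real (Re v)" by (simp add: complex_eq_iff)
    then have "v\<^sup>2 = complex_of_real ((Re v)\<^sup>2)" by (metis of_real_power)
    moreover have "(Re v)\<^sup>2 = 1" using nv \<open>Im v = 0\<close> by simp
    ultimately show False using v(2) by (metis of_real_1)
  qed
  then have "(Im v)\<^sup>2 > 0" by simp
  then have "t\<^sup>2 < 1" using nv unfolding t_def by linarith
  then have t: "t \<in> {-1<..<1}" by (auto simp: abs_square_less_1 abs_less_iff)
  have ut0: "circle_pt t \<noteq> 0" using circle_pt_props(1)[OF t] by auto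
  have "Im v = sqrt (1 - t\<^sup>2) \<or> Im v = - sqrt (1 - t\<^sup>2)"
  proof -
    have "1 - t\<^sup>2 = (Im v)\<^sup>2" using nv by (simp add: t_def)
    then show ?thesis by (auto simp: abs_if)
  qed
  then have "v = circle_pt t \<or> v = 1 / circle_pt t"
    unfolding circle_pt_props(2)[OF t] by (auto simp: circle_pt_def t_def complex_eq_iff)
  then have X00: "X 0 (circle_pt t) * X 0 (1 / circle_pt t) = 0" using X0 by auto
  define N where "N = {v \<in> cball 0 1. X 0 v = 0} \<union> {v \<in> cball 0 1. \<not> asc_regular q A B \<delta> (\<gamma> * v / 2)}"
  have "finite N" unfolding N_def by (intro finite_UnI finite_X0_zeros finite_irregular)
  then have "eventually (\<lambda>x. x \<notin> Re ` N) (at t)"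
    by (intro eventually_at_notin_finite finite_imageI)
  moreover have "eventually (\<lambda>x. x \<in> {-1<..<1}) (at t)"
    using t by (intro eventually_at_in_open') auto
  ultimately have ev: "eventually (\<lambda>x. x \<in> {-1<..<1} \<and> circle_pt x \<notin> N \<and> 1 / circle_pt x \<notin> N) (at t)"
  proof eventually_elim
    case (elim x)
    have "Re (circle_pt x) = x" by (simp add: circle_pt_eq)
    moreover have "Re (1 / circle_pt x) = x" using elim(2) circle_pt_props(2)[of x] by simp
    ultimately show ?case using elim by (metis imageI)
  qed
  define num where "num x = 2 * complex_of_real (sqrt (1 - x\<^sup>2)) / complex_of_real pi * C (circle_pt x)" for x
  define den where "den x = X 0 (circle_pt x) * X 0 (1 / circle_pt x)" for x
  have good: "asc_regular q A B \<delta> (\<gamma> * circle_pt x / 2) \<and> asc_regular q A B \<delta> (\<gamma> * (1 / circle_pt x) / 2) \<and> den x \<noteq> 0"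
    if "x \<in> {-1<..<1} \<and> circle_pt x \<notin> N \<and> 1 / circle_pt x \<notin> N" for x
    using that circle_pt_props(1)[of x] unfolding N_def den_def by (auto simp: norm_divide)
  have ev_eq: "eventually (\<lambda>x. num x / den x = asc_weight q A B \<delta> \<gamma> x) (at t)"
    using ev by eventually_elim (use good weight_eq in \<open>simp add: num_def den_def\<close>)
  have "isCont (\<lambda>x. C (circle_pt x)) t"
  proof (rule isCont_o2[OF isCont_circle_pt])
    show "isCont C (circle_pt t)"
      using holomorphic_on_imp_continuous_on[OF C_holomorphic] ut0
      by (simp add: continuous_on_eq_continuous_at open_Compl)
  qed
  then have cnum: "isCont num t" unfolding num_def by (intro continuous_intros) auto
  have "isCont (\<lambda>x. X 0 (circle_pt x)) t" by (rule isCont_o2[OF isCont_circle_pt isCont_X])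
  moreover have "isCont (\<lambda>x. X 0 (1 / circle_pt x)) t"
    by (rule isCont_o2[OF _ isCont_X]) (intro continuous_intros isCont_circle_pt ut0)
  ultimately have "isCont den t" unfolding den_def by (intro continuous_intros)
  then have "(den \<longlongrightarrow> 0) (at t)" using X00 by (simp add: isCont_def den_def)
  then have "filterlim den (at 0) (at t)"
    using eventually_mono[OF ev] good by (auto simp: filterlim_at)
  moreover have "num t \<noteq> 0"
    using C_circle_nonzero[OF circle_pt_props(1)[OF t]] \<open>t\<^sup>2 < 1\<close> by (simp add: num_def)
  ultimately have "is_pole (\<lambda>x. num x / den x) t"
    using cnum by (intro is_pole_divide)
  then have "is_pole (asc_weight q A B \<delta> \<gamma>) t"
    using ev_eq by (rule is_pole_transform) simp
  then show False using np t by blast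
qed

lemma circle_pt_cos:
  assumes "\<theta> \<in> {0..pi}"
  shows "circle_pt (cos \<theta>) = cis \<theta>"
proof -
  have "sqrt (1 - (cos \<theta>)\<^sup>2) = sin \<theta>"
    using assms sin_ge_zero[of \<theta>] by (simp add: sin_squared_eq[symmetric])
  then show ?thesis by (simp add: circle_pt_eq cis.code)
qed

lemma J_cis: "J (cis \<theta>) = \<gamma> * complex_of_real (cos \<theta>)" "J (cis (- \<theta>)) = \<gamma> * complex_of_real (cos \<theta>)"
proof -
  have "cis \<theta> + 1 / cis \<theta> = 2 * complex_of_real (cos \<theta>)"
    by (simp add: divide_inverse complex_eq_iff)
  then show "J (cis \<theta>) = \<gamma> * complex_of_real (cos \<theta>)" by (simp add: J_def)
  have "cis (- \<theta>) + 1 / cis (- \<theta>) = 2 * complex_of_real (cos \<theta>)"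
    by (simp add: divide_inverse complex_eq_iff)
  then show "J (cis (- \<theta>)) = \<gamma> * complex_of_real (cos \<theta>)" by (simp add: J_def)
qed

lemma finite_cis_vimage:
  assumes "finite N"
  shows "finite {\<theta> \<in> {0..pi}. cis \<theta> \<in> N \<or> cis (- \<theta>) \<in> N}"
proof -
  have "{\<theta> \<in> {0..pi}. cis \<theta> \<in> N \<or> cis (- \<theta>) \<in> N} \<subseteq> (\<lambda>v. arccos (Re v)) ` N"
  proof
    fix \<theta> assume \<theta>: "\<theta> \<in> {\<theta> \<in> {0..pi}. cis \<theta> \<in> N \<or> cis (- \<theta>) \<in> N}"
    then have "arccos (Re (cis \<theta>)) = \<theta>" "arccos (Re (cis (- \<theta>))) = \<theta>"
      by (auto simp: arccos_cos)
    then show "\<theta> \<in> (\<lambda>v. arccos (Re v)) ` N" using \<theta> by (metis (mono_tags, lifting) image_eqI mem_Collect_eq)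
  qed
  then show ?thesis using assms by (meson finite_imageI finite_subset)
qed

lemma cis_sq_neq_1:
  assumes "\<theta> \<in> {0<..<pi}"
  shows "(cis \<theta>)\<^sup>2 \<noteq> 1" "(cis (- \<theta>))\<^sup>2 \<noteq> 1"
proof -
  have s: "sin \<theta> > 0" using assms sin_gt_zero by auto
  have neq: "v\<^sup>2 \<noteq> 1" if "Im v \<noteq> 0" for v :: complex
  proof
    assume "v\<^sup>2 = 1"
    then have "v = 1 \<or> v = -1" by (simp add: power2_eq_1_iff)
    then show False using that by auto
  qed
  show "(cis \<theta>)\<^sup>2 \<noteq> 1" "(cis (- \<theta>))\<^sup>2 \<noteq> 1" using s by (intro neq, simp)+
qed

section \<open>Cauchy's formula in the disc\<close>

lemma deriv_J: "v \<noteq> 0 \<Longrightarrow> deriv J v = \<gamma> / 2 * (1 - 1 / v\<^sup>2)"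
  unfolding J_def[abs_def]
  by (rule DERIV_imp_deriv) (auto intro!: derivative_eq_intros simp: power2_eq_square)

lemma asc_F_holomorphic: "asc_F holomorphic_on {z \<in> - cut. X 0 (unif z) \<noteq> 0}"
proof (rule holomorphic_transform)
  show "(\<lambda>z. H (unif z)) holomorphic_on {z \<in> - cut. X 0 (unif z) \<noteq> 0}"
    unfolding H_def using \<gamma>_nz
    by (intro holomorphic_intros holomorphic_on_subset[OF unif_holomorphic]) auto
qed (simp add: asc_F_def cf_value_eq)

section \<open>Two evaluations of one contour integral, for a fixed \<open>w\<close>\<close>

context
  fixes N D :: "complex \<Rightarrow> complex" and w :: complex
  assumes N_hol: "N holomorphic_on UNIV" and D_hol: "D holomorphic_on UNIV"
    and ND: "\<And>s. N s * X 0 s = (s\<^sup>2 - 1) * D s"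
    and D_circle: "\<And>s. norm s = 1 \<Longrightarrow> D s \<noteq> 0"
    and D_zero_iff: "\<And>s. s\<^sup>2 \<noteq> 1 \<Longrightarrow> D s = 0 \<longleftrightarrow> X 0 s = 0"
    and X0_circle: "\<And>s. norm s = 1 \<Longrightarrow> s\<^sup>2 \<noteq> 1 \<Longrightarrow> X 0 s \<noteq> 0"
    and w: "w \<noteq> 0" "norm w < 1" "X 0 w \<noteq> 0"
begin

private lemma disc_sq_neq_1: "norm s < 1 \<Longrightarrow> s\<^sup>2 \<noteq> (1::complex)"
  by (auto simp: power2_eq_1_iff)

private lemma ws_neq_1: "norm s \<le> 1 \<Longrightarrow> w * s - 1 \<noteq> 0"
proof
  assume "norm s \<le> 1" "w * s - 1 = 0"
  then have "norm (w * s) = 1" by simp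
  moreover have "norm (w * s) \<le> norm w * 1"
    unfolding norm_mult using \<open>norm s \<le> 1\<close> by (intro mult_left_mono) auto
  ultimately show False using w(2) by simp
qed

text \<open>
  The integrand \<open>F \<zeta> d\<zeta> / (z - \<zeta>)\<close> of Cauchy's formula in the coordinate \<open>s\<close>, \<open>\<zeta> = J s\<close>, \<open>z = J w\<close>.
  It extends past the circle \<open>|s| = 1\<close>, which covers the cut, because \<open>N s / D s\<close> is
  \<open>(s\<^sup>2 - 1) / X 0 s\<close> without its removable singularities at \<open>\<plusminus>1\<close>.
\<close>

private definition G :: "complex \<Rightarrow> complex" where
  "G s = 2 / \<gamma> * X 1 s * w * N s / (D s * ((w - s) * (w * s - 1)))"

text \<open>The right-hand side is \<open>H s\<close> times the derivative of \<open>J\<close> at s,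
  divided by \<open>J w - J s\<close>. The denominator of \<open>G\<close> comes from
  \<open>J w - J s\<close> = (\<gamma>/2)(w - s)(ws - 1)/(ws).\<close>

private lemma G_eq:
  assumes "s \<noteq> 0" "X 0 s \<noteq> 0" "D s \<noteq> 0" "s \<noteq> w" "w * s - 1 \<noteq> 0"
  shows "G s = X 1 s * (s\<^sup>2 - 1) / (X 0 s * s * (J w - J s))"
proof -
  have JJ: "J w - J s = \<gamma> / 2 * ((w - s) * (w * s - 1)) / (w * s)"
    using w(1) assms(1) by (simp add: J_def field_simps power2_eq_square)
  have nd: "N s / D s = (s\<^sup>2 - 1) / X 0 s"
    using ND[of s] assms by (simp add: frac_eq_eq)
  define E where "E = (w - s) * (w * s - 1)"
  have E: "E \<noteq> 0" using assms by (simp add: E_def)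
  have "G s = 2 / \<gamma> * X 1 s * w * (N s / D s) / E"
    by (simp add: G_def E_def)
  also have "\<dots> = X 1 s * (s\<^sup>2 - 1) / (X 0 s * s * (\<gamma> / 2 * E / (w * s)))"
    unfolding nd using E w(1) assms(1,2) \<gamma>_nz by (simp add: field_simps)
  finally show ?thesis unfolding JJ E_def .
qed

private lemma G_holomorphic: "G holomorphic_on {s. D s \<noteq> 0 \<and> s \<noteq> w \<and> w * s - 1 \<noteq> 0}"
  unfolding G_def[abs_def] using \<gamma>_nz
  by (intro holomorphic_intros holomorphic_on_subset[OF N_hol] holomorphic_on_subset[OF D_hol]) auto

private lemma D_w: "D w \<noteq> 0"
  using D_zero_iff[OF disc_sq_neq_1[OF w(2)]] w(3) by simp

private lemma D_zeros_disc: "norm s < 1 \<Longrightarrow> D s = 0 \<longleftrightarrow> s \<in> Z"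
  using D_zero_iff[OF disc_sq_neq_1] by (simp add: Z_def)

private lemma isCont_D: "isCont D s"
  using holomorphic_on_imp_continuous_on[OF D_hol] by (simp add: continuous_on_eq_continuous_at)

private lemma isCont_N: "isCont N s"
  using holomorphic_on_imp_continuous_on[OF N_hol] by (simp add: continuous_on_eq_continuous_at)

private lemma open_D: "open {s. D s \<noteq> 0}"
  by (intro open_Collect_neq continuous_at_imp_continuous_on ballI isCont_D continuous_on_const)

text \<open>The kernel is 1/(z - \<zeta>) and not 1/(\<zeta> - z), hence the minus sign.\<close>

private lemma residue_G_w: "residue G w = - H w"
proof -
  define f where "f s = - (2 / \<gamma> * X 1 s * w * N s / (D s * (w * s - 1)))" for s
  define S where "S = {s. D s \<noteq> 0} \<inter> ball 0 1"
  have S: "open S" "w \<in> S" using open_D D_w w(2) by (auto simp: S_def)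
  have "f holomorphic_on S"
    unfolding f_def using \<gamma>_nz
    by (intro holomorphic_intros holomorphic_on_subset[OF N_hol] holomorphic_on_subset[OF D_hol])
      (use ws_neq_1 in \<open>auto simp: S_def\<close>)
  then have "residue (\<lambda>s. f s / (s - w)) w = f w" by (rule residue_simple[OF S])
  moreover have "(\<lambda>s. f s / (s - w)) = G"
  proof
    fix s
    have "(w - s) * (w * s - 1) = - ((w * s - 1) * (s - w))" by (simp add: algebra_simps)
    then show "f s / (s - w) = G s" by (simp add: f_def G_def mult.assoc)
  qed
  moreover have "f w = - H w"
  proof -
    have sq: "w\<^sup>2 - 1 \<noteq> 0" using disc_sq_neq_1[OF w(2)] by simp
    have "N w / D w = (w\<^sup>2 - 1) / X 0 w" using ND[of w] D_w w(3) by (simp add: frac_eq_eq)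
    moreover have "f w = - (2 / \<gamma> * X 1 w * w * (N w / D w) / (w\<^sup>2 - 1))"
      by (simp add: f_def power2_eq_square)
    ultimately show ?thesis using sq by (simp add: H_def)
  qed
  ultimately show ?thesis by simp
qed

text \<open>Residues of differential forms are invariant under the conformal map \<open>J\<close>.
  Near p, and away from p itself, \<open>G\<close> is the pullback of the integrand;
  \<open>S\<close> leaves out w and the other zeros, where the integrand may be singular.\<close>

private lemma residue_G_Z:
  assumes p: "p \<in> Z"
  shows "residue G p = residue (\<lambda>\<zeta>. asc_F \<zeta> / (J w - \<zeta>)) (J p)"
proof -
  define S where "S = ball 0 1 - {0} - (Z - {p}) - {w}"
  have pw: "p \<noteq> w" using p w(3) by (auto simp: Z_def)
  have p0: "p \<noteq> 0" "norm p < 1" using p zero_notin_Z by (auto simp: Z_def)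
  have S: "open S" "p \<in> S"
    unfolding S_def using finite_Z p0 pw
    by (auto intro!: open_Diff open_ball finite_imp_closed)
  have SD: "S \<subseteq> ball 0 1 - {0}" by (auto simp: S_def)
  have inj: "inj_on J S" using inj_on_J SD by (rule inj_on_subset)
  have Shol: "J holomorphic_on S" using J_holomorphic_disc SD by (rule holomorphic_on_subset)
  have good: "J s \<notin> cut \<and> unif (J s) = s \<and> X 0 s \<noteq> 0 \<and> J w - J s \<noteq> 0" if "s \<in> S - {p}" for s
  proof -
    have s: "s \<noteq> 0" "norm s < 1" "s \<notin> Z" "s \<noteq> w" using that by (auto simp: S_def)
    have "J w \<noteq> J s" using inj_onD[OF inj_on_J, of w s] s w by auto
    then show ?thesis using J_notin_cut[OF s(1,2)] unif_J[OF s(1,2)] s by (auto simp: Z_def)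
  qed
  have sub: "J ` S - {J p} \<subseteq> {z \<in> - cut. X 0 (unif z) \<noteq> 0} \<inter> {z. J w - z \<noteq> 0}"
  proof
    fix \<zeta> assume "\<zeta> \<in> J ` S - {J p}"
    then obtain s where "s \<in> S - {p}" "\<zeta> = J s" by auto
    then show "\<zeta> \<in> {z \<in> - cut. X 0 (unif z) \<noteq> 0} \<inter> {z. J w - z \<noteq> 0}" using good[of s] by auto
  qed
  have "(\<lambda>\<zeta>. asc_F \<zeta> / (J w - \<zeta>)) holomorphic_on J ` S - {J p}"
    by (intro holomorphic_intros holomorphic_on_subset[OF asc_F_holomorphic]) (use sub in auto)
  from residue_comp_conformal[OF S Shol inj this]
  have "residue (\<lambda>s. deriv J s * (asc_F (J s) / (J w - J s))) p = residue (\<lambda>\<zeta>. asc_F \<zeta> / (J w - \<zeta>)) (J p)" .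
  moreover have "residue (\<lambda>s. deriv J s * (asc_F (J s) / (J w - J s))) p = residue G p"
  proof (rule residue_cong[OF _ refl])
    have "eventually (\<lambda>s. s \<in> S - {p}) (at p)"
      using S eventually_at_in_open by blast
    then show "eventually (\<lambda>s. deriv J s * (asc_F (J s) / (J w - J s)) = G s) (at p)"
    proof eventually_elim
      case (elim s)
      note g = good[OF elim]
      have s: "s \<noteq> 0" "norm s < 1" "s \<notin> Z" "s \<noteq> w" using elim by (auto simp: S_def)
      have "asc_F (J s) = H s" using g cf_value_eq[of "J s"] by (simp add: asc_F_def)
      then have "deriv J s * (asc_F (J s) / (J w - J s)) = \<gamma> / 2 * (1 - 1 / s\<^sup>2) * (2 * s / \<gamma> * X 1 s / X 0 s / (J w - J s))"
        by (simp add: deriv_J[OF s(1)] H_def)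
      also have "\<dots> = ((1 - 1 / s\<^sup>2) * s) * X 1 s / (X 0 s * (J w - J s))"
        using \<gamma>_nz by simp
      also have "(1 - 1 / s\<^sup>2) * s = (s\<^sup>2 - 1) / s"
        using s(1) by (simp add: field_simps power2_eq_square)
      also have "(s\<^sup>2 - 1) / s * X 1 s / (X 0 s * (J w - J s)) = X 1 s * (s\<^sup>2 - 1) / (X 0 s * s * (J w - J s))"
        by (simp add: mult_ac)
      also have "\<dots> = G s"
        using s g D_zeros_disc[OF s(2)] ws_neq_1[of s] by (intro G_eq[symmetric]) auto
      finally show ?case .
    qed
  qed
  ultimately show ?thesis by simp
qed

private lemma contour_integral_G_residues:
  "contour_integral (circlepath 0 1) G = 2 * pi * \<i> * (- H w + (\<Sum>p\<in>Z. residue G p))"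
proof -
  \<comment> \<open>The radius 2 leaves room around the unit circle. Extra zeros of \<open>D\<close>
    and the point 1/w lie outside the closed unit disc, where the winding number is 0, since
    \<open>D\<close> has no zero on the circle.\<close>
  define pts where "pts = {s \<in> cball 0 2. D s = 0} \<union> {w, 1 / w}"
  have fin: "finite pts"
    unfolding pts_def using finite_zeros_in_cball[OF D_hol D_w, of 2] by simp
  have win: "winding_number (circlepath 0 1) s = 0" if "norm s > 1" for s
    by (rule winding_number_zero_outside[of _ "cball 0 1"]) (use that in auto)
  have nw: "norm (1 / w) > 1" using w by (simp add: norm_divide)
  have "contour_integral (circlepath 0 1) G =
      2 * pi * \<i> * (\<Sum>p\<in>pts. winding_number (circlepath 0 1) p * residue G p)"
  proof (rule Residue_theorem[of "ball 0 2"])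
    show "G holomorphic_on ball 0 2 - pts"
      by (rule holomorphic_on_subset[OF G_holomorphic]) (use w(1) in \<open>auto simp: pts_def field_simps\<close>)
    show "path_image (circlepath 0 1) \<subseteq> ball 0 2 - pts"
      using D_circle w(2) nw by (auto simp: pts_def)
    show "\<forall>z. z \<notin> ball 0 2 \<longrightarrow> winding_number (circlepath 0 1) z = 0"
      using win by auto
  qed (use fin in auto)
  also have "(\<Sum>p\<in>pts. winding_number (circlepath 0 1) p * residue G p) = (\<Sum>p\<in>insert w Z. residue G p)"
  proof (rule sum.mono_neutral_cong_right)
    show "insert w Z \<subseteq> pts"
      using D_zeros_disc by (auto simp: pts_def Z_def)
    show "\<forall>p\<in>pts - insert w Z. winding_number (circlepath 0 1) p * residue G p = 0"
    proof
      fix p assume p: "p \<in> pts - insert w Z"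
      have "norm p > 1"
      proof (rule ccontr)
        assume "\<not> norm p > 1"
        then have "norm p < 1 \<or> norm p = 1" by auto
        then show False using p D_circle[of p] D_zeros_disc[of p] nw by (auto simp: pts_def)
      qed
      then show "winding_number (circlepath 0 1) p * residue G p = 0" by (simp add: win)
    qed
    show "winding_number (circlepath 0 1) p * residue G p = residue G p" if "p \<in> insert w Z" for p
      using that w(2) winding_number_circlepath[of p 0 1] by (auto simp: Z_def)
  qed (rule fin)
  also have "(\<Sum>p\<in>insert w Z. residue G p) = - H w + (\<Sum>p\<in>Z. residue G p)"
    using finite_Z w(3) by (subst sum.insert) (auto simp: residue_G_w Z_def)
  finally show ?thesis .
qed

text \<open>The weight times sin \<theta>, that is, times the density of dt for t = cos \<theta>. In
  terms of \<open>N / D\<close> it is continuous even at the angles 0 and \<pi>.\<close>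

private definition g :: "real \<Rightarrow> complex" where
  "g \<theta> = 1 / (2 * complex_of_real pi) * C (cis \<theta>) * (N (cis \<theta>) / D (cis \<theta>)) * (N (cis (- \<theta>)) / D (cis (- \<theta>)))"

private lemma g_eq:
  assumes "\<theta> \<in> {0<..<pi}"
  shows "g \<theta> = 2 * complex_of_real ((sin \<theta>)\<^sup>2) / complex_of_real pi * C (cis \<theta>) / (X 0 (cis \<theta>) * X 0 (cis (- \<theta>)))"
    "((cis \<theta>)\<^sup>2 - 1) * ((cis (- \<theta>))\<^sup>2 - 1) = 4 * complex_of_real ((sin \<theta>)\<^sup>2)"
proof -
  note sq = cis_sq_neq_1[OF assms]
  have nd: "N s / D s = (s\<^sup>2 - 1) / X 0 s" if "norm s = 1" "s\<^sup>2 \<noteq> 1" for s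
    using ND[of s] D_circle[OF that(1)] X0_circle[OF that] by (simp add: frac_eq_eq)
  have d: "cis \<theta> - cis (- \<theta>) = 2 * \<i> * complex_of_real (sin \<theta>)"
    by (simp add: complex_eq_iff)
  have m: "cis \<theta> * cis (- \<theta>) = 1" by (simp add: cis_mult)
  have "((cis \<theta>)\<^sup>2 - 1) * ((cis (- \<theta>))\<^sup>2 - 1) =
      (cis \<theta> * cis (- \<theta>))\<^sup>2 - 2 * (cis \<theta> * cis (- \<theta>)) + 1 - (cis \<theta> - cis (- \<theta>))\<^sup>2 + 2 * (1 - 1)"
    using m by (simp add: algebra_simps power2_eq_square)
  then show s: "((cis \<theta>)\<^sup>2 - 1) * ((cis (- \<theta>))\<^sup>2 - 1) = 4 * complex_of_real ((sin \<theta>)\<^sup>2)"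
    unfolding d m by (simp add: power_mult_distrib)
  have "g \<theta> = 1 / (2 * complex_of_real pi) * C (cis \<theta>) *
      (((cis \<theta>)\<^sup>2 - 1) * ((cis (- \<theta>))\<^sup>2 - 1)) / (X 0 (cis \<theta>) * X 0 (cis (- \<theta>)))"
    unfolding g_def using nd[OF _ sq(1)] nd[OF _ sq(2)] by (simp add: mult.assoc)
  then show "g \<theta> = 2 * complex_of_real ((sin \<theta>)\<^sup>2) / complex_of_real pi * C (cis \<theta>) / (X 0 (cis \<theta>) * X 0 (cis (- \<theta>)))"
    unfolding s by simp
qed

private lemma J_w_neq: "J w \<noteq> \<gamma> * complex_of_real (cos \<theta>)"
  using J_notin_cut[OF w(1,2)] J_mem_cut_iff[of "cis \<theta>"] J_cis(1)[of \<theta>] by auto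

private lemma continuous_g: "continuous_on S g"
proof (intro continuous_at_imp_continuous_on ballI)
  fix \<theta> :: real
  have cis: "isCont cis \<theta>" "isCont (\<lambda>\<theta>. cis (- \<theta>)) \<theta>"
    using isCont_cis isCont_o2[of \<theta> uminus cis] by (auto intro: continuous_intros)
  have C: "isCont C (cis \<theta>)"
    using holomorphic_on_imp_continuous_on[OF C_holomorphic]
    by (simp add: continuous_on_eq_continuous_at open_Compl)
  show "isCont g \<theta>"
    unfolding g_def[abs_def]
    by (intro continuous_intros isCont_o2[OF cis(1) C] isCont_o2[OF cis(1) isCont_N] isCont_o2[OF cis(1) isCont_D]
        isCont_o2[OF cis(2) isCont_N] isCont_o2[OF cis(2) isCont_D]) (auto simp: D_circle)
qed

text \<open>The points \<open>cis \<theta>\<close> and \<open>cis (-\<theta>)\<close> lie over the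
  same point of the cut and carry the boundary values of the continued fraction from its two sides.
  Their combination is the jump across the cut, with the Casoratian in its numerator.\<close>

private lemma G_symmetrized:
  assumes \<theta>: "\<theta> \<in> {0<..<pi}"
  shows "G (cis \<theta>) * \<i> * cis \<theta> + G (cis (- \<theta>)) * \<i> * cis (- \<theta>) =
    - 2 * complex_of_real pi * \<i> * (g \<theta> / (J w - \<gamma> * complex_of_real (cos \<theta>)))"
proof -
  define u where "u = cis \<theta>"
  define v where "v = cis (- \<theta>)"
  define z where "z = J w - \<gamma> * complex_of_real (cos \<theta>)"
  have z: "z \<noteq> 0" using J_w_neq by (simp add: z_def)
  note sq = cis_sq_neq_1[OF \<theta>, folded u_def v_def]
  have nz: "X 0 u \<noteq> 0" "X 0 v \<noteq> 0" using X0_circle sq by (auto simp: u_def v_def)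
  have uv: "u * v = 1" by (simp add: u_def v_def cis_mult)
  have u0: "u \<noteq> 0" by (simp add: u_def)
  have v: "v = 1 / u" using uv u0 by (simp add: field_simps)
  have G: "G s * \<i> * s = \<i> * (X 1 s * (s\<^sup>2 - 1) / (X 0 s * z))"
    if "s = u \<or> s = v" for s
  proof -
    have "norm s = 1" "s\<^sup>2 \<noteq> 1" "J s = \<gamma> * complex_of_real (cos \<theta>)"
      using that sq J_cis by (auto simp: u_def v_def)
    note s = this
    have s0: "s \<noteq> 0" "s \<noteq> w" using s(1) w(2) by auto
    have "G s = X 1 s * (s\<^sup>2 - 1) / (X 0 s * s * z)"
      unfolding z_def s(3)[symmetric]
      using s by (intro G_eq s0 D_circle X0_circle ws_neq_1) auto
    then show ?thesis using s0 by simp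
  qed
  have cas: "u * X 1 u * X 0 v - v * X 0 u * X 1 v = - (C u * (v - u))"
    using arg_cong[OF casoratian[OF u0], of uminus] by (simp add: v C_def)
  have su: "u\<^sup>2 - 1 = u * (u - v)" and sv: "v\<^sup>2 - 1 = - (v * (u - v))"
    using uv by (simp_all add: algebra_simps power2_eq_square)
  have "G u * \<i> * u + G v * \<i> * v = \<i> * (X 1 u * (u\<^sup>2 - 1) / (X 0 u * z) + X 1 v * (v\<^sup>2 - 1) / (X 0 v * z))"
    using G[of u] G[of v] by (simp add: distrib_left)
  also have "X 1 u * (u\<^sup>2 - 1) / (X 0 u * z) + X 1 v * (v\<^sup>2 - 1) / (X 0 v * z) =
      (u - v) * (u * X 1 u * X 0 v - v * X 0 u * X 1 v) / (X 0 u * X 0 v * z)"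
    unfolding su sv using nz z by (simp add: divide_simps) (simp add: algebra_simps)
  also have "\<dots> = - ((u\<^sup>2 - 1) * (v\<^sup>2 - 1) * C u) / (X 0 u * X 0 v * z)"
  proof -
    have "(u\<^sup>2 - 1) * (v\<^sup>2 - 1) = - ((u * v) * ((u - v) * (u - v)))"
      unfolding su sv by (simp add: mult_ac)
    then have e: "(u\<^sup>2 - 1) * (v\<^sup>2 - 1) = - ((u - v) * (u - v))"
      unfolding uv by simp
    have "(u - v) * - (C u * (v - u)) = - (- ((u - v) * (u - v)) * C u)"
      by (simp add: algebra_simps)
    then show ?thesis unfolding cas e by (rule arg_cong)
  qed
  also have "\<i> * (- ((u\<^sup>2 - 1) * (v\<^sup>2 - 1) * C u) / (X 0 u * X 0 v * z)) =
      - 2 * complex_of_real pi * \<i> * (g \<theta> / z)"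
    unfolding g_eq(1)[OF \<theta>] g_eq(2)[OF \<theta>, folded u_def v_def] u_def[symmetric] v_def[symmetric]
    using nz z by (simp add: field_simps)
  finally show ?thesis by (simp add: u_def v_def z_def)
qed

text \<open>Periodicity and reflection fold the lower half-circle onto the upper one, so that the
  integrand appears in its symmetrized form.\<close>

private lemma contour_integral_G_angle:
  "contour_integral (circlepath 0 1) G =
    - 2 * complex_of_real pi * \<i> * integral {0..pi} (\<lambda>\<theta>. g \<theta> / (J w - \<gamma> * complex_of_real (cos \<theta>)))"
proof -
  define k where "k t = G (cis t) * \<i> * cis t" for t
  have "isCont k t" for t
  proof -
    have "open {s. D s \<noteq> 0 \<and> s \<noteq> w \<and> w * s - 1 \<noteq> 0}"
      by (intro open_Collect_conj open_D open_Collect_neq continuous_intros)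
    then have "isCont G (cis t)"
      using holomorphic_on_imp_continuous_on[OF G_holomorphic] D_circle[of "cis t"] ws_neq_1[of "cis t"] w(2)
      by (auto simp: continuous_on_eq_continuous_at)
    then have "isCont (\<lambda>t. G (cis t)) t" by (rule isCont_o2[OF isCont_cis])
    then show ?thesis unfolding k_def by (intro continuous_intros isCont_cis)
  qed
  then have cont: "continuous_on S k" for S by (simp add: continuous_at_imp_continuous_on)
  have int: "k integrable_on {a..b}" for a b by (rule integrable_continuous_real[OF cont])
  have "contour_integral (circlepath 0 1) G = integral {0..2*pi} (\<lambda>t. G (0 + 1 * cis t) * 1 * \<i> * cis t)"
    unfolding circlepath_def using contour_integral_part_circlepath_eq[of 0 "2*pi" 0 1 G] by simp
  also have "\<dots> = integral {0..2*pi} k"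
    by (simp add: k_def[abs_def] del: integral_mult_left integral_mult_right)
  also have "\<dots> = integral {0..pi} k + integral {pi..2*pi} k"
    by (rule Henstock_Kurzweil_Integration.integral_combine[symmetric, OF _ _ int]) auto
  also have "integral {pi..2*pi} k = integral {0..pi} (\<lambda>t. k (- t))"
  proof -
    have per: "k (t + 2 * pi) = k t" for t
      by (simp add: k_def cis_mult[symmetric] del: cis_mult)
    have "integral {pi..2*pi} k = integral {pi - 2*pi..2*pi - 2*pi} (\<lambda>t. k (t + 2*pi))"
      by (rule integral_shift_real_ivl[symmetric])
    also have "\<dots> = integral {-pi..-0} k" by (simp add: per)
    also have "\<dots> = integral {0..pi} (\<lambda>t. k (- t))"
      using Henstock_Kurzweil_Integration.integral_reflect_real[of pi 0 "\<lambda>t. k (- t)"] by simp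
    finally show ?thesis .
  qed
  also have "integral {0..pi} k + integral {0..pi} (\<lambda>t. k (- t)) = integral {0..pi} (\<lambda>t. k t + k (- t))"
    by (rule Henstock_Kurzweil_Integration.integral_add[symmetric, OF int])
      (intro integrable_continuous_real continuous_on_compose2[OF cont[of UNIV]] continuous_intros, auto)
  also have "\<dots> = integral {0..pi} (\<lambda>\<theta>. - 2 * complex_of_real pi * \<i> * (g \<theta> / (J w - \<gamma> * complex_of_real (cos \<theta>))))"
  proof (rule integral_spike[of "{0, pi}"])
    fix \<theta> assume "\<theta> \<in> {0..pi} - {0, pi}"
    then show "- 2 * complex_of_real pi * \<i> * (g \<theta> / (J w - \<gamma> * complex_of_real (cos \<theta>))) = k \<theta> + k (- \<theta>)"
      unfolding k_def by (intro G_symmetrized[symmetric]) auto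
  qed simp
  also have "\<dots> = - 2 * complex_of_real pi * \<i> * integral {0..pi} (\<lambda>\<theta>. g \<theta> / (J w - \<gamma> * complex_of_real (cos \<theta>)))"
    by (rule integral_mult_right)
  finally show ?thesis .
qed

text \<open>The exceptions are the ends of the interval and the angles at which one of the two
  series in the weight is irregular.\<close>

private lemma weight_angle:
  "\<exists>S. finite S \<and> (\<forall>\<theta>\<in>{0..pi} - S. sin \<theta> *\<^sub>R asc_weight q A B \<delta> \<gamma> (cos \<theta>) = g \<theta>)"
proof -
  define M where "M = {v \<in> cball 0 1. \<not> asc_regular q A B \<delta> (\<gamma> * v / 2)}"
  define S where "S = {\<theta> \<in> {0..pi}. cis \<theta> \<in> M \<or> cis (- \<theta>) \<in> M} \<union> {0, pi}"
  have "finite S"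
    unfolding S_def M_def by (intro finite_UnI finite_cis_vimage finite_irregular) auto
  moreover have "sin \<theta> *\<^sub>R asc_weight q A B \<delta> \<gamma> (cos \<theta>) = g \<theta>" if \<theta>: "\<theta> \<in> {0..pi} - S" for \<theta>
  proof -
    have \<theta>': "\<theta> \<in> {0<..<pi}" "\<theta> \<in> {0..pi}" using \<theta> by (auto simp: S_def)
    have c: "cos \<theta> \<in> {-1<..<1}"
      using \<theta>' cos_monotone_0_pi[of 0 \<theta>] cos_monotone_0_pi[of \<theta> pi] by auto
    have u: "circle_pt (cos \<theta>) = cis \<theta>" "1 / cis \<theta> = cis (- \<theta>)"
      using circle_pt_cos[OF \<theta>'(2)] by (simp_all add: divide_inverse)
    have r: "sqrt (1 - (cos \<theta>)\<^sup>2) = sin \<theta>"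
      using \<theta>' sin_ge_zero[of \<theta>] by (simp add: sin_squared_eq[symmetric])
    have "asc_regular q A B \<delta> (\<gamma> * cis \<theta> / 2)" "asc_regular q A B \<delta> (\<gamma> * cis (- \<theta>) / 2)"
      using \<theta> \<theta>'(2) by (auto simp: S_def M_def)
    then have wt: "asc_weight q A B \<delta> \<gamma> (cos \<theta>) =
        2 * complex_of_real (sin \<theta>) / complex_of_real pi * C (cis \<theta>) / (X 0 (cis \<theta>) * X 0 (cis (- \<theta>)))"
      using weight_eq[OF c] unfolding u r by blast
    show ?thesis
      unfolding wt g_eq(1)[OF \<theta>'(1)] scaleR_conv_of_real power2_eq_square of_real_mult divide_inverse
      by (simp only: mult_ac)
  qed
  ultimately show ?thesis by blast
qed

text \<open>The substitution t = cos \<theta> is made in its absolute form. The factor sin \<theta>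
  turns the weight, possibly unbounded at 1 and -1, into the continuous \<open>g\<close>, up to
  finitely many angles, and this also yields the integrability.\<close>

private lemma change_of_variables:
  assumes h: "continuous_on {-1..1} h"
  shows "(\<lambda>t. asc_weight q A B \<delta> \<gamma> t * h t) absolutely_integrable_on {-1..1}"
    "integral {-1..1} (\<lambda>t. asc_weight q A B \<delta> \<gamma> t * h t) = integral {0..pi} (\<lambda>\<theta>. g \<theta> * h (cos \<theta>))"
proof -
  obtain S where S: "finite S" "\<And>\<theta>. \<theta> \<in> {0..pi} - S \<Longrightarrow> sin \<theta> *\<^sub>R asc_weight q A B \<delta> \<gamma> (cos \<theta>) = g \<theta>"
    using weight_angle by blast
  have img: "cos ` {0..pi} = {-1..1}"
  proof
    show "cos ` {0..pi} \<subseteq> {-1..1}" by auto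
    show "{-1..1} \<subseteq> cos ` {0..pi}"
    proof
      fix t :: real assume "t \<in> {-1..1}"
      then show "t \<in> cos ` {0..pi}"
        by (intro image_eqI[of _ _ "arccos t"]) (auto simp: arccos_lbound arccos_ubound)
    qed
  qed
  let ?k = "\<lambda>\<theta>. \<bar>- sin \<theta>\<bar> *\<^sub>R (asc_weight q A B \<delta> \<gamma> (cos \<theta>) * h (cos \<theta>))"
  have eq: "?k \<theta> = g \<theta> * h (cos \<theta>)" if "\<theta> \<in> {0..pi} - S" for \<theta>
  proof -
    have "\<bar>- sin \<theta>\<bar> = sin \<theta>" using that sin_ge_zero[of \<theta>] by simp
    then have "?k \<theta> = (sin \<theta> *\<^sub>R asc_weight q A B \<delta> \<gamma> (cos \<theta>)) * h (cos \<theta>)" by simp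
    then show ?thesis unfolding S(2)[OF that] .
  qed
  have "continuous_on {0..pi} (\<lambda>\<theta>. g \<theta> * h (cos \<theta>))"
    by (intro continuous_intros continuous_g continuous_on_compose2[OF h]) auto
  then have "(\<lambda>\<theta>. g \<theta> * h (cos \<theta>)) absolutely_integrable_on {0..pi}"
    by (rule absolutely_integrable_continuous_real)
  then have ai: "?k absolutely_integrable_on {0..pi}"
    using eq by (rule absolutely_integrable_spike[OF _ negligible_finite[OF S(1)]])
  have ik: "integral {0..pi} ?k = integral {0..pi} (\<lambda>\<theta>. g \<theta> * h (cos \<theta>))"
    using eq by (intro integral_spike[OF negligible_finite[OF S(1)]]) auto
  have "(\<lambda>t. asc_weight q A B \<delta> \<gamma> t * h t) absolutely_integrable_on cos ` {0..pi} \<and>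
      integral (cos ` {0..pi}) (\<lambda>t. asc_weight q A B \<delta> \<gamma> t * h t) = integral {0..pi} (\<lambda>\<theta>. g \<theta> * h (cos \<theta>))"
  proof (subst has_absolute_integral_change_of_variables_real[symmetric, where h = "\<lambda>\<theta>. - sin \<theta>"])
    show "inj_on cos {0..pi}"
      by (rule inj_onI) (simp add: cos_inj_pi)
    show "(cos has_field_derivative - sin x) (at x within {0..pi})" for x :: real
      by (auto intro!: derivative_eq_intros)
  qed (use ai ik in auto)
  then show "(\<lambda>t. asc_weight q A B \<delta> \<gamma> t * h t) absolutely_integrable_on {-1..1}"
    "integral {-1..1} (\<lambda>t. asc_weight q A B \<delta> \<gamma> t * h t) = integral {0..pi} (\<lambda>\<theta>. g \<theta> * h (cos \<theta>))"
    unfolding img by blast+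
qed

lemma weight_integrable_aux: "asc_weight q A B \<delta> \<gamma> absolutely_integrable_on {-1..1}"
  using change_of_variables(1)[of "\<lambda>_. 1"] by simp

text \<open>The residues of \<open>G\<close> in the disc and its integral over the angle are equated
  and 2\<pi>i is cancelled; the term at w supplies \<open>H w\<close>, the terms at \<open>Z\<close>
  the pole contributions.\<close>

lemma integral_representation_aux:
  "H w = integral {-1..1} (\<lambda>t. asc_weight q A B \<delta> \<gamma> t / (J w - \<gamma> * complex_of_real t)) +
    (\<Sum>p\<in>J ` Z. residue (\<lambda>\<zeta>. asc_F \<zeta> / (J w - \<zeta>)) p)"
proof -
  have "J w - \<gamma> * complex_of_real t \<noteq> 0" if "t \<in> {-1..1}" for t
    using J_w_neq[of "arccos t"] that by simp
  then have "continuous_on {-1..1} (\<lambda>t. 1 / (J w - \<gamma> * complex_of_real t))"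
    by (intro continuous_intros) auto
  from change_of_variables(2)[OF this]
  have I: "integral {-1..1} (\<lambda>t. asc_weight q A B \<delta> \<gamma> t / (J w - \<gamma> * complex_of_real t)) =
      integral {0..pi} (\<lambda>\<theta>. g \<theta> / (J w - \<gamma> * complex_of_real (cos \<theta>)))" by simp
  define c where "c = 2 * complex_of_real pi * \<i>"
  have c0: "c \<noteq> 0" by (simp add: c_def)
  have "c * (- H w + (\<Sum>p\<in>Z. residue G p)) = contour_integral (circlepath 0 1) G"
    unfolding contour_integral_G_residues by (simp only: c_def of_real_mult of_real_numeral)
  also have "\<dots> = c * - integral {0..pi} (\<lambda>\<theta>. g \<theta> / (J w - \<gamma> * complex_of_real (cos \<theta>)))"
    unfolding contour_integral_G_angle by (simp only: c_def mult_minus_left mult_minus_right)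
  finally have "- H w + (\<Sum>p\<in>Z. residue G p) = - integral {0..pi} (\<lambda>\<theta>. g \<theta> / (J w - \<gamma> * complex_of_real (cos \<theta>)))"
    using c0 by (simp only: mult_cancel_left) simp
  moreover have "(\<Sum>p\<in>J ` Z. residue (\<lambda>\<zeta>. asc_F \<zeta> / (J w - \<zeta>)) p) = (\<Sum>p\<in>Z. residue G p)"
  proof (subst sum.reindex)
    show "inj_on J Z" by (rule inj_on_subset[OF inj_on_J]) (use zero_notin_Z in \<open>auto simp: Z_def\<close>)
  qed (auto intro!: sum.cong simp: residue_G_Z)
  ultimately show ?thesis unfolding I by (simp add: algebra_simps add_eq_0_iff)
qed

end

theorem integral_representation:
  assumes np: "\<forall>t\<in>{-1<..<1}. \<not> is_pole (asc_weight q A B \<delta> \<gamma>) t"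
  shows "asc_weight q A B \<delta> \<gamma> absolutely_integrable_on {-1..1}"
    and "z \<notin> cut \<Longrightarrow> \<not> is_pole asc_F z \<Longrightarrow>
      asc_F z = integral {-1..1} (\<lambda>t. asc_weight q A B \<delta> \<gamma> t / (z - \<gamma> * complex_of_real t)) +
        (\<Sum>p\<in>J ` Z. residue (\<lambda>\<zeta>. asc_F \<zeta> / (z - \<zeta>)) p)"
proof -
  obtain N D where ND': "N holomorphic_on UNIV" "D holomorphic_on UNIV" "\<forall>s. N s * X 0 s = (s\<^sup>2 - 1) * D s"
    "D 1 \<noteq> 0" "D (-1) \<noteq> 0" "\<forall>s. s\<^sup>2 \<noteq> 1 \<longrightarrow> (D s = 0 \<longleftrightarrow> X 0 s = 0)"
  proof -
    have "deriv (X 0) 1 \<noteq> 0" if "X 0 1 = 0" using X0_simple_at_branch_point[of 1] that by simp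
    moreover have "deriv (X 0) (-1) \<noteq> 0" if "X 0 (-1) = 0" using X0_simple_at_branch_point[of "-1"] that by simp
    ultimately show ?thesis
      using factor_two_simple_zeros[OF X_holomorphic_UNIV[of 0]] that by blast
  qed
  note ND = ND'(1,2) ND'(3)[rule_format] ND'(4,5) ND'(6)[rule_format]
  have Dc: "D s \<noteq> 0" if "norm s = 1" for s
  proof (cases "s\<^sup>2 = 1")
    case True
    then have "s = 1 \<or> s = -1" by (simp add: power2_eq_1_iff)
    then show ?thesis using ND(4,5) by auto
  next
    case False
    then show ?thesis using ND(6) X0_circle_nonzero[OF np that] by simp
  qed
  \<comment> \<open>Integrability of the weight does not involve z, but the lemma for it is stated
    for a point w; any point of the punctured disc outside the finite set \<open>Z\<close> will
    do.\<close>
  obtain w0 :: complex where w0: "w0 \<noteq> 0" "norm w0 < 1" "X 0 w0 \<noteq> 0"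
  proof -
    have "infinite (ball (0::complex) 1 - {0})"
      using uncountable_ball[of 1 "0::complex"] by (auto dest: countable_finite)
    then have "\<not> ball (0::complex) 1 - {0} \<subseteq> Z" using finite_Z by (meson finite_subset)
    then obtain x where "x \<in> ball 0 1 - {0}" "x \<notin> Z" by blast
    then show ?thesis using that[of x] by (auto simp: Z_def)
  qed
  show "asc_weight q A B \<delta> \<gamma> absolutely_integrable_on {-1..1}"
    by (rule weight_integrable_aux[OF ND(1,2,3) Dc ND(6) X0_circle_nonzero[OF np] w0])
  assume z: "z \<notin> cut" "\<not> is_pole asc_F z"
  have X0: "X 0 (unif z) \<noteq> 0" using z is_pole_asc_F_iff by blast
  show "asc_F z = integral {-1..1} (\<lambda>t. asc_weight q A B \<delta> \<gamma> t / (z - \<gamma> * complex_of_real t)) +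
        (\<Sum>p\<in>J ` Z. residue (\<lambda>\<zeta>. asc_F \<zeta> / (z - \<zeta>)) p)"
    using integral_representation_aux[OF ND(1,2,3) Dc ND(6) X0_circle_nonzero[OF np] unif_props(1,2)[OF z(1)] X0]
    unfolding unif_props(3)[OF z(1)] using cf_value_eq[OF z(1) X0] by (simp add: asc_F_def)
qed

end

theorem mainTheorem11:
  fixes q A B \<delta> \<gamma> :: complex
  defines "K \<equiv> {z. z / \<gamma> \<in> complex_of_real ` {-1..1}}"
  defines "\<alpha> \<equiv> asc_\<alpha> q A B \<delta>"
  defines "\<beta> \<equiv> asc_\<beta> q \<delta>"
  defines "F \<equiv> \<lambda>z. cf_value \<alpha> (\<beta> z)"
  defines "R \<equiv> \<lambda>z. asc_quotient q A B \<delta> (Lambda_minus \<gamma> z)"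
  defines "\<omega> \<equiv> asc_weight q A B \<delta> \<gamma>"
  assumes "0 < norm q" and "norm q < 1"
    and "A \<noteq> 0" and "B \<noteq> 0" and "\<delta> \<noteq> 0"
    and "\<And>n. n \<ge> 1 \<Longrightarrow> asc_bsq q A B \<delta> n \<noteq> 0"
    and "\<gamma>\<^sup>2 = 4 * (q / (A * B * \<delta>))"
  shows
    \<comment> \<open>the quotient formula at every point where its ingredients are defined\<close>
    "(\<forall>z. z \<notin> K \<longrightarrow> asc_regular q A B \<delta> (Lambda_minus \<gamma> z) \<longrightarrow>
       (if asc_phi_den q A B \<delta> (Lambda_minus \<gamma> z) \<noteq> 0
        then cf_converges_to \<alpha> (\<beta> z) (R z)
        else cf_converges_to_infinity \<alpha> (\<beta> z)))
     \<and>
     \<comment> \<open>at every point outside \<open>K = [-\<gamma>, \<gamma>]\<close>, as an identity of meromorphic functions\<close>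
     (\<forall>z. z \<notin> K \<longrightarrow>
       (\<exists>v. cf_converges_to \<alpha> (\<beta> z) v \<and> (R \<longlongrightarrow> v) (at z)) \<or>
       (cf_converges_to_infinity \<alpha> (\<beta> z) \<and> is_pole R z))
     \<and>
     \<comment> \<open>the integral representation; the contribution of a pole \<open>p\<close> of \<open>F\<close> is the principal part
       of \<open>F\<close> at \<open>p\<close>, evaluated at \<open>z\<close>, which is the residue at \<open>p\<close> of \<open>F \<zeta> / (z - \<zeta>)\<close>\<close>
     finite {p. p \<notin> K \<and> is_pole F p}
     \<and>
     ((\<forall>t\<in>{-1<..<1}. \<not> is_pole \<omega> t) \<longrightarrow>
       \<omega> absolutely_integrable_on {-1..1} \<and>
       (\<forall>z. z \<notin> K \<longrightarrow> \<not> is_pole F z \<longrightarrow>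
          F z = integral {-1..1} (\<lambda>t. \<omega> t / (z - \<gamma> * complex_of_real t)) +
                (\<Sum>p\<in>{p. p \<notin> K \<and> is_pole F p}. residue (\<lambda>\<zeta>. F \<zeta> / (z - \<zeta>)) p)))"
proof -
  \<comment> \<open>\<open>asc_bsq\<close> contains the exponent n - 1, so its value at
    \<open>Suc n\<close> covers all powers from q^0 on.\<close>
  have "A * q ^ n \<noteq> 1 \<and> B * q ^ n \<noteq> 1" for n
    using assms(12)[of "Suc n"] by (auto simp: asc_bsq_def)
  then interpret asc q A B \<delta> \<gamma>
    using assms by unfold_locales auto
  have K: "K = cut" by (simp add: K_def cut_def)
  have F: "F = asc_F" by (simp add: F_def asc_F_def[abs_def] \<alpha>_def \<beta>_def)
  show ?thesis
    unfolding K F poles_asc_F unfolding \<alpha>_def \<beta>_def R_def \<omega>_def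
  proof (intro conjI allI impI)
    show "finite (J ` Z)" using finite_Z by simp
  qed (rule quotient_formula quotient_formula_meromorphic integral_representation; assumption)+
qed

end
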